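(* Let $\alpha:\mathbb{R}\to\mathbb{R}^+=[0,\infty)$ be a convex symmetric (i.e. even) function of class $C^1$ such that $\alpha(0)=\alpha'(0)=0$ and $\alpha'$ is concave on $\mathbb{R}^+$. Define $c(x)=\sum_{i=1}^k\alpha(x_i)$ for $x=(x_1,\dots,x_k)\in\mathbb{R}^k$, and let $\mu$ be a probability measure on $\mathbb{R}^k$. The following propositions are equivalent: (1) There exists $C_1>0$ such that $\mu$ verifies the transport inequality $\mathbf{T}_c(C_1)$. (2) There exists $C_2>0$ such that $\mu$ verifies the inf-convolution logarithmic Sobolev inequality $\mathbf{ICLSI}(c,C_2)$. (3) There exists $C_3>0$ such that $\mu$ verifies the restricted modified logarithmic Sobolev inequality $\mathbf{rMLSI}(c,C_3)$. The constants are related as follows: (1) with constant $C_1$ implies (2) with $C_2=C_1$; (2) with constant $C_2$ implies (3) with $C_3=C_2$; and (3) with constant $C_3$ implies (1) with $C_1=8C_3$.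
   Context: Notation: $\mathcal{P}(\mathbb{R}^k)$ is the set of Borel probability measures on $\mathbb{R}^k$; $H(\nu|\mu)=\int\log\frac{d\nu}{d\mu}\,d\nu$ if $\nu\ll\mu$ and $+\infty$ otherwise; $\operatorname{Ent}_\mu(g)=\int g\log g\,d\mu-\int g\,d\mu\,\log\int g\,d\mu$; $c^*(u)=\sup_{h\in\mathbb{R}^k}\{u\cdot h-c(h)\}\in[0,+\infty]$. Transport cost: $\mathcal{T}_c(\nu,\mu)=\inf_\pi\iint c(x-y)\,d\pi(x,y)$, infimum over probability measures $\pi$ on $\mathbb{R}^k\times\mathbb{R}^k$ with marginals $\nu$ and $\mu$. $\mathbf{T}_c(C)$: $\mathcal{T}_c(\nu,\mu)\le C\,H(\nu|\mu)$ for all $\nu\in\mathcal{P}(\mathbb{R}^k)$. $\mathbf{ICLSI}(c,C)$: for all $\lambda\in(0,1/C)$ and all $f:\mathbb{R}^k\to\mathbb{R}$, $\operatorname{Ent}_\mu(e^f)\le\frac{1}{1-\lambda C}\int(f-Q^\lambda f)e^f\,d\mu$, where $Q^\lambda f(x)=\inf_{y\in\mathbb{R}^k}\{f(y)+\lambda c(x-y)\}$. $K$-semi-convexity: $f:\mathbb{R}^k\to\mathbb{R}$ is $K$-semi-convex ($K\in\mathbb{R}$) for the cost $c$ if for all $\lambda\in[0,1]$ and $x,y\in\mathbb{R}^k$, $f(\lambda x+(1-\lambda)y)\le\lambda f(x)+(1-\lambda)f(y)+\lambda K c((1-\lambda)(y-x))+(1-\lambda)K c(\lambda(y-x))$. $\mathbf{rMLSI}(c,C)$: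 for all $K\ge0$, $\eta>0$ with $\eta+K<1/C$ and all differentiable functions $f:\mathbb{R}^k\to\mathbb{R}$ that are $K$-semi-convex for the cost $c$, $\operatorname{Ent}_\mu(e^f)\le\frac{\eta}{1-C(\eta+K)}\int c^*\left(\frac{\nabla f}{\eta}\right)e^f\,d\mu$. Functions are understood to be measurable, and the functional inequalities are understood for functions $f$ for which the integrals make sense. *)

theory Defs
  imports "HOL-Probability.Probability"
begin

text \<open>
  Extended-valued integral \<open>\<integral>f\<^sup>+ - \<integral>f\<^sup>-\<close> of a real function. The Bochner integral is \<open>0\<close> on
  non-integrable functions and would make an infinite entropy vanish. Below, it is only applied
  to integrands whose negative part has a finite integral, so that \<open>\<infinity> - \<infinity>\<close> does not occur.
\<close>

definition ext_integral :: "'a measure \<Rightarrow> ('a \<Rightarrow> real) \<Rightarrow> ereal" where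
  "ext_integral M f =
     enn2ereal (\<integral>\<^sup>+ x. ennreal (f x) \<partial>M) - enn2ereal (\<integral>\<^sup>+ x. ennreal (- f x) \<partial>M)"

definition rel_entropy :: "'a measure \<Rightarrow> 'a measure \<Rightarrow> ereal" where
  "rel_entropy \<nu> \<mu> =
     (if absolutely_continuous \<mu> \<nu>
      then ext_integral \<nu> (\<lambda>x. ln (enn2real (RN_deriv \<mu> \<nu> x))) else \<infinity>)"

text \<open>Meant for \<open>g \<ge> 0\<close> with \<open>\<integral>g d\<mu> < \<infinity>\<close>; the value is then in \<open>[0, \<infinity>]\<close>.\<close>

definition Ent :: "'a measure \<Rightarrow> ('a \<Rightarrow> real) \<Rightarrow> ereal" where
  "Ent \<mu> g = ext_integral \<mu> (\<lambda>x. g x * ln (g x)) - ereal ((\<integral>x. g x \<partial>\<mu>) * ln (\<integral>x. g x \<partial>\<mu>))"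

definition sep_cost :: "(real \<Rightarrow> real) \<Rightarrow> real ^ 'k \<Rightarrow> real" where
  "sep_cost \<alpha> x = (\<Sum>i\<in>UNIV. \<alpha> (x $ i))"

definition conj_cost :: "(real ^ 'k \<Rightarrow> real) \<Rightarrow> real ^ 'k \<Rightarrow> ereal" where
  "conj_cost c u = (SUP h. ereal (u \<bullet> h - c h))"

definition couplings :: "(real ^ 'k) measure \<Rightarrow> (real ^ 'k) measure \<Rightarrow>
    ((real ^ 'k) \<times> (real ^ 'k)) measure set" where
  "couplings \<nu> \<mu> = {\<pi> \<in> space (prob_algebra (borel \<Otimes>\<^sub>M borel)).
     distr \<pi> borel fst = \<nu> \<and> distr \<pi> borel snd = \<mu>}"

definition transport_cost :: "(real ^ 'k \<Rightarrow> real) \<Rightarrow> (real ^ 'k) measure \<Rightarrow>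
    (real ^ 'k) measure \<Rightarrow> ennreal" where
  "transport_cost c \<nu> \<mu> = (INF \<pi>\<in>couplings \<nu> \<mu>. \<integral>\<^sup>+ (x, y). ennreal (c (x - y)) \<partial>\<pi>)"

definition transport_ineq :: "(real ^ 'k) measure \<Rightarrow> (real ^ 'k \<Rightarrow> real) \<Rightarrow> real \<Rightarrow> bool" where
  "transport_ineq \<mu> c C \<longleftrightarrow>
     (\<forall>\<nu> \<in> space (prob_algebra borel).
        enn2ereal (transport_cost c \<nu> \<mu>) \<le> ereal C * rel_entropy \<nu> \<mu>)"

text \<open>The infimum may be \<open>-\<infinity>\<close>.\<close>

definition inf_conv :: "(real ^ 'k \<Rightarrow> real) \<Rightarrow> real \<Rightarrow> (real ^ 'k \<Rightarrow> real) \<Rightarrow> real ^ 'k \<Rightarrow> ereal" where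
  "inf_conv c s f x = (INF y. ereal (f y + s * c (x - y)))"

text \<open>
  For a cost \<open>c \<ge> 0\<close> with \<open>c 0 = 0\<close>, both \<open>f - Q\<^sup>s f\<close> and \<open>c\<^sup>*\<close> are nonnegative, so the right-hand
  sides of the next two inequalities always make sense in \<open>[0, \<infinity>]\<close>, and the conversion \<open>e2ennreal\<close>
  does not truncate. The left-hand side makes sense in \<open>[0, \<infinity>]\<close> as soon as \<open>e\<^sup>f\<close> is integrable,
  because \<open>t \<mapsto> t ln t\<close> is bounded below; this is the only integrability required of \<open>f\<close>.
\<close>

definition ICLSI :: "(real ^ 'k) measure \<Rightarrow> (real ^ 'k \<Rightarrow> real) \<Rightarrow> real \<Rightarrow> bool" where
  "ICLSI \<mu> c C \<longleftrightarrow>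
     (\<forall>s f. 0 < s \<and> s < 1 / C \<and> f \<in> borel_measurable borel \<and>
        integrable \<mu> (\<lambda>x. exp (f x)) \<longrightarrow>
        Ent \<mu> (\<lambda>x. exp (f x)) \<le> ereal (1 / (1 - s * C)) *
          enn2ereal (\<integral>\<^sup>+ x. e2ennreal (ereal (f x) - inf_conv c s f x) * ennreal (exp (f x)) \<partial>\<mu>))"

definition semi_convex :: "(real ^ 'k \<Rightarrow> real) \<Rightarrow> real \<Rightarrow> (real ^ 'k \<Rightarrow> real) \<Rightarrow> bool" where
  "semi_convex c K f \<longleftrightarrow>
     (\<forall>s \<in> {0..1}. \<forall>x y. f (s *\<^sub>R x + (1 - s) *\<^sub>R y) \<le>
        s * f x + (1 - s) * f y +
        s * K * c ((1 - s) *\<^sub>R (y - x)) + (1 - s) * K * c (s *\<^sub>R (y - x)))"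

definition gradient :: "(real ^ 'k \<Rightarrow> real) \<Rightarrow> real ^ 'k \<Rightarrow> real ^ 'k" where
  "gradient f x = (THE D. GDERIV f x :> D)"

definition rMLSI :: "(real ^ 'k) measure \<Rightarrow> (real ^ 'k \<Rightarrow> real) \<Rightarrow> real \<Rightarrow> bool" where
  "rMLSI \<mu> c C \<longleftrightarrow>
     (\<forall>K \<eta> f. 0 \<le> K \<and> 0 < \<eta> \<and> \<eta> + K < 1 / C \<and> (\<forall>x. f differentiable (at x)) \<and>
        semi_convex c K f \<and> integrable \<mu> (\<lambda>x. exp (f x)) \<longrightarrow>
        Ent \<mu> (\<lambda>x. exp (f x)) \<le> ereal (\<eta> / (1 - C * (\<eta> + K))) *
          enn2ereal (\<integral>\<^sup>+ x. e2ennreal (conj_cost c (gradient f x /\<^sub>R \<eta>)) * ennreal (exp (f x)) \<partial>\<mu>))"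

end

theory Submission
  imports Defs
begin

text \<open>
  \<open>(1) \<Longrightarrow> (2)\<close>: for bounded \<open>f\<close> and \<open>\<nu> = e\<^sup>f \<mu> / Z\<close>, Jensen's inequality gives \<open>H(\<nu>|\<mu>) \<le> \<integral>f d\<nu> -
  \<integral>f d\<mu>\<close>, and integrating \<open>f x - f y \<le> (f - Q f) x + s c(x - y)\<close> against an almost optimal
  coupling lets the transport inequality absorb a part of \<open>H\<close>. Truncating \<open>f\<close> only decreases \<open>(f
  - Q f) e\<^sup>f\<close>, so Fatou's lemma covers the general case.

  \<open>(2) \<Longrightarrow> (3)\<close>: a semi-convex function lies above its tangents up to \<open>- K c\<close>, whence \<open>f - Q\<^sup>\<lambda> f \<le>
  \<eta> c\<^sup>*(\<nabla>f / \<eta>)\<close> pointwise for \<open>\<lambda> = K + \<eta>\<close>.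

  \<open>(3) \<Longrightarrow> (1)\<close>: the softmax \<open>f\<^sub>t\<close> of finitely many functions \<open>g\<^sub>j - t c((x - y\<^sub>j) / t)\<close>, a smooth
  sup-convolution, satisfies \<open>c\<^sup>*(\<nabla>f\<^sub>t) \<le> \<partial>\<^sub>t f\<^sub>t\<close>, and since \<open>\<alpha>'\<close> is concave it is semi-convex
  with a constant of order \<open>1 / t\<close>. By (3), \<open>(1 / a) ln \<integral>exp (a f\<^sub>t) d\<mu>\<close> is therefore
  nondecreasing in \<open>t\<close> along any schedule \<open>a(t)\<close> which decreases slowly enough. A schedule which
  vanishes at \<open>t = 1\<close> and exceeds \<open>1 / (8 C)\<close> at \<open>t = 7 / 25\<close> yields the inequality dual to the
  transport inequality with constant \<open>8 C\<close>. Kantorovich duality is needed only for finitely many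
  points: the dual inequality forces exponential tails of \<open>\<mu>\<close>, so that it suffices to discretise
  on a compact sublevel set of \<open>c\<close>.
\<close>

subsection \<open>Profiles with concave derivative\<close>

text \<open>The obstacle in the last implication is time zero: the semi-convexity constant
  \<open>1 / t\<close> of the flow blows up there, while the restricted inequality demands
  \<open>C * a / t < 1\<close>. The flow is therefore started at time \<open>7 / 25\<close>, where
  the kernel at \<open>y j\<close> already has the shape
  \<open>7 / 25 * c ((x - y j) /\<^sub>R (7 / 25))\<close>. At a net point close to \<open>x\<close>
  this costs only an amount that vanishes with the mesh. With u = C a, the schedule must satisfy u'
  >= -(1 - kappa u)^2 / 4, where kappa is 2 after time 1/2 and 1/t before. Backwards from u = 0 at
  time 1 it has to pass 1/8 while kappa u stays away from 1. The margin is small: the quadratic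
  subsolution reaches 1/8 near t = 0.287 and is still admissible at t = 0.26; \<open>7 / 25\<close>
  is a round value in between. Softmax replaces the maximum because the restricted inequality speaks
  of differentiable functions only. Being convex, log-sum-exp preserves the lower tangent bounds
  that give semi-convexity, and its excess \<open>ln (card J) / \<beta>\<close> disappears as
  \<beta> tends to infinity.\<close>

locale cost_profile =
  fixes \<alpha> :: "real \<Rightarrow> real"
  assumes nonneg: "\<And>t. 0 \<le> \<alpha> t"
    and convex: "convex_on UNIV \<alpha>"
    and even: "\<And>t. \<alpha> (- t) = \<alpha> t"
    and C1: "\<alpha> C1_differentiable_on UNIV"
    and zero: "\<alpha> 0 = 0"
    and deriv_zero: "deriv \<alpha> 0 = 0"
    and concave_deriv: "concave_on {0..} (deriv \<alpha>)"
begin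

lemma has_deriv: "(\<alpha> has_real_derivative deriv \<alpha> t) (at t)"
proof -
  have "\<alpha> differentiable at t"
    using C1 by (auto simp: C1_differentiable_on_eq)
  then show ?thesis
    by (simp add: DERIV_deriv_iff_real_differentiable)
qed

lemma has_deriv_chain [derivative_intros]:
  "(f has_real_derivative D) (at t within S) \<Longrightarrow>
    ((\<lambda>t. \<alpha> (f t)) has_real_derivative deriv \<alpha> (f t) * D) (at t within S)"
  by (rule DERIV_chain2[OF has_deriv])

lemma continuous_profile: "continuous_on UNIV \<alpha>"
  by (meson DERIV_isCont has_deriv continuous_at_imp_continuous_on)

lemma deriv_minus: "deriv \<alpha> (- t) = - deriv \<alpha> t"
proof -
  have "((\<lambda>t. \<alpha> (- t)) has_real_derivative deriv \<alpha> (- t) * (-1)) (at t)"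
    by (auto intro!: derivative_eq_intros)
  moreover have "(\<lambda>t. \<alpha> (- t)) = \<alpha>"
    by (auto simp: even)
  ultimately show ?thesis
    using DERIV_unique[OF has_deriv[of t]] by fastforce
qed

lemma tangent: "\<alpha> z + deriv \<alpha> z * (w - z) \<le> \<alpha> w"
proof -
  have "deriv \<alpha> z * (w - z) \<le> \<alpha> w - \<alpha> z"
    by (rule convex_on_imp_above_tangent[OF convex]) (auto intro: has_deriv)
  then show ?thesis by simp
qed

lemma deriv_mono: "x \<le> y \<Longrightarrow> deriv \<alpha> x \<le> deriv \<alpha> y"
proof -
  assume "x \<le> y"
  have "0 \<le> (deriv \<alpha> y - deriv \<alpha> x) * (y - x)"
    using tangent[of x y] tangent[of y x] by (simp add: algebra_simps)
  then show ?thesis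
    using \<open>x \<le> y\<close> by (cases "x = y") (auto simp: zero_le_mult_iff)
qed

lemma deriv_concave:
  assumes "0 \<le> x" "0 \<le> y" "0 \<le> u" "u \<le> 1"
  shows "(1 - u) * deriv \<alpha> x + u * deriv \<alpha> y \<le> deriv \<alpha> ((1 - u) * x + u * y)"
  using concave_deriv assms by (auto simp: concave_on_iff)

lemma deriv_scale: "0 \<le> x \<Longrightarrow> 0 \<le> u \<Longrightarrow> u \<le> 1 \<Longrightarrow> u * deriv \<alpha> x \<le> deriv \<alpha> (u * x)"
  using deriv_concave[of 0 x u] by (simp add: deriv_zero)

text \<open>A concave function on the half-line that vanishes at 0 is subadditive: \<open>x\<close>
  and \<open>y\<close> are fractions of \<open>x + y\<close>, and \<open>deriv_scale\<close> applies
  to each.\<close>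

lemma deriv_subadditive:
  assumes "0 \<le> x" "0 \<le> y"
  shows "deriv \<alpha> (x + y) \<le> deriv \<alpha> x + deriv \<alpha> y"
proof (cases "x + y = 0")
  case True
  then have "x = 0" "y = 0" using assms by auto
  then show ?thesis by (simp add: deriv_zero)
next
  case False
  then have pos: "x + y > 0" using assms by simp
  have "x / (x + y) * deriv \<alpha> (x + y) \<le> deriv \<alpha> (x / (x + y) * (x + y))"
    by (rule deriv_scale) (use assms pos in auto)
  moreover have "y / (x + y) * deriv \<alpha> (x + y) \<le> deriv \<alpha> (y / (x + y) * (x + y))"
    by (rule deriv_scale) (use assms pos in auto)
  moreover have "x / (x + y) * deriv \<alpha> (x + y) + y / (x + y) * deriv \<alpha> (x + y) = deriv \<alpha> (x + y)"
    using pos by (simp flip: distrib_right add_divide_distrib)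
  ultimately show ?thesis
    using pos by simp
qed

text \<open>An odd function that is concave on the half-line increases most over an interval of
  length \<open>h\<close> when the interval is centred at 0. If 0 lies inside, oddness turns the
  increment into a sum of two values whose arguments have midpoint \<open>h / 2\<close>; otherwise
  subadditivity gives the bound.\<close>

lemma deriv_diff_le:
  assumes "0 \<le> h"
  shows "deriv \<alpha> (z + h) - deriv \<alpha> z \<le> 2 * deriv \<alpha> (h / 2)"
proof -
  have h: "deriv \<alpha> h \<le> 2 * deriv \<alpha> (h / 2)"
    using deriv_subadditive[of "h / 2" "h / 2"] assms by simp
  consider "0 \<le> z" | "z < 0" "z + h \<ge> 0" | "z + h < 0" by linarith
  then show ?thesis
  proof cases
    case 1
    then show ?thesis using deriv_subadditive[of z h] assms h by simp
  next
    case 2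
    have eq: "h / 2 = (1 - 1/2) * (- z) + 1/2 * (z + h)" by (simp add: field_simps)
    have "(1 - 1/2) * deriv \<alpha> (- z) + 1/2 * deriv \<alpha> (z + h) \<le> deriv \<alpha> (h / 2)"
      unfolding eq by (rule deriv_concave) (use 2 in auto)
    then show ?thesis by (simp add: deriv_minus)
  next
    case 3
    have "deriv \<alpha> (- (z + h) + h) \<le> deriv \<alpha> (- (z + h)) + deriv \<alpha> h"
      by (rule deriv_subadditive) (use 3 assms in auto)
    moreover have "deriv \<alpha> (- (z + h) + h) = - deriv \<alpha> z" by (simp add: deriv_minus)
    ultimately show ?thesis using h deriv_minus[of "z + h"] by simp
  qed
qed

text \<open>This is \<open>deriv_diff_le\<close> integrated in \<open>h\<close>: the derivative of
  \<open>4 * \<alpha> (h / 2)\<close> is \<open>2 * deriv \<alpha> (h / 2)\<close>. Equality holds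
  for the square function. Every semi-convexity constant of the flow comes from this bound.\<close>

lemma second_order: "\<alpha> (z + h) \<le> \<alpha> z + deriv \<alpha> z * h + 4 * \<alpha> (h / 2)"
proof -
  have *: "\<alpha> (z + h) \<le> \<alpha> z + deriv \<alpha> z * h + 4 * \<alpha> (h / 2)" if "0 \<le> h" for z h
  proof -
    let ?\<psi> = "\<lambda>h. \<alpha> z + deriv \<alpha> z * h + 4 * \<alpha> (h / 2) - \<alpha> (z + h)"
    have "?\<psi> 0 \<le> ?\<psi> h"
    proof (rule DERIV_nonneg_imp_nondecreasing[OF that])
      fix x :: real assume "0 \<le> x" "x \<le> h"
      then show "\<exists>y. (?\<psi> has_real_derivative y) (at x) \<and> 0 \<le> y"
        using deriv_diff_le[of x z]
        by (intro exI[of _ "deriv \<alpha> z + 2 * deriv \<alpha> (x / 2) - deriv \<alpha> (z + x)"] conjI)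
           (auto intro!: derivative_eq_intros)
    qed
    then show ?thesis by (simp add: zero)
  qed
  show ?thesis
  proof (cases "0 \<le> h")
    case True
    then show ?thesis by (rule *)
  next
    case False
    then have "\<alpha> (- z + - h) \<le> \<alpha> (- z) + deriv \<alpha> (- z) * (- h) + 4 * \<alpha> (- h / 2)"
      by (intro *) auto
    moreover have "\<alpha> (- z + - h) = \<alpha> (z + h)" using even[of "z + h"] by simp
    ultimately show ?thesis using even[of "h / 2"] by (simp add: even deriv_minus)
  qed
qed

lemma abs_eq: "\<alpha> \<bar>x\<bar> = \<alpha> x"
  by (simp add: abs_if even)

text \<open>Concavity of \<alpha>' together with \<alpha>'(0) = 0 makes \<alpha>'(x) / x
  nonincreasing on the positive half-line, so \<alpha> grows at most quadratically.\<close>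

lemma subquadratic:
  assumes "0 < r" "r \<le> 1"
  shows "\<alpha> (h / r) \<le> \<alpha> h / r\<^sup>2"
proof -
  let ?\<psi> = "\<lambda>h. \<alpha> h / r\<^sup>2 - \<alpha> (h / r)"
  have "?\<psi> 0 \<le> ?\<psi> \<bar>h\<bar>"
  proof (rule DERIV_nonneg_imp_nondecreasing[where f = ?\<psi>])
    fix x :: real assume x: "0 \<le> x" "x \<le> \<bar>h\<bar>"
    have "r * deriv \<alpha> (x / r) \<le> deriv \<alpha> x"
      using deriv_scale[of "x / r" r] assms x by simp
    then have "0 \<le> deriv \<alpha> x / r\<^sup>2 - deriv \<alpha> (x / r) / r"
      using assms by (simp add: field_simps power2_eq_square)
    then show "\<exists>y. (?\<psi> has_real_derivative y) (at x) \<and> 0 \<le> y"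
      using assms
      by (intro exI[of _ "deriv \<alpha> x / r\<^sup>2 - deriv \<alpha> (x / r) / r"] conjI)
         (auto intro!: derivative_eq_intros simp: power2_eq_square)
  qed auto
  moreover have "\<alpha> (\<bar>h\<bar> / r) = \<alpha> (h / r)"
    using abs_eq[of "h / r"] assms by simp
  ultimately show ?thesis by (simp add: zero abs_eq)
qed

lemma scale_le: "0 \<le> r \<Longrightarrow> r \<le> 1 \<Longrightarrow> \<alpha> (r * h) \<le> r * \<alpha> h"
  using convex_onD[OF convex, of r 0 h] by (simp add: zero)

text \<open>Convexity at the midpoint of \<open>2 * x\<close> and \<open>2 * y\<close> halves the
  sum, and \<open>subquadratic\<close> charges a factor 4 for each doubling.\<close>

lemma quasi_triangle: "\<alpha> (x + y) \<le> 2 * \<alpha> x + 2 * \<alpha> y"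
proof -
  have "\<alpha> (x + y) = \<alpha> ((1 - 1/2) * (2 * x) + 1/2 * (2 * y))" by (simp add: algebra_simps)
  also have "\<dots> \<le> (1 - 1/2) * \<alpha> (2 * x) + 1/2 * \<alpha> (2 * y)"
    using convex_onD[OF convex, of "1/2" "2 * x" "2 * y"] by simp
  also have "\<dots> \<le> 2 * \<alpha> x + 2 * \<alpha> y"
    using subquadratic[of "1/2" x] subquadratic[of "1/2" y]
      by (simp add: power2_eq_square mult.commute)
  finally show ?thesis .
qed

lemma profile_le: "\<alpha> z \<le> z * deriv \<alpha> z"
  using tangent[of z 0] by (simp add: zero mult.commute)

text \<open>Concavity puts \<alpha>' above its chord on [0, z], and the chord integrates to z
  \<alpha>'(z) / 2. Together with \<open>profile_le\<close> this locates the Legendre value z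
  \<alpha>'(z) - \<alpha>(z) between 0 and \<alpha>(z), which controls the time derivative of the
  flow.\<close>

lemma deriv_le_profile: "z * deriv \<alpha> z \<le> 2 * \<alpha> z"
proof -
  have *: "z * deriv \<alpha> z \<le> 2 * \<alpha> z" if "0 < z" for z
  proof -
    let ?\<psi> = "\<lambda>w. \<alpha> w - w\<^sup>2 / (2 * z) * deriv \<alpha> z"
    have "?\<psi> 0 \<le> ?\<psi> z"
    proof (rule DERIV_nonneg_imp_nondecreasing[where f = ?\<psi>])
      fix x :: real assume x: "0 \<le> x" "x \<le> z"
      have "x / z * deriv \<alpha> z \<le> deriv \<alpha> x"
        using deriv_scale[of z "x / z"] x that by simp
      then show "\<exists>y. (?\<psi> has_real_derivative y) (at x) \<and> 0 \<le> y"
        using that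
        by (intro exI[of _ "deriv \<alpha> x - x / z * deriv \<alpha> z"] conjI)
           (auto intro!: derivative_eq_intros simp: field_simps)
    qed (use that in auto)
    then show ?thesis using that by (simp add: zero power2_eq_square)
  qed
  consider "z = 0" | "0 < z" | "0 < - z" by linarith
  then show ?thesis
  proof cases
    case 1
    then show ?thesis by (simp add: zero)
  qed (use *[of z] *[of "- z"] in \<open>auto simp: even deriv_minus\<close>)
qed

text \<open>Convexity between 0 and a point beyond \<open>t0\<close> forces at least linear growth
  there.\<close>

lemma coercive:
  assumes "\<alpha> t0 \<noteq> 0"
  obtains B where "\<And>t. \<alpha> t \<le> R \<Longrightarrow> \<bar>t\<bar> \<le> B"
proof -
  have pos: "\<alpha> t0 > 0" "t0 \<noteq> 0" using nonneg[of t0] assms zero by auto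
  have "\<bar>t\<bar> \<le> max \<bar>t0\<bar> (R * \<bar>t0\<bar> / \<alpha> t0)" if "\<alpha> t \<le> R" for t
  proof (cases "\<bar>t\<bar> \<le> \<bar>t0\<bar>")
    case False
    then have "\<alpha> (\<bar>t0\<bar> / \<bar>t\<bar> * \<bar>t\<bar>) \<le> \<bar>t0\<bar> / \<bar>t\<bar> * \<alpha> \<bar>t\<bar>"
      by (intro scale_le) (auto simp: field_simps)
    then have "\<alpha> t0 \<le> \<bar>t0\<bar> / \<bar>t\<bar> * \<alpha> t" using False by (simp add: abs_eq)
    also have "\<dots> \<le> \<bar>t0\<bar> / \<bar>t\<bar> * R" using that by (intro mult_left_mono) auto
    finally have "\<bar>t\<bar> \<le> R * \<bar>t0\<bar> / \<alpha> t0" using pos False by (simp add: field_simps)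
    then show ?thesis by simp
  qed simp
  then show ?thesis by (rule that)
qed

end

subsection \<open>Entropy\<close>

lemma ext_integral_eq_integral:
  assumes "integrable M f"
  shows "ext_integral M f = ereal (\<integral>x. f x \<partial>M)"
proof -
  have fin: "(\<integral>\<^sup>+ x. ennreal (f x) \<partial>M) < \<infinity>" "(\<integral>\<^sup>+ x. ennreal (- f x) \<partial>M) < \<infinity>"
    using assms by (auto simp: real_integrable_def top.not_eq_extremum)
  obtain p q where pq: "0 \<le> p" "0 \<le> q" "(\<integral>\<^sup>+ x. ennreal (f x) \<partial>M) = ennreal p"
    "(\<integral>\<^sup>+ x. ennreal (- f x) \<partial>M) = ennreal q"
    using fin by (metis enn2real_nonneg ennreal_enn2real infinity_ennreal_def)
  then show ?thesis
    unfolding ext_integral_def real_lebesgue_integral_def[OF assms] by (simp add: enn2ereal_ennreal)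
qed

text \<open>An integrable minorant makes the negative part finite, so the extended value is either
  infinity or an ordinary integral. In \<open>Gibbs\<close> this replaces a discussion of the
  integrability of the log-density.\<close>

lemma integral_le_ext_integral:
  assumes g: "integrable M g" and f: "f \<in> borel_measurable M" and le: "AE x in M. g x \<le> f x"
  shows "ereal (\<integral>x. g x \<partial>M) \<le> ext_integral M f"
proof -
  have neg: "(\<integral>\<^sup>+ x. ennreal (- f x) \<partial>M) < \<infinity>"
  proof -
    have "(\<integral>\<^sup>+ x. ennreal (- f x) \<partial>M) \<le> (\<integral>\<^sup>+ x. ennreal (- g x) \<partial>M)"
      using le by (intro nn_integral_mono_AE) (auto elim!: eventually_mono intro: ennreal_leI)
    also have "\<dots> < \<infinity>" using g by (auto simp: real_integrable_def top.not_eq_extremum)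
    finally show ?thesis .
  qed
  show ?thesis
  proof (cases "(\<integral>\<^sup>+ x. ennreal (f x) \<partial>M) = \<infinity>")
    case True
    then show ?thesis
      using neg unfolding ext_integral_def
      by (cases "\<integral>\<^sup>+ x. ennreal (- f x) \<partial>M") (auto simp: top_ennreal.rep_eq)
  next
    case False
    then have int: "integrable M f"
      using neg f by (auto simp: real_integrable_def)
    then show ?thesis
      using ext_integral_eq_integral[OF int] integral_mono_AE[OF g int le] by simp
  qed
qed

text \<open>For negative \<open>x\<close> the reciprocal is easier: the quadratic Taylor lower bound
  of exp(-x), multiplied by 1 + x + x^2, is at least 1.\<close>

lemma exp_le_quadratic:
  fixes x :: real
  assumes "\<bar>x\<bar> \<le> 1"
  shows "exp x \<le> 1 + x + x\<^sup>2"
proof (cases "0 \<le> x")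
  case True
  then show ?thesis using exp_bound[of x] assms by simp
next
  case False
  have "1 \<le> exp (- x) * (1 + x + x\<^sup>2)"
  proof -
    have "1 + - x + (- x)\<^sup>2 / 2 \<le> exp (- x)"
      by (rule exp_lower_Taylor_quadratic) (use False in simp)
    then have "(1 - x + x\<^sup>2 / 2) * (1 + x + x\<^sup>2) \<le> exp (- x) * (1 + x + x\<^sup>2)"
      using assms by (intro mult_right_mono) (auto simp: abs_le_iff intro!: add_nonneg_nonneg)
    moreover have "(1 - x + x\<^sup>2 / 2) * (1 + x + x\<^sup>2) = 1 + x\<^sup>2 / 2 * (1 - x + x\<^sup>2)"
      by (simp add: field_simps power2_eq_square)
    moreover have "0 \<le> x\<^sup>2 / 2 * (1 - x + x\<^sup>2)"
      using False by (intro mult_nonneg_nonneg) (auto intro!: add_nonneg_nonneg)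
    ultimately show ?thesis by linarith
  qed
  then have "exp x * 1 \<le> exp x * (exp (- x) * (1 + x + x\<^sup>2))" by (intro mult_left_mono) auto
  then show ?thesis by (simp add: mult.assoc[symmetric] flip: exp_add)
qed

text \<open>The function \<open>f\<close> may be non-measurable: \<open>ICLSI_imp_rMLSI\<close>
  applies this to \<open>conj_cost c\<close> of a gradient, whose measurability would need an
  argument of its own. A simple function below \<open>r * f\<close>, divided by \<open>r\<close>,
  lies below \<open>f\<close>.\<close>

lemma nn_integral_cmult_le:
  assumes "0 < r"
  shows "(\<integral>\<^sup>+ x. ennreal r * f x \<partial>M) \<le> ennreal r * (\<integral>\<^sup>+ x. f x \<partial>M)"
proof -
  have "integral\<^sup>S M g \<le> ennreal r * (\<integral>\<^sup>+ x. f x \<partial>M)"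
    if g: "simple_function M g" "g \<le> (\<lambda>x. ennreal r * f x)" for g
  proof -
    have inv: "ennreal r * ennreal (1 / r) = 1" "ennreal (1 / r) * ennreal r = 1"
      using assms by (simp_all flip: ennreal_mult')
    have inv': "ennreal r * (ennreal (1 / r) * y) = y" "ennreal (1 / r) * (ennreal r * y) = y" for y
      by (simp_all only: mult.assoc[symmetric] inv mult_1_left)
    have "integral\<^sup>S M g = (\<integral>\<^sup>+ x. g x \<partial>M)"
      using g(1) by (rule nn_integral_eq_simple_integral[symmetric])
    also have "\<dots> = (\<integral>\<^sup>+ x. ennreal r * (ennreal (1 / r) * g x) \<partial>M)"
      by (simp only: inv')
    also have "\<dots> = ennreal r * (\<integral>\<^sup>+ x. ennreal (1 / r) * g x \<partial>M)"
      by (rule nn_integral_cmult) (use g(1) in \<open>auto dest: borel_measurable_simple_function\<close>)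
    also have "(\<integral>\<^sup>+ x. ennreal (1 / r) * g x \<partial>M) \<le> (\<integral>\<^sup>+ x. f x \<partial>M)"
    proof (rule nn_integral_mono)
      fix x
      have "ennreal (1 / r) * g x \<le> ennreal (1 / r) * (ennreal r * f x)"
        using g(2) by (intro mult_left_mono) (auto simp: le_fun_def)
      then show "ennreal (1 / r) * g x \<le> f x" by (simp only: inv')
    qed
    finally show ?thesis by (simp add: mult_left_mono)
  qed
  then show ?thesis
    unfolding nn_integral_def[of M "\<lambda>x. ennreal r * f x"] by (auto intro!: SUP_least)
qed

section \<open>Exponential tilting and the variational inequality for relative entropy\<close>

context
  fixes \<mu> :: "'a measure" assumes \<mu>: "prob_space \<mu>"
begin

interpretation prob_space \<mu> by (rule \<mu>)

lemma exp_bounded_integrable: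
  fixes f :: "'a \<Rightarrow> real"
  assumes "f \<in> borel_measurable \<mu>" "\<And>x. \<bar>f x\<bar> \<le> M"
  shows "integrable \<mu> f" "integrable \<mu> (\<lambda>x. exp (f x))"
    "integrable \<mu> (\<lambda>x. exp (f x) * f x)" "0 < (\<integral>x. exp (f x) \<partial>\<mu>)"
proof -
  have e: "exp (f x) \<le> exp M" "exp (- M) \<le> exp (f x)" for x using assms(2)[of x]
    by (auto simp: abs_le_iff)
  show f: "integrable \<mu> f"
    by (rule integrable_const_bound[where B = M]) (use assms in auto)
  show i: "integrable \<mu> (\<lambda>x. exp (f x))"
    by (rule integrable_const_bound[where B = "exp M"]) (use assms e in auto)
  show "integrable \<mu> (\<lambda>x. exp (f x) * f x)"
    by (rule integrable_const_bound[where B = "exp M * M"])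
       (use assms e in \<open>auto simp: abs_mult intro!: mult_mono\<close>)
  have "exp (- M) = (\<integral>x. exp (- M) \<partial>\<mu>)" by (simp add: prob_space)
  also have "\<dots> \<le> (\<integral>x. exp (f x) \<partial>\<mu>)" by (rule integral_mono) (use i e in auto)
  finally show "0 < (\<integral>x. exp (f x) \<partial>\<mu>)" by (meson exp_gt_zero less_le_trans)
qed

lemma Ent_exp_bounded:
  fixes f :: "'a \<Rightarrow> real"
  assumes "f \<in> borel_measurable \<mu>" "\<And>x. \<bar>f x\<bar> \<le> M"
  shows "Ent \<mu> (\<lambda>x. exp (f x)) =
    ereal ((\<integral>x. exp (f x) * f x \<partial>\<mu>) - (\<integral>x. exp (f x) \<partial>\<mu>) * ln (\<integral>x. exp (f x) \<partial>\<mu>))"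
  unfolding Ent_def using exp_bounded_integrable[OF assms] by (simp add: ext_integral_eq_integral)

lemma Jensen_exp:
  fixes f :: "'a \<Rightarrow> real"
  assumes "f \<in> borel_measurable \<mu>" "\<And>x. \<bar>f x\<bar> \<le> M"
  shows "(\<integral>x. f x \<partial>\<mu>) \<le> ln (\<integral>x. exp (f x) \<partial>\<mu>)"
proof -
  note I = exp_bounded_integrable[OF assms]
  have "exp (\<integral>x. f x \<partial>\<mu>) \<le> (\<integral>x. exp (f x) \<partial>\<mu>)"
    by (rule jensens_inequality[where I = UNIV]) (use I in \<open>auto intro: exp_convex\<close>)
  then show ?thesis using I(4) by (simp add: ln_ge_iff)
qed

text \<open>A second-order expansion at \<open>a = 0\<close>, followed by ln z <= z - 1. It is used
  at the end of the flow, where \<open>a\<close> vanishes and the normalised log-Laplace transform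
  turns into a mean.\<close>

lemma log_Laplace_le:
  fixes f :: "'a \<Rightarrow> real"
  assumes "f \<in> borel_measurable \<mu>" "\<And>x. \<bar>f x\<bar> \<le> M" "0 < a" "a * M \<le> 1"
  shows "ln (\<integral>x. exp (a * f x) \<partial>\<mu>) / a \<le> (\<integral>x. f x \<partial>\<mu>) + a * M\<^sup>2"
proof -
  have M: "0 \<le> M" using assms(2)[of undefined] by linarith
  have [measurable]: "f \<in> borel_measurable \<mu>" by fact
  have b: "\<bar>a * f x\<bar> \<le> 1" for x
    using order_trans[OF mult_left_mono[OF assms(2)[of x], of a] assms(4)] assms(3)
    unfolding abs_mult by simp
  have i: "integrable \<mu> f" by (rule integrable_const_bound[where B = M]) (use assms in auto)
  note I = exp_bounded_integrable[of "\<lambda>x. a * f x" 1, OF _ b]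
  have "(\<integral>x. exp (a * f x) \<partial>\<mu>) \<le> (\<integral>x. 1 + a * f x + (a * M)\<^sup>2 \<partial>\<mu>)"
  proof (rule integral_mono)
    fix x
    have "exp (a * f x) \<le> 1 + a * f x + (a * f x)\<^sup>2"
      using b[of x] by (rule exp_le_quadratic)
    moreover have "(a * f x)\<^sup>2 \<le> (a * M)\<^sup>2"
      using assms(2)[of x] assms(3) M by (intro abs_le_square_iff[THEN iffD1]) (auto simp: abs_mult)
    ultimately show "exp (a * f x) \<le> 1 + a * f x + (a * M)\<^sup>2" by simp
  qed (use i I in auto)
  also have "\<dots> = 1 + (a * (\<integral>x. f x \<partial>\<mu>) + (a * M)\<^sup>2)" using i by (simp add: prob_space)
  finally have *: "(\<integral>x. exp (a * f x) \<partial>\<mu>) \<le> 1 + (a * (\<integral>x. f x \<partial>\<mu>) + (a * M)\<^sup>2)" .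
  have "ln (\<integral>x. exp (a * f x) \<partial>\<mu>) \<le> (\<integral>x. exp (a * f x) \<partial>\<mu>) - 1"
    using I(4) by (intro ln_le_minus_one) auto
  also have "\<dots> \<le> a * ((\<integral>x. f x \<partial>\<mu>) + a * M\<^sup>2)" using * by (simp add: algebra_simps power2_eq_square)
  finally show ?thesis using assms(3) by (simp add: field_simps)
qed

text \<open>The easy half of the Donsker-Varadhan formula. Let \<open>D\<close> be the density of
  \<nu> and W the ratio of the Gibbs density exp(\<phi>) / Z to \<open>D\<close>. Then 1 + ln W <= W
  says that \<phi> - ln Z + 1 - W is a minorant of ln D, and this minorant is integrable.\<close>

lemma Gibbs:
  fixes \<nu> :: "'a measure" and \<phi> :: "'a \<Rightarrow> real"
  assumes \<nu>: "prob_space \<nu>" "sets \<nu> = sets \<mu>"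
    and \<phi>: "\<phi> \<in> borel_measurable \<mu>" "\<And>x. \<bar>\<phi> x\<bar> \<le> M"
  shows "ereal ((\<integral>x. \<phi> x \<partial>\<nu>) - ln (\<integral>x. exp (\<phi> x) \<partial>\<mu>)) \<le> rel_entropy \<nu> \<mu>"
proof (cases "absolutely_continuous \<mu> \<nu>")
  case ac: True
  interpret \<nu>: prob_space \<nu> by fact
  note I = exp_bounded_integrable[OF \<phi>]
  let ?Z = "\<integral>x. exp (\<phi> x) \<partial>\<mu>"
  define D where "D x = enn2real (RN_deriv \<mu> \<nu> x)" for x
  have [measurable]: "D \<in> borel_measurable \<mu>" unfolding D_def by measurable
  have [measurable]: "\<phi> \<in> borel_measurable \<mu>" by fact
  have [measurable]: "\<phi> \<in> borel_measurable \<nu>" "D \<in> borel_measurable \<nu>"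
    using \<nu>(2) by (auto cong: measurable_cong_sets)
  have dens: "density \<mu> (RN_deriv \<mu> \<nu>) = \<nu>"
    by (rule density_RN_deriv) (use ac \<nu> in auto)
  have fin: "AE x in \<mu>. RN_deriv \<mu> \<nu> x \<noteq> \<infinity>"
    by (rule RN_deriv_finite) (use ac \<nu> \<nu>.sigma_finite_measure_axioms in auto)
  have dens': "\<nu> = density \<mu> (\<lambda>x. ennreal (D x))"
    unfolding D_def
    by (subst dens[symmetric], rule density_cong) (use fin in \<open>auto simp: less_top\<close>)
  have D0: "0 \<le> D x" for x by (simp add: D_def)
  have pos: "AE x in \<nu>. 0 < D x"
    by (subst dens') (auto simp: AE_density order.strict_iff_order D0)
  let ?W = "\<lambda>x. exp (\<phi> x) / (?Z * D x)"
  have W0: "0 \<le> ?W x" for x using I(4) D0 by simp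
  \<comment> \<open>Only an inequality: the Gibbs mass of the set where \<open>D\<close> vanishes is
    lost.\<close>
  have Wle: "(\<integral>\<^sup>+ x. ennreal (?W x) \<partial>\<nu>) \<le> 1"
  proof -
    have "(\<integral>\<^sup>+ x. ennreal (?W x) \<partial>\<nu>) = (\<integral>\<^sup>+ x. ennreal (D x) * ennreal (?W x) \<partial>\<mu>)"
      by (subst dens') (simp add: nn_integral_density)
    also have "\<dots> \<le> (\<integral>\<^sup>+ x. ennreal (exp (\<phi> x) / ?Z) \<partial>\<mu>)"
    proof (rule nn_integral_mono)
      fix x
      have "D x * ?W x \<le> exp (\<phi> x) / ?Z" using I(4) D0 by (cases "D x = 0") auto
      then show "ennreal (D x) * ennreal (?W x) \<le> ennreal (exp (\<phi> x) / ?Z)"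
        using D0 by (simp add: ennreal_leI flip: ennreal_mult')
    qed
    also have "\<dots> = ennreal (\<integral>x. exp (\<phi> x) / ?Z \<partial>\<mu>)"
      using I by (intro nn_integral_eq_integral) auto
    also have "\<dots> = 1" using I by simp
    finally show ?thesis .
  qed
  then have Wi: "integrable \<nu> ?W"
    using W0 by (intro integrableI_nonneg) (auto simp: top.extremum_strict le_less_trans[OF _
      ennreal_one_less_top])
  have W1: "(\<integral>x. ?W x \<partial>\<nu>) \<le> 1"
    using Wle nn_integral_eq_integral[OF Wi] W0 by simp
  have \<phi>i: "integrable \<nu> \<phi>"
    by (rule \<nu>.integrable_const_bound[where B = M]) (use \<phi> in auto)
  have "(\<integral>x. \<phi> x \<partial>\<nu>) - ln ?Z \<le> (\<integral>x. \<phi> x - ln ?Z + 1 - ?W x \<partial>\<nu>)"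
    using \<phi>i Wi W1 by (simp add: \<nu>.prob_space)
  also have "ereal \<dots> \<le> ext_integral \<nu> (\<lambda>x. ln (D x))"
  proof (rule integral_le_ext_integral)
    show "AE x in \<nu>. \<phi> x - ln ?Z + 1 - ?W x \<le> ln (D x)"
      using pos
    proof eventually_elim
      case (elim x)
      have "1 + (\<phi> x - ln ?Z - ln (D x)) \<le> exp (\<phi> x - ln ?Z - ln (D x))"
        by (rule exp_ge_add_one_self)
      also have "\<dots> = ?W x" using elim I(4) by (simp add: exp_diff)
      finally show ?case by simp
    qed
  qed (use \<phi>i Wi in auto)
  finally show ?thesis using ac by (simp add: rel_entropy_def D_def)
qed (simp add: rel_entropy_def)

lemma rel_entropy_nonneg:
  assumes "prob_space \<nu>" "sets \<nu> = sets \<mu>"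
  shows "0 \<le> rel_entropy \<nu> \<mu>"
  using Gibbs[OF assms, of "\<lambda>_. 0" 0] by (simp add: prob_space zero_ereal_def)

text \<open>The tilted measure is the equality case of \<open>Gibbs\<close> at \<phi> = f. Its
  Radon-Nikodym derivative is explicit up to a null set, so its entropy can be computed.\<close>

lemma exp_density:
  fixes f :: "'a \<Rightarrow> real"
  assumes f: "f \<in> borel_measurable \<mu>" "\<And>x. \<bar>f x\<bar> \<le> M"
  defines "Z \<equiv> \<integral>x. exp (f x) \<partial>\<mu>"
  defines "\<nu> \<equiv> density \<mu> (\<lambda>x. ennreal (exp (f x) / Z))"
  shows "prob_space \<nu>" "sets \<nu> = sets \<mu>"
    "\<And>g. g \<in> borel_measurable \<mu> \<Longrightarrow> (\<integral>x. g x \<partial>\<nu>) = (\<integral>x. exp (f x) * g x \<partial>\<mu>) / Z"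
    "rel_entropy \<nu> \<mu> = ereal ((\<integral>x. f x \<partial>\<nu>) - ln Z)"
proof -
  note I = exp_bounded_integrable[OF f]
  have Z: "0 < Z" using I by (simp add: Z_def)
  have [measurable]: "f \<in> borel_measurable \<mu>" by fact
  show sets: "sets \<nu> = sets \<mu>" by (simp add: \<nu>_def)
  have "(\<integral>\<^sup>+ x. ennreal (exp (f x) / Z) \<partial>\<mu>) = ennreal (\<integral>x. exp (f x) / Z \<partial>\<mu>)"
    using I Z by (intro nn_integral_eq_integral) auto
  also have "\<dots> = 1" using I Z by (simp add: Z_def)
  finally show \<nu>: "prob_space \<nu>"
    by (intro prob_spaceI) (simp add: \<nu>_def emeasure_density)
  interpret \<nu>: prob_space \<nu> by fact
  show "(\<integral>x. g x \<partial>\<nu>) = (\<integral>x. exp (f x) * g x \<partial>\<mu>) / Z" if [measurable]: "g \<in> borel_measurable \<mu>" for g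
    unfolding \<nu>_def using Z by (subst integral_density) (auto simp: less_imp_le)
  have ac: "absolutely_continuous \<mu> \<nu>"
    unfolding \<nu>_def by (rule absolutely_continuousI_density) measurable
  have "AE x in \<mu>. ennreal (exp (f x) / Z) = RN_deriv \<mu> \<nu> x"
    by (rule RN_deriv_unique) (simp_all add: \<nu>_def)
  then have "AE x in \<nu>. RN_deriv \<mu> \<nu> x = ennreal (exp (f x) / Z)"
    unfolding \<nu>_def by (subst AE_density) auto
  then have eq: "AE x in \<nu>. ln (enn2real (RN_deriv \<mu> \<nu> x)) = f x - ln Z"
    by eventually_elim (use Z in \<open>simp add: ln_div\<close>)
  have [measurable]: "(\<lambda>x. ln (enn2real (RN_deriv \<mu> \<nu> x))) \<in> borel_measurable \<nu>"
    using sets by (simp cong: measurable_cong_sets)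
  have fi: "integrable \<nu> f"
    by (rule \<nu>.integrable_const_bound[where B = M]) (use f in \<open>auto simp: \<nu>_def\<close>)
  have i: "integrable \<nu> (\<lambda>x. ln (enn2real (RN_deriv \<mu> \<nu> x)))"
    by (rule integrable_cong_AE_imp[of _ "\<lambda>x. f x - ln Z"]) (use fi eq in auto)
  have "(\<integral>x. ln (enn2real (RN_deriv \<mu> \<nu> x)) \<partial>\<nu>) = (\<integral>x. f x - ln Z \<partial>\<nu>)"
    by (rule integral_cong_AE) (use eq in \<open>auto simp: \<nu>_def\<close>)
  also have "\<dots> = (\<integral>x. f x \<partial>\<nu>) - ln Z" using fi by (simp add: \<nu>.prob_space)
  finally show "rel_entropy \<nu> \<mu> = ereal ((\<integral>x. f x \<partial>\<nu>) - ln Z)"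
    using ac i by (simp add: rel_entropy_def ext_integral_eq_integral)
qed

end

subsection \<open>From transport to inf-convolution\<close>

text \<open>In the uncountable infimum \<open>y\<close> is a mere index and each member is
  continuous in \<open>x\<close>. The infimum is thus upper semicontinuous: its strict sublevel sets
  are unions of open sets.\<close>

lemma borel_measurable_inf_conv:
  fixes c :: "real ^ 'k \<Rightarrow> real"
  assumes "continuous_on UNIV c"
  shows "inf_conv c s f \<in> borel_measurable borel"
proof (rule borel_measurableI_less)
  fix a :: ereal
  have "{x \<in> space borel. inf_conv c s f x < a} = (\<Union>y. {x. ereal (f y + s * c (x - y)) < a})"
    by (auto simp: inf_conv_def INF_less_iff)
  moreover have "open {x. ereal (f y + s * c (x - y)) < a}" for y
    by (intro open_Collect_less continuous_intros continuous_on_compose2[OF assms]) auto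
  ultimately show "{x \<in> space borel. inf_conv c s f x < a} \<in> sets borel"
    by (simp add: open_UN)
qed

context
  fixes c :: "real ^ 'k \<Rightarrow> real"
  assumes c_cont: "continuous_on UNIV c" and c_nonneg: "\<And>x. 0 \<le> c x" and c_zero: "c 0 = 0"
begin

lemma inf_conv_le_cost: "inf_conv c s f x \<le> ereal (f y + s * c (x - y))"
  unfolding inf_conv_def by (rule INF_lower) auto

lemma inf_conv_le: "inf_conv c s f x \<le> ereal (f x)"
  using inf_conv_le_cost[of s f x x] by (simp add: c_zero)

lemma inf_conv_ge:
  assumes "0 \<le> s" "\<And>y. m \<le> f y"
  shows "ereal m \<le> inf_conv c s f x"
  unfolding inf_conv_def
proof (rule INF_greatest)
  fix y
  have "0 \<le> s * c (x - y)" using assms c_nonneg by simp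
  then show "ereal m \<le> ereal (f y + s * c (x - y))" using assms(2)[of y] by simp
qed

definition inf_conv_real :: "real \<Rightarrow> (real ^ 'k \<Rightarrow> real) \<Rightarrow> real ^ 'k \<Rightarrow> real" where
  "inf_conv_real s f x = real_of_ereal (inf_conv c s f x)"

lemma borel_measurable_inf_conv_real [measurable]: "inf_conv_real s f \<in> borel_measurable borel"
  unfolding inf_conv_real_def[abs_def] using borel_measurable_inf_conv[OF c_cont] by measurable

lemma inf_conv_real:
  assumes "0 \<le> s" "\<And>y. \<bar>f y\<bar> \<le> M"
  shows "inf_conv c s f x = ereal (inf_conv_real s f x)" "- M \<le> inf_conv_real s f x"
    "inf_conv_real s f x \<le> f x" "inf_conv_real s f x \<le> f y + s * c (x - y)"
proof -
  have "ereal (- M) \<le> inf_conv c s f x" 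
    by (rule inf_conv_ge) (use assms in \<open>auto simp: abs_le_iff minus_le_iff\<close>)
  moreover note inf_conv_le_cost[of s f x y] inf_conv_le[of s f x]
  ultimately show "inf_conv c s f x = ereal (inf_conv_real s f x)" "- M \<le> inf_conv_real s f x"
    "inf_conv_real s f x \<le> f x" "inf_conv_real s f x \<le> f y + s * c (x - y)"
    unfolding inf_conv_real_def by (cases "inf_conv c s f x"; simp)+
qed

text \<open>The estimate is proved for the entropy \<open>H\<close> of the tilted measure and then
  multiplied by \<open>Z\<close>, because \<open>Z * H\<close> is the entropy of the exponential of
  \<open>f\<close>. Keeping \<open>1 - s * C\<close> on the left avoids a division.\<close>

lemma transport_imp_ICLSI_bounded:
  assumes \<mu>: "\<mu> \<in> space (prob_algebra borel)" and T: "transport_ineq \<mu> c C"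
    and C: "0 < C" and s: "0 < s"
    and f: "f \<in> borel_measurable borel" "\<And>x. \<bar>f x\<bar> \<le> M"
  defines "Z \<equiv> \<integral>x. exp (f x) \<partial>\<mu>"
  shows "(1 - s * C) * ((\<integral>x. exp (f x) * f x \<partial>\<mu>) - Z * ln Z)
    \<le> (\<integral>x. exp (f x) * (f x - inf_conv_real s f x) \<partial>\<mu>)"
proof -
  have \<mu>p: "prob_space \<mu>" and sets\<mu>[measurable_cong]: "sets \<mu> = sets borel"
    using \<mu> by (auto simp: space_prob_algebra)
  interpret \<mu>: prob_space \<mu> by fact
  have [measurable]: "f \<in> borel_measurable borel" by fact
  have f\<mu>: "f \<in> borel_measurable \<mu>" by measurable
  let ?q = "inf_conv_real s f"
  note q = inf_conv_real[of s f M, OF less_imp_le[OF s] f(2)]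
  define \<nu> where "\<nu> = density \<mu> (\<lambda>x. ennreal (exp (f x) / Z))"
  note I = exp_bounded_integrable[OF \<mu>p f\<mu> f(2), folded Z_def]
  note \<nu> = exp_density[OF \<mu>p f\<mu> f(2), folded Z_def, folded \<nu>_def]
  interpret \<nu>: prob_space \<nu> by (rule \<nu>)
  have sets\<nu>[measurable_cong]: "sets \<nu> = sets borel" using \<nu>(2) sets\<mu> by simp
  define H where "H = (\<integral>x. f x \<partial>\<nu>) - ln Z"
  have H: "rel_entropy \<nu> \<mu> = ereal H" using \<nu>(4) by (simp add: H_def)
  have H0: "0 \<le> H" using rel_entropy_nonneg[OF \<mu>p \<nu>(1,2)] H by simp
  let ?g = "\<lambda>x. f x - ?q x"
  have g: "\<bar>?g x\<bar> \<le> 2 * M" for x using q(2,3)[of x] f(2)[of x] by (simp add: abs_le_iff)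
  have gi: "integrable \<nu> ?g" by (rule \<nu>.integrable_const_bound[where B = "2 * M"]) (use g in auto)
  \<comment> \<open>The infimum over couplings is only approached, so a coupling of cost below
    \<open>C * H + e\<close> is used and \<open>e\<close> is removed afterwards.\<close>
  have le: "(1 - s * C) * H \<le> (\<integral>x. ?g x \<partial>\<nu>) + s * e" if "0 < e" for e
  proof -
    have "\<nu> \<in> space (prob_algebra borel)" using \<nu>(1) sets\<nu> by (simp add: space_prob_algebra)
    then have "enn2ereal (transport_cost c \<nu> \<mu>) \<le> ereal (C * H)"
      using T H by (auto simp: transport_ineq_def)
    then have "transport_cost c \<nu> \<mu> \<le> ennreal (C * H)"
      using C H0 by (simp add: less_eq_ennreal.rep_eq enn2ereal_ennreal)
    also have "\<dots> < ennreal (C * H + e)" using that C H0 by (simp add: ennreal_less_iff)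
    finally obtain \<pi> where \<pi>: "\<pi> \<in> couplings \<nu> \<mu>"
      and le: "(\<integral>\<^sup>+ (x, y). ennreal (c (x - y)) \<partial>\<pi>) < ennreal (C * H + e)"
      unfolding transport_cost_def by (auto simp: INF_less_iff)
    have sets\<pi>[measurable_cong]: "sets \<pi> = sets (borel \<Otimes>\<^sub>M borel)" and \<pi>p: "prob_space \<pi>"
      and fst: "distr \<pi> borel fst = \<nu>" and snd: "distr \<pi> borel snd = \<mu>"
      using \<pi> by (auto simp: couplings_def space_prob_algebra)
    interpret \<pi>: prob_space \<pi> by fact
    have [measurable]: "c \<in> borel_measurable borel"
      using c_cont by (rule borel_measurable_continuous_onI)
    have le': "(\<integral>\<^sup>+ p. ennreal (c (fst p - snd p)) \<partial>\<pi>) < ennreal (C * H + e)"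
      using le by (simp add: case_prod_unfold)
    have ci: "integrable \<pi> (\<lambda>p. c (fst p - snd p))"
      using c_nonneg less_trans[OF le' ennreal_less_top] by (intro integrableI_nonneg) auto
    have "ennreal (\<integral>p. c (fst p - snd p) \<partial>\<pi>) < ennreal (C * H + e)"
      using le' nn_integral_eq_integral[OF ci] c_nonneg by simp
    then have cle: "(\<integral>p. c (fst p - snd p) \<partial>\<pi>) \<le> C * H + e"
      using ennreal_leI less_imp_le ennreal_less_iff c_nonneg by (simp add: ennreal_less_iff)
    have fi: "integrable \<pi> (\<lambda>p. f (fst p))" "integrable \<pi> (\<lambda>p. f (snd p))"
      by (rule \<pi>.integrable_const_bound[where B = M]; use f in auto)+
    have gi\<pi>: "integrable \<pi> (\<lambda>p. ?g (fst p))"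
      by (rule \<pi>.integrable_const_bound[where B = "2 * M"]) (use g in auto)
    have eqs: "(\<integral>x. f x \<partial>\<nu>) = (\<integral>p. f (fst p) \<partial>\<pi>)" "(\<integral>x. f x \<partial>\<mu>) = (\<integral>p. f (snd p) \<partial>\<pi>)"
      "(\<integral>x. ?g x \<partial>\<nu>) = (\<integral>p. ?g (fst p) \<partial>\<pi>)"
      by (subst fst[symmetric] snd[symmetric], subst integral_distr, auto)+
    have "H \<le> (\<integral>x. f x \<partial>\<nu>) - (\<integral>x. f x \<partial>\<mu>)"
      using Jensen_exp[OF \<mu>p f\<mu> f(2)] by (simp add: H_def Z_def)
    also have "\<dots> = (\<integral>p. f (fst p) - f (snd p) \<partial>\<pi>)" using fi by (simp add: eqs)
    also have "\<dots> \<le> (\<integral>p. ?g (fst p) + s * c (fst p - snd p) \<partial>\<pi>)"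
    proof (rule integral_mono)
      fix p
      show "f (fst p) - f (snd p) \<le> ?g (fst p) + s * c (fst p - snd p)"
        using q(4)[of "fst p" "snd p"] by simp
    qed (use fi gi\<pi> ci in auto)
    also have "\<dots> = (\<integral>x. ?g x \<partial>\<nu>) + s * (\<integral>p. c (fst p - snd p) \<partial>\<pi>)"
      using gi\<pi> ci by (simp add: eqs)
    also have "\<dots> \<le> (\<integral>x. ?g x \<partial>\<nu>) + s * (C * H + e)" using cle s by simp
    finally show ?thesis by (simp add: algebra_simps)
  qed
  have "(1 - s * C) * H \<le> (\<integral>x. ?g x \<partial>\<nu>)"
  proof (rule field_le_epsilon)
    fix e :: real assume "0 < e"
    then show "(1 - s * C) * H \<le> (\<integral>x. ?g x \<partial>\<nu>) + e" using le[of "e / s"] s by simp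
  qed
  then have "Z * ((1 - s * C) * H) \<le> Z * (\<integral>x. ?g x \<partial>\<nu>)" using I(4) by (intro mult_left_mono) auto
  moreover have "Z * H = (\<integral>x. exp (f x) * f x \<partial>\<mu>) - Z * ln Z"
    using I(4) by (simp add: H_def \<nu>(3) algebra_simps)
  moreover have "Z * (\<integral>x. ?g x \<partial>\<nu>) = (\<integral>x. exp (f x) * ?g x \<partial>\<mu>)"
    using I(4) by (subst \<nu>(3)) auto
  ultimately show ?thesis by (metis mult.left_commute)
qed

section \<open>From bounded to general functions by truncation\<close>

definition truncate :: "nat \<Rightarrow> real \<Rightarrow> real" where
  "truncate n t = max (- real n) (min (real n) t)"

text \<open>If \<open>f x\<close> is cut from below, then \<open>f'\<close> is minimal at
  \<open>x\<close> and has no gap there. Otherwise \<open>f' x <= f x\<close>. Points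
  \<open>y\<close> with \<open>f y <= n\<close> can only have been raised, so the difference from
  \<open>x\<close> to \<open>y\<close> shrinks; points cut from above have the largest value
  \<open>n\<close> and contribute nothing positive.\<close>

lemma truncate_gap:
  assumes s: "0 \<le> s" and n: "f' = (\<lambda>x. truncate n (f x))"
  shows "ennreal (exp (f' x) * (f' x - inf_conv_real s f' x))
    \<le> e2ennreal (ereal (f x) - inf_conv c s f x) * ennreal (exp (f x))"
proof -
  have b: "\<bar>f' y\<bar> \<le> real n" for y by (auto simp: n truncate_def)
  note q = inf_conv_real[of s f' "real n" x, OF s b]
  have Q: "inf_conv c s f x \<le> ereal (f x)" by (rule inf_conv_le)
  show ?thesis
  proof (cases "f x \<le> - real n")
    case True
    then have "f' x = - real n" by (simp add: n truncate_def)
    then have "f' x - inf_conv_real s f' x \<le> 0" using q(2) by simp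
    then show ?thesis by (simp add: mult_nonneg_nonpos ennreal_neg)
  next
    case False
    have f'x: "f' x \<le> f x" "f' x \<le> real n" using False by (auto simp: n truncate_def)
    have "inf_conv c s f x + ereal (f' x) - ereal (f x) \<le> ereal (inf_conv_real s f' x)"
      unfolding q(1)[symmetric] unfolding inf_conv_def[of c s f' x]
    proof (rule INF_greatest)
      fix y
      have c: "0 \<le> s * c (x - y)" using s c_nonneg by simp
      show "inf_conv c s f x + ereal (f' x) - ereal (f x) \<le> ereal (f' y + s * c (x - y))"
      proof (cases "f y \<le> real n")
        case True
        then have "f y \<le> f' y" by (simp add: n truncate_def)
        moreover have "inf_conv c s f x \<le> ereal (f y + s * c (x - y))" by (rule inf_conv_le_cost)
        ultimately show ?thesis using f'x
          by (cases "inf_conv c s f x") auto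
      next
        case False
        then have "f' y = real n" by (simp add: n truncate_def)
        then show ?thesis using f'x c Q by (cases "inf_conv c s f x") auto
      qed
    qed
    then have gap: "ereal (f' x - inf_conv_real s f' x) \<le> ereal (f x) - inf_conv c s f x"
      using Q by (cases "inf_conv c s f x") auto
    have "ennreal (exp (f' x) * (f' x - inf_conv_real s f' x))
        = ennreal (f' x - inf_conv_real s f' x) * ennreal (exp (f' x))"
      by (simp add: ennreal_mult' mult.commute)
    also have "\<dots> \<le> e2ennreal (ereal (f x) - inf_conv c s f x) * ennreal (exp (f x))"
    proof (rule mult_mono)
      show "ennreal (f' x - inf_conv_real s f' x) \<le> e2ennreal (ereal (f x) - inf_conv c s f x)"
        using e2ennreal_mono[OF gap] by simp
    qed (use f'x in \<open>auto intro: ennreal_leI\<close>)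
    finally show ?thesis .
  qed
qed

theorem transport_imp_ICLSI:
  assumes \<mu>: "\<mu> \<in> space (prob_algebra borel)" and C: "0 < C" and T: "transport_ineq \<mu> c C"
  shows "ICLSI \<mu> c C"
  unfolding ICLSI_def
proof (intro allI impI, elim conjE)
  fix s and f :: "real ^ 'k \<Rightarrow> real"
  assume s: "0 < s" "s < 1 / C" and [measurable]: "f \<in> borel_measurable borel"
    and ei: "integrable \<mu> (\<lambda>x. exp (f x))"
  have \<mu>p: "prob_space \<mu>" and sets\<mu>[measurable_cong]: "sets \<mu> = sets borel"
    using \<mu> by (auto simp: space_prob_algebra)
  interpret \<mu>: prob_space \<mu> by fact
  have k: "0 < 1 - s * C" using s C by (simp add: field_simps)
  let ?G = "\<integral>\<^sup>+ x. e2ennreal (ereal (f x) - inf_conv c s f x) * ennreal (exp (f x)) \<partial>\<mu>"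
  show "Ent \<mu> (\<lambda>x. exp (f x)) \<le> ereal (1 / (1 - s * C)) * enn2ereal ?G"
  proof (cases "?G = \<infinity>")
    case True
    then show ?thesis using k by (simp add: top_ennreal.rep_eq)
  next
    case False
    then obtain G where G: "?G = ennreal G" "0 \<le> G" by (cases ?G) auto
    define r where "r = G / (1 - s * C)"
    define F where "F n x = truncate n (f x)" for n x
    have F[measurable]: "F n \<in> borel_measurable borel" for n
      unfolding F_def[abs_def] truncate_def by measurable
    have Fb: "\<bar>F n x\<bar> \<le> real n" for n x by (auto simp: F_def truncate_def)
    define Z where "Z n = (\<integral>x. exp (F n x) \<partial>\<mu>)" for n
    define Zf where "Zf = (\<integral>x. exp (f x) \<partial>\<mu>)"
    have lim: "(\<lambda>n. F n x) \<longlonglongrightarrow> f x" for x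
    proof (rule tendsto_eventually)
      obtain N where "\<bar>f x\<bar> \<le> real N" using real_arch_simple by blast
      then show "\<forall>\<^sub>F n in sequentially. F n x = f x"
        unfolding eventually_sequentially
        by (intro exI[of _ N]) (auto simp: F_def truncate_def)
    qed
    have Ei: "integrable \<mu> (\<lambda>x. exp (F n x))" "integrable \<mu> (\<lambda>x. exp (F n x) * F n x)" for n
      by (rule exp_bounded_integrable[OF \<mu>p _ Fb]; measurable)+
    have F_le: "exp (F n x) \<le> exp (f x) + 1" for n x
      by (cases "f x \<le> - real n") (auto simp: F_def truncate_def add_increasing add_increasing2)
    have Zlim: "Z \<longlonglongrightarrow> Zf"
      unfolding Z_def Zf_def
    proof (rule integral_dominated_convergence[where w = "\<lambda>x. exp (f x) + 1"])
      show "AE x in \<mu>. (\<lambda>n. exp (F n x)) \<longlonglongrightarrow> exp (f x)"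
        using lim by (intro AE_I2 tendsto_intros)
    qed (use ei F_le in auto)
    have Zf0: "0 < Zf"
    proof -
      have "Zf \<noteq> 0"
        using integral_nonneg_eq_0_iff_AE[OF ei] \<mu>.AE_False by (auto simp: Zf_def)
      moreover have "0 \<le> Zf" by (simp add: Zf_def)
      ultimately show ?thesis by simp
    qed
    have E: "(\<integral>x. exp (F n x) * F n x \<partial>\<mu>) \<le> r + Z n * ln (Z n)" for n
    proof -
      let ?q = "inf_conv_real s (F n)"
      have g: "0 \<le> F n x - ?q x" "F n x - ?q x \<le> 2 * real n" for x
        using inf_conv_real(2,3)[of s "F n" "real n" x, OF less_imp_le[OF s(1)] Fb] Fb[of n x]
        unfolding abs_le_iff by linarith+
      have gi: "integrable \<mu> (\<lambda>x. exp (F n x) * (F n x - ?q x))"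
      proof (rule \<mu>.integrable_const_bound[where B = "exp (real n) * (2 * real n)"], rule AE_I2)
        fix x
        have "exp (F n x) * (F n x - ?q x) \<le> exp (real n) * (2 * real n)"
          by (intro mult_mono g) (use g[of x] Fb[of n x] in \<open>simp_all add: abs_le_iff\<close>)
        then show "norm (exp (F n x) * (F n x - ?q x)) \<le> exp (real n) * (2 * real n)"
          using g[of x] by (simp add: abs_mult)
      qed measurable
      have "ennreal (\<integral>x. exp (F n x) * (F n x - ?q x) \<partial>\<mu>)
          = (\<integral>\<^sup>+ x. ennreal (exp (F n x) * (F n x - ?q x)) \<partial>\<mu>)"
        using g by (intro nn_integral_eq_integral[symmetric] gi) auto
      also have "\<dots> \<le> ?G"
        by (intro nn_integral_mono truncate_gap[of s _ n]) (use s in \<open>auto simp: F_def\<close>)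
      finally have "(\<integral>x. exp (F n x) * (F n x - ?q x) \<partial>\<mu>) \<le> G"
        using G by simp
      moreover have "(1 - s * C) * ((\<integral>x. exp (F n x) * F n x \<partial>\<mu>) - Z n * ln (Z n))
        \<le> (\<integral>x. exp (F n x) * (F n x - ?q x) \<partial>\<mu>)"
        unfolding Z_def by (rule transport_imp_ICLSI_bounded[OF \<mu> T C s(1) F Fb])
      ultimately show ?thesis using k by (simp add: r_def field_simps)
    qed
    \<comment> \<open>Adding 1 makes t exp(t) nonnegative, as Fatou's lemma requires. The same bound
      keeps the limiting right-hand side nonnegative, so that \<open>ennreal\<close> does not
      truncate it.\<close>
    have lb: "0 \<le> exp t * t + 1" for t :: real
    proof -
      have "exp (- t) \<ge> 1 + - t" by (rule exp_ge_add_one_self)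
      then have "exp t * exp (- t) \<ge> exp t * (- t)"
        using exp_gt_zero[of t] by (intro mult_left_mono) auto
      then show ?thesis by (simp flip: exp_add)
    qed
    have "(\<integral>\<^sup>+ x. ennreal (exp (f x) * f x + 1) \<partial>\<mu>)
        = (\<integral>\<^sup>+ x. liminf (\<lambda>n. ennreal (exp (F n x) * F n x + 1)) \<partial>\<mu>)"
    proof (rule nn_integral_cong)
      fix x
      have "(\<lambda>n. ennreal (exp (F n x) * F n x + 1)) \<longlonglongrightarrow> ennreal (exp (f x) * f x + 1)"
        by (intro tendsto_intros lim tendsto_ennrealI)
      then show "ennreal (exp (f x) * f x + 1) = liminf (\<lambda>n. ennreal (exp (F n x) * F n x + 1))"
        by (simp add: lim_imp_Liminf)
    qed
    also have "\<dots> \<le> liminf (\<lambda>n. \<integral>\<^sup>+ x. ennreal (exp (F n x) * F n x + 1) \<partial>\<mu>)"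
      by (rule nn_integral_liminf) measurable
    also have "\<dots> \<le> liminf (\<lambda>n. ennreal (r + Z n * ln (Z n) + 1))"
    proof (rule Liminf_mono, rule always_eventually, rule allI)
      fix n
      have "(\<integral>\<^sup>+ x. ennreal (exp (F n x) * F n x + 1) \<partial>\<mu>)
        = ennreal (\<integral>x. exp (F n x) * F n x + 1 \<partial>\<mu>)"
        using Ei lb by (intro nn_integral_eq_integral) auto
      also have "\<dots> \<le> ennreal (r + Z n * ln (Z n) + 1)"
        using Ei E[of n] by (intro ennreal_leI) (simp add: \<mu>.prob_space)
      finally show "(\<integral>\<^sup>+ x. ennreal (exp (F n x) * F n x + 1) \<partial>\<mu>)
        \<le> ennreal (r + Z n * ln (Z n) + 1)" .
    qed
    also have "\<dots> = ennreal (r + Zf * ln Zf + 1)"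
      using Zf0 by (intro lim_imp_Liminf tendsto_ennrealI tendsto_intros Zlim) auto
    finally have nn: "(\<integral>\<^sup>+ x. ennreal (exp (f x) * f x + 1) \<partial>\<mu>) \<le> ennreal (r + Zf * ln Zf + 1)" .
    have i1: "integrable \<mu> (\<lambda>x. exp (f x) * f x + 1)"
      using lb nn by (intro integrableI_nonneg) (auto intro: le_less_trans)
    then have i: "integrable \<mu> (\<lambda>x. exp (f x) * f x)"
      using Bochner_Integration.integrable_diff[OF i1 \<mu>.integrable_const[of 1]] by simp
    have "ennreal (\<integral>x. exp (f x) * f x + 1 \<partial>\<mu>) \<le> ennreal (r + Zf * ln Zf + 1)"
      using nn nn_integral_eq_integral[OF i1] lb by simp
    moreover have "0 \<le> r + Zf * ln Zf + 1"
      using G k lb[of "ln Zf"] Zf0 by (simp add: r_def add_nonneg_nonneg add.assoc)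
    ultimately have "(\<integral>x. exp (f x) * f x + 1 \<partial>\<mu>) \<le> r + Zf * ln Zf + 1"
      by simp
    then have "(\<integral>x. exp (f x) * f x \<partial>\<mu>) - Zf * ln Zf \<le> r"
      using i by (simp add: \<mu>.prob_space)
    then show ?thesis
      using i G by (simp add: Ent_def ext_integral_eq_integral Zf_def r_def enn2ereal_ennreal)
  qed
qed

end

subsection \<open>Separable costs and semi-convex functions\<close>

context cost_profile
begin

section \<open>The vector cost: scalar inequalities summed over coordinates\<close>

definition c :: "real ^ 'k \<Rightarrow> real" where "c = sep_cost \<alpha>"

definition dc :: "real ^ 'k \<Rightarrow> real ^ 'k" where "dc z = (\<chi> i. deriv \<alpha> (z $ i))"

lemma c_eq: "c x = (\<Sum>i\<in>UNIV. \<alpha> (x $ i))"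
  by (simp add: c_def sep_cost_def)

lemma c_nonneg: "0 \<le> c x"
  by (simp add: c_eq sum_nonneg nonneg)

lemma c_zero: "c 0 = 0"
  by (simp add: c_eq zero)

lemma c_minus: "c (- x) = c x"
  by (simp add: c_eq even)

lemma c_commute: "c (x - y) = c (y - x)"
  using c_minus[of "x - y"] by simp

lemma c_continuous: "continuous_on UNIV c"
  unfolding c_eq[abs_def]
  by (intro continuous_intros continuous_on_compose2[OF continuous_profile]) auto

lemma c_measurable [measurable]: "c \<in> borel_measurable borel"
  by (rule borel_measurable_continuous_onI[OF c_continuous])

lemma inner_dc: "dc z \<bullet> v = (\<Sum>i\<in>UNIV. deriv \<alpha> (z $ i) * v $ i)"
  by (simp add: inner_vec_def dc_def)

lemma c_has_derivative:
  assumes "(g has_derivative g') (at x within S)"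
  shows "((\<lambda>x. c (g x)) has_derivative (\<lambda>v. dc (g x) \<bullet> g' v)) (at x within S)"
proof -
  have *: "((\<lambda>x. \<alpha> (g x $ i)) has_derivative (\<lambda>v. deriv \<alpha> (g x $ i) * g' v $ i)) (at x within S)"
    for i
    by (rule has_derivative_compose[of "\<lambda>x. g x $ i" "\<lambda>v. g' v $ i" x S \<alpha> "(*) (deriv \<alpha> (g x $
      i))"])
       (use assms has_deriv in \<open>auto intro: bounded_linear.has_derivative[OF bounded_linear_vec_nth]
          simp: has_field_derivative_def\<close>)
  show ?thesis
    unfolding c_eq inner_dc by (rule has_derivative_sum) (rule *)
qed

lemma c_tangent: "c z + dc z \<bullet> (w - z) \<le> c w"
  unfolding c_eq inner_dc sum.distrib[symmetric]
  by (intro sum_mono) (use tangent in simp)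

lemma c_scale_le: "0 \<le> r \<Longrightarrow> r \<le> 1 \<Longrightarrow> c (r *\<^sub>R h) \<le> r * c h"
  unfolding c_eq sum_distrib_left by (intro sum_mono) (simp add: scale_le)

lemma c_shrink: "0 \<le> r \<Longrightarrow> r \<le> 1 \<Longrightarrow> c (r *\<^sub>R h) \<le> c h"
  by (rule order_trans[OF c_scale_le mult_left_le_one_le]) (auto simp: c_nonneg)

lemma c_subquadratic: "0 < r \<Longrightarrow> r \<le> 1 \<Longrightarrow> c (h /\<^sub>R r) \<le> c h / r\<^sup>2"
  unfolding c_eq sum_divide_distrib
  by (intro sum_mono) (use subquadratic in \<open>simp add: divide_inverse_commute\<close>)

lemma c_quasi_triangle: "c (x + y) \<le> 2 * c x + 2 * c y"
  unfolding c_eq sum_distrib_left sum.distrib[symmetric]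
    by (intro sum_mono) (simp add: quasi_triangle)

lemma c_diff_le: "c (x - y) \<le> 2 * c x + 2 * c y"
  using c_quasi_triangle[of x "- y"] by (simp add: c_minus)

lemma c_second_order: "c (z + h) \<le> c z + dc z \<bullet> h + 4 * c (h /\<^sub>R 2)"
  unfolding c_eq inner_dc sum_distrib_left sum.distrib[symmetric]
  by (intro sum_mono) (use second_order in simp)

lemma dc_inner_le: "z \<bullet> dc z \<le> 2 * c z"
  unfolding inner_commute[of z] inner_dc c_eq sum_distrib_left
  by (intro sum_mono) (use deriv_le_profile in \<open>simp add: mult.commute[of "deriv \<alpha> _"]\<close>)

lemma c_le_dc_inner: "c z \<le> z \<bullet> dc z"
  unfolding inner_commute[of z] inner_dc c_eq
  by (intro sum_mono) (use profile_le in \<open>simp add: mult.commute[of "deriv \<alpha> _"]\<close>)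

lemma conj_cost_nonneg: "0 \<le> conj_cost c u"
  unfolding conj_cost_def by (rule SUP_upper2[of 0]) (auto simp: c_zero zero_ereal_def)

section \<open>Gradients, and tangents of semi-convex functions\<close>

lemma GDERIV_imp_gradient:
  fixes f :: "real ^ 'k \<Rightarrow> real"
  assumes "GDERIV f x :> D"
  shows "gradient f x = D"
  unfolding gradient_def
proof (rule the_equality)
  show "GDERIV f x :> D" by fact
  fix E assume "GDERIV f x :> E"
  then have "(\<lambda>h. h \<bullet> E) = (\<lambda>h. h \<bullet> D)"
    using assms unfolding gderiv_def by (rule has_derivative_unique)
  then show "E = D" by (metis inner_commute vector_eq_rdot)
qed

lemma gradient_works:
  fixes f :: "real ^ 'k \<Rightarrow> real"
  assumes "f differentiable (at x)"
  shows "GDERIV f x :> gradient f x"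
proof -
  obtain f' where f': "(f has_derivative f') (at x)" using assms by (auto simp: differentiable_def)
  then have lin: "linear f'" by (rule has_derivative_linear)
  define D where "D = (\<Sum>b\<in>Basis. f' b *\<^sub>R b)"
  have "f' h = h \<bullet> D" for h
  proof -
    have "f' h = f' (\<Sum>b\<in>Basis. (h \<bullet> b) *\<^sub>R b)" by (simp add: euclidean_representation)
    also have "\<dots> = (\<Sum>b\<in>Basis. (h \<bullet> b) * f' b)"
      using lin by (simp add: linear_sum linear_scale)
    finally show ?thesis by (simp add: D_def inner_sum_right mult.commute)
  qed
  then have "f' = (\<lambda>h. h \<bullet> D)" by blast
  then have "GDERIV f x :> D" using f' by (simp add: gderiv_def)
  then show ?thesis by (simp add: GDERIV_imp_gradient)
qed

text \<open>Semi-convexity along the segment is divided by its parameter t, which tends to 0. The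
  term K c(t d) / t disappears because \<open>c\<close> has derivative 0 at 0, and the other cost
  term stays below K c(d).\<close>

lemma semi_convex_tangent:
  fixes f :: "real ^ 'k \<Rightarrow> real"
  assumes f: "semi_convex c K f" and K: "0 \<le> K" and D: "GDERIV f x :> D"
  shows "D \<bullet> (y - x) \<le> f y - f x + K * c (y - x)"
proof -
  define d where "d = y - x"
  have lin: "((\<lambda>t. x + t *\<^sub>R d) has_derivative (\<lambda>t. t *\<^sub>R d)) (at 0)"
    by (auto intro!: derivative_eq_intros)
  have "(f has_derivative (\<lambda>h. h \<bullet> D)) (at (x + 0 *\<^sub>R d))" using D by (simp add: gderiv_def)
  from has_derivative_compose[OF lin this]
  have "((\<lambda>t. f (x + t *\<^sub>R d)) has_real_derivative D \<bullet> d) (at 0)"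
    by (simp add: has_field_derivative_def inner_commute mult.commute[of _ "D \<bullet> d"])
  then have 1: "((\<lambda>t. (f (x + t *\<^sub>R d) - f x) / t) \<longlongrightarrow> D \<bullet> d) (at_right 0)"
    by (auto simp: DERIV_def intro: filterlim_mono[OF _ order_refl at_le])
  have "((\<lambda>t. t *\<^sub>R d) has_derivative (\<lambda>t. t *\<^sub>R d)) (at 0)"
    by (auto intro!: derivative_eq_intros)
  from c_has_derivative[OF this]
  have "((\<lambda>t. c (t *\<^sub>R d)) has_real_derivative 0) (at 0)"
    by (simp add: has_field_derivative_def inner_dc deriv_zero mult_zero_left[abs_def])
  then have 2: "((\<lambda>t. c (t *\<^sub>R d) / t) \<longlongrightarrow> 0) (at_right 0)"
    by (auto simp: DERIV_def c_zero intro: filterlim_mono[OF _ order_refl at_le])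
  have "D \<bullet> d \<le> f y - f x + K * c d + K * 0"
  proof (rule tendsto_le[OF _ _ 1])
    show "((\<lambda>t. f y - f x + K * c d + K * (c (t *\<^sub>R d) / t)) \<longlongrightarrow> f y - f x + K * c d + K * 0)
      (at_right 0)"
      by (intro tendsto_intros 2)
    show "\<forall>\<^sub>F t in at_right 0. (f (x + t *\<^sub>R d) - f x) / t
      \<le> f y - f x + K * c d + K * (c (t *\<^sub>R d) / t)"
      unfolding eventually_at_right_field
    proof (intro exI[of _ 1] conjI allI impI)
      fix t :: real assume t: "0 < t" "t < 1"
      have eq: "t *\<^sub>R y + (1 - t) *\<^sub>R x = x + t *\<^sub>R d" by (simp add: d_def algebra_simps)
      \<comment> \<open>The weight \<open>t\<close> sits on \<open>y\<close>, so the difference in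
        \<open>semi_convex\<close> is \<open>x - y\<close>; evenness of the cost turns it into
        \<open>d\<close>.\<close>
      have cd: "c (r *\<^sub>R (x - y)) = c (r *\<^sub>R d)" for r
        using c_minus[of "r *\<^sub>R d"] by (simp add: d_def flip: scaleR_minus_right)
      have "f (x + t *\<^sub>R d) \<le> t * f y + (1 - t) * f x + t * K * c ((1 - t) *\<^sub>R d) + (1 - t) * K * c
        (t *\<^sub>R d)"
        using f t unfolding semi_convex_def eq[symmetric] by (auto simp flip: cd)
      also have "\<dots> \<le> t * f y + (1 - t) * f x + t * K * c d + 1 * K * c (t *\<^sub>R d)"
        using t K by (intro add_mono mult_mono mult_left_mono order_refl c_shrink) (auto simp:
          c_nonneg)
      finally have "f (x + t *\<^sub>R d) - f x \<le> t * (f y - f x + K * c d + K * (c (t *\<^sub>R d) / t))"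
        using t by (simp add: algebra_simps)
      then show "(f (x + t *\<^sub>R d) - f x) / t \<le> f y - f x + K * c d + K * (c (t *\<^sub>R d) / t)"
        using t by (simp add: divide_le_eq mult.commute)
    qed simp
  qed simp
  then show ?thesis by (simp add: d_def)
qed

text \<open>The Fenchel-Young inequality, scaled by \<eta>, bounds the tangent term by \<eta> c(x -
  y) plus \<eta> times the conjugate. The loss K c(x - y) in the tangent inequality is paid by the
  remaining part of the parameter \<open>\<eta> + K\<close>.\<close>

lemma inf_conv_gap_le_conj_cost:
  fixes f :: "real ^ 'k \<Rightarrow> real"
  assumes f: "semi_convex c K f" "f differentiable (at x)" and K: "0 \<le> K" and \<eta>: "0 < \<eta>"
  shows "e2ennreal (ereal (f x) - inf_conv c (\<eta> + K) f x)
    \<le> ennreal \<eta> * e2ennreal (conj_cost c (gradient f x /\<^sub>R \<eta>))"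
proof (cases "conj_cost c (gradient f x /\<^sub>R \<eta>) = \<infinity>")
  case True
  then show ?thesis using \<eta> by (simp add: ennreal_mult_top)
next
  case False
  then obtain r where r: "conj_cost c (gradient f x /\<^sub>R \<eta>) = ereal r"
    using conj_cost_nonneg[of "gradient f x /\<^sub>R \<eta>"]
      by (cases "conj_cost c (gradient f x /\<^sub>R \<eta>)") auto
  have "ereal (f x - \<eta> * r) \<le> inf_conv c (\<eta> + K) f x"
    unfolding inf_conv_def
  proof (rule INF_greatest)
    fix y
    have "ereal ((gradient f x /\<^sub>R \<eta>) \<bullet> (x - y) - c (x - y)) \<le> conj_cost c (gradient f x /\<^sub>R \<eta>)"
      unfolding conj_cost_def by (rule SUP_upper) auto
    then have "(gradient f x \<bullet> (x - y)) / \<eta> - c (x - y) \<le> r" by (simp add: r divide_inverse_commute)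
    then have "gradient f x \<bullet> (x - y) - \<eta> * c (x - y) \<le> \<eta> * r" using \<eta> by (simp add: field_simps)
    moreover have "gradient f x \<bullet> (y - x) \<le> f y - f x + K * c (y - x)"
      by (rule semi_convex_tangent[OF f(1) K gradient_works[OF f(2)]])
    moreover have "gradient f x \<bullet> (x - y) = - (gradient f x \<bullet> (y - x))"
      by (simp add: inner_diff_right)
    ultimately show "ereal (f x - \<eta> * r) \<le> ereal (f y + (\<eta> + K) * c (x - y))"
      by (simp add: c_commute[of x y] algebra_simps)
  qed
  then have "ereal (f x) - inf_conv c (\<eta> + K) f x \<le> ereal (\<eta> * r)"
    by (cases "inf_conv c (\<eta> + K) f x") auto
  from e2ennreal_mono[OF this] show ?thesis using \<eta> by (simp add: r ennreal_mult')
qed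

theorem ICLSI_imp_rMLSI:
  fixes \<mu> :: "(real ^ 'k) measure"
  assumes C: "0 < C" and I: "ICLSI \<mu> c C"
  shows "rMLSI \<mu> c C"
  unfolding rMLSI_def
proof (intro allI impI, elim conjE)
  fix K \<eta> and f :: "real ^ 'k \<Rightarrow> real"
  assume K: "0 \<le> K" and \<eta>: "0 < \<eta>" "\<eta> + K < 1 / C"
    and f: "\<forall>x. f differentiable (at x)" "semi_convex c K f"
    and ei: "integrable \<mu> (\<lambda>x. exp (f x))"
  let ?s = "\<eta> + K"
  let ?A = "\<integral>\<^sup>+ x. e2ennreal (ereal (f x) - inf_conv c ?s f x) * ennreal (exp (f x)) \<partial>\<mu>"
  let ?B = "\<integral>\<^sup>+ x. e2ennreal (conj_cost c (gradient f x /\<^sub>R \<eta>)) * ennreal (exp (f x)) \<partial>\<mu>"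
  have "continuous_on UNIV f"
    using f(1) by (auto intro: differentiable_imp_continuous_on simp: differentiable_on_def)
  then have "f \<in> borel_measurable borel" by (rule borel_measurable_continuous_onI)
  then have Ent: "Ent \<mu> (\<lambda>x. exp (f x)) \<le> ereal (1 / (1 - ?s * C)) * enn2ereal ?A"
    using I K \<eta> ei by (auto simp: ICLSI_def)
  have k: "0 < 1 - ?s * C" using \<eta> C by (simp add: field_simps)
  have "?A \<le> (\<integral>\<^sup>+ x. ennreal \<eta> * (e2ennreal (conj_cost c (gradient f x /\<^sub>R \<eta>)) * ennreal (exp (f
    x))) \<partial>\<mu>)"
    unfolding mult.assoc[symmetric] using f K \<eta>
    by (intro nn_integral_mono mult_right_mono inf_conv_gap_le_conj_cost) auto
  also have "\<dots> \<le> ennreal \<eta> * ?B" by (rule nn_integral_cmult_le[OF \<eta>(1)])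
  finally have "enn2ereal ?A \<le> ereal \<eta> * enn2ereal ?B"
    using \<eta> by (simp add: less_eq_ennreal.rep_eq times_ennreal.rep_eq)
  then have "ereal (1 / (1 - ?s * C)) * enn2ereal ?A
    \<le> ereal (1 / (1 - ?s * C)) * (ereal \<eta> * enn2ereal ?B)"
    using k by (intro ereal_mult_left_mono) auto
  also have "\<dots> = ereal (\<eta> / (1 - C * ?s)) * enn2ereal ?B"
    by (simp add: mult.assoc[symmetric] mult.commute)
  finally show "Ent \<mu> (\<lambda>x. exp (f x)) \<le> ereal (\<eta> / (1 - C * ?s)) * enn2ereal ?B"
    using Ent by (rule order_trans[rotated])
qed

end

subsection \<open>Softmax\<close>

definition softmax :: "real \<Rightarrow> 'j set \<Rightarrow> ('j \<Rightarrow> real) \<Rightarrow> real" where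
  "softmax \<beta> J u = ln (\<Sum>j\<in>J. exp (\<beta> * u j)) / \<beta>"

definition softmax_weight :: "real \<Rightarrow> 'j set \<Rightarrow> ('j \<Rightarrow> real) \<Rightarrow> 'j \<Rightarrow> real" where
  "softmax_weight \<beta> J u j = exp (\<beta> * u j) / (\<Sum>j\<in>J. exp (\<beta> * u j))"

context
  fixes J :: "'j set" and \<beta> :: real
  assumes J: "finite J" "J \<noteq> {}" and \<beta>: "0 < \<beta>"
begin

lemma softmax_sum_pos: "0 < (\<Sum>j\<in>J. exp (\<beta> * u j))"
  using J by (intro sum_pos) auto

lemma softmax_weight_nonneg: "0 \<le> softmax_weight \<beta> J u j"
  using softmax_sum_pos[of u] by (simp add: softmax_weight_def less_imp_le)

lemma sum_softmax_weight: "(\<Sum>j\<in>J. softmax_weight \<beta> J u j) = 1"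
  using softmax_sum_pos[of u] by (simp add: softmax_weight_def flip: sum_divide_distrib)

text \<open>Comparison with one fixed index \<open>i\<close>. Taken at the constant index of the
  flow, it makes the weight of a kernel decay exponentially in its cost.\<close>

lemma softmax_weight_le:
  assumes "i \<in> J" shows "softmax_weight \<beta> J u j \<le> exp (\<beta> * (u j - u i))"
proof -
  have "exp (\<beta> * u i) \<le> (\<Sum>j\<in>J. exp (\<beta> * u j))"
    using J assms by (intro member_le_sum) auto
  then have "softmax_weight \<beta> J u j \<le> exp (\<beta> * u j) / exp (\<beta> * u i)"
    unfolding softmax_weight_def by (intro divide_left_mono) (auto simp: softmax_sum_pos)
  then show ?thesis by (simp add: exp_diff right_diff_distrib)
qed

lemma exp_softmax: "exp (\<beta> * softmax \<beta> J u) = (\<Sum>j\<in>J. exp (\<beta> * u j))"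
  using \<beta> softmax_sum_pos[of u] by (simp add: softmax_def)

lemma softmax_ge:
  assumes "j \<in> J" shows "u j \<le> softmax \<beta> J u"
proof -
  have "exp (\<beta> * u j) \<le> exp (\<beta> * softmax \<beta> J u)"
    unfolding exp_softmax using J assms by (intro member_le_sum) auto
  then show ?thesis using \<beta> by simp
qed

lemma softmax_le:
  assumes "\<And>j. j \<in> J \<Longrightarrow> u j \<le> m"
  shows "softmax \<beta> J u \<le> m + ln (real (card J)) / \<beta>"
proof -
  have "(\<Sum>j\<in>J. exp (\<beta> * u j)) \<le> (\<Sum>j\<in>J. exp (\<beta> * m))"
    using assms \<beta> by (intro sum_mono) simp
  then have "ln (\<Sum>j\<in>J. exp (\<beta> * u j)) \<le> ln (real (card J) * exp (\<beta> * m))"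
    using softmax_sum_pos[of u] by (simp add: ln_mono)
  also have "\<dots> = ln (real (card J)) + \<beta> * m"
    using J by (simp add: ln_mult card_gt_0_iff)
  finally show ?thesis using \<beta> by (simp add: softmax_def field_simps)
qed

text \<open>Convexity of log-sum-exp, as Jensen's inequality for the softmax weights at
  \<open>u\<close>: the weighted mean of exp(\<beta> (v j - u j)) is exactly the ratio of the two
  exponential sums.\<close>

lemma softmax_tangent:
  "softmax \<beta> J u + (\<Sum>j\<in>J. softmax_weight \<beta> J u j * (v j - u j)) \<le> softmax \<beta> J v"
proof -
  let ?p = "softmax_weight \<beta> J u"
  define m where "m = (\<Sum>j\<in>J. ?p j * (\<beta> * (v j - u j)))"
  have "exp m = exp m * (\<Sum>j\<in>J. ?p j * (1 + (\<beta> * (v j - u j) - m)))"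
    by (simp add: distrib_left sum.distrib sum_softmax_weight right_diff_distrib sum_subtractf m_def
        flip: sum_distrib_right)
  also have "\<dots> = (\<Sum>j\<in>J. ?p j * (exp m * (1 + (\<beta> * (v j - u j) - m))))"
    by (simp add: sum_distrib_left mult.left_commute)
  also have "\<dots> \<le> (\<Sum>j\<in>J. ?p j * exp (\<beta> * (v j - u j)))"
  proof (intro sum_mono mult_left_mono softmax_weight_nonneg)
    fix j
    have "exp m * (1 + (\<beta> * (v j - u j) - m)) \<le> exp m * exp (\<beta> * (v j - u j) - m)"
      by (intro mult_left_mono exp_ge_add_one_self) simp
    then show "exp m * (1 + (\<beta> * (v j - u j) - m)) \<le> exp (\<beta> * (v j - u j))"
      by (simp flip: exp_add)
  qed
  also have "\<dots> = exp (\<beta> * softmax \<beta> J v) / exp (\<beta> * softmax \<beta> J u)"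
    by (simp add: exp_softmax softmax_weight_def sum_divide_distrib right_diff_distrib exp_diff)
  finally have "m \<le> \<beta> * (softmax \<beta> J v - softmax \<beta> J u)"
    by (simp add: right_diff_distrib flip: exp_diff)
  moreover have "m = \<beta> * (\<Sum>j\<in>J. ?p j * (v j - u j))"
    by (simp add: m_def sum_distrib_left mult.left_commute)
  ultimately show ?thesis using \<beta> by simp
qed

lemma has_derivative_softmax:
  assumes "\<And>j. j \<in> J \<Longrightarrow> ((\<lambda>x. u x j) has_derivative u' j) (at x within S)"
  shows "((\<lambda>x. softmax \<beta> J (u x)) has_derivative
    (\<lambda>h. \<Sum>j\<in>J. softmax_weight \<beta> J (u x) j * u' j h)) (at x within S)"
proof -
  have "((\<lambda>x. softmax \<beta> J (u x)) has_derivative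
    (\<lambda>h. (\<Sum>j\<in>J. exp (\<beta> * u x j) * (\<beta> * u' j h)) * inverse (\<Sum>j\<in>J. exp (\<beta> * u x j)) / \<beta>)) (at x within
      S)"
    unfolding softmax_def using \<beta> softmax_sum_pos[of "u x"]
    by (auto intro!: derivative_eq_intros assms simp: fun_eq_iff divide_inverse sum_distrib_right
      ac_simps)
  moreover have "(\<lambda>h. (\<Sum>j\<in>J. exp (\<beta> * u x j) * (\<beta> * u' j h)) * inverse (\<Sum>j\<in>J. exp (\<beta> * u x j)) / \<beta>)
      = (\<lambda>h. \<Sum>j\<in>J. softmax_weight \<beta> J (u x) j * u' j h)"
    unfolding sum_distrib_right sum_divide_distrib softmax_weight_def
    by (intro ext sum.cong refl) (use \<beta> in \<open>simp add: divide_inverse\<close>)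
  ultimately show ?thesis by simp
qed

end

text \<open>The mean value theorem bounds the difference quotients by \<open>B\<close>, so dominated
  convergence applies along every sequence tending to \<open>t0\<close>.\<close>

lemma has_real_derivative_integral:
  fixes \<phi> :: "real \<Rightarrow> 'a \<Rightarrow> real"
  assumes \<mu>: "prob_space \<mu>" and t0: "t0 \<in> {lo<..<hi}"
    and meas: "\<And>t. t \<in> {lo<..<hi} \<Longrightarrow> \<phi> t \<in> borel_measurable \<mu>" "\<phi>' t0 \<in> borel_measurable \<mu>"
    and bd: "\<And>t x. t \<in> {lo<..<hi} \<Longrightarrow> \<bar>\<phi> t x\<bar> \<le> B" "\<And>t x. t \<in> {lo<..<hi} \<Longrightarrow> \<bar>\<phi>' t x\<bar> \<le> B"
    and deriv: "\<And>t x. t \<in> {lo<..<hi} \<Longrightarrow> ((\<lambda>t. \<phi> t x) has_real_derivative \<phi>' t x) (at t)"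
  shows "((\<lambda>t. \<integral>x. \<phi> t x \<partial>\<mu>) has_real_derivative (\<integral>x. \<phi>' t0 x \<partial>\<mu>)) (at t0)"
proof -
  interpret prob_space \<mu> by fact
  let ?S = "{lo<..<hi}"
  have int: "integrable \<mu> (\<phi> t)" if "t \<in> ?S" for t
    by (rule integrable_const_bound[where B = B]) (use that meas bd in auto)
  have lip: "\<bar>\<phi> s x - \<phi> t0 x\<bar> \<le> B * \<bar>s - t0\<bar>" if "s \<in> ?S" for s x
  proof -
    have "norm (\<phi> s x - \<phi> t0 x) \<le> B * norm (s - t0)"
      by (rule field_differentiable_bound[of ?S _ "\<lambda>t. \<phi>' t x"])
         (use that t0 bd(2) deriv in \<open>auto intro: has_field_derivative_at_within\<close>)
    then show ?thesis by simp
  qed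
  have "((\<lambda>t. \<integral>x. \<phi> t x \<partial>\<mu>) has_real_derivative (\<integral>x. \<phi>' t0 x \<partial>\<mu>)) (at t0 within ?S)"
    unfolding has_field_derivative_iff tendsto_at_iff_sequentially
  proof (intro allI impI)
    fix X :: "nat \<Rightarrow> real" assume X: "\<forall>i. X i \<in> ?S - {t0}" "X \<longlonglongrightarrow> t0"
    have "(\<lambda>n. \<integral>x. (\<phi> (X n) x - \<phi> t0 x) / (X n - t0) \<partial>\<mu>) \<longlonglongrightarrow> (\<integral>x. \<phi>' t0 x \<partial>\<mu>)"
    proof (rule integral_dominated_convergence[where w = "\<lambda>_. B"])
      show "(\<lambda>x. (\<phi> (X n) x - \<phi> t0 x) / (X n - t0)) \<in> borel_measurable \<mu>" for n
        using X t0 meas(1)[of "X n"] meas(1)[of t0] by auto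
      show "AE x in \<mu>. (\<lambda>n. (\<phi> (X n) x - \<phi> t0 x) / (X n - t0)) \<longlonglongrightarrow> \<phi>' t0 x"
      proof (rule AE_I2)
        fix x
        have "((\<lambda>t. \<phi> t x) has_real_derivative \<phi>' t0 x) (at t0 within ?S)"
          using deriv[OF t0] by (rule has_field_derivative_at_within)
        then show "(\<lambda>n. (\<phi> (X n) x - \<phi> t0 x) / (X n - t0)) \<longlonglongrightarrow> \<phi>' t0 x"
          using X unfolding has_field_derivative_iff tendsto_at_iff_sequentially
            by (auto simp: o_def)
      qed
      show "AE x in \<mu>. norm ((\<phi> (X n) x - \<phi> t0 x) / (X n - t0)) \<le> B" for n
        using lip[of "X n"] X by (intro AE_I2) (auto simp: divide_le_eq)
    qed (use meas in auto)
    moreover have "(\<integral>x. (\<phi> (X n) x - \<phi> t0 x) / (X n - t0) \<partial>\<mu>)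
        = ((\<integral>x. \<phi> (X n) x \<partial>\<mu>) - (\<integral>x. \<phi> t0 x \<partial>\<mu>)) / (X n - t0)" for n
      using int[of "X n"] int[OF t0] X by simp
    ultimately show "((\<lambda>t. ((\<integral>x. \<phi> t x \<partial>\<mu>) - (\<integral>x. \<phi> t0 x \<partial>\<mu>)) / (t - t0)) \<circ> X) \<longlonglongrightarrow> (\<integral>x. \<phi>' t0 x \<partial>\<mu>)"
      by (simp only: o_def)
  qed
  then show ?thesis by (simp only: at_within_open[OF t0 open_greaterThanLessThan])
qed

subsection \<open>The softmax flow\<close>

text \<open>An index with \<open>b j = 0\<close> contributes a constant. At least one is required: it keeps \<open>f\<close>
  bounded below.\<close>

locale softmax_flow = cost_profile +
  fixes J :: "nat set" and g b :: "nat \<Rightarrow> real" and y :: "nat \<Rightarrow> real ^ 'k"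
    and \<beta> :: real and j0 :: nat
  assumes J: "finite J" and \<beta>: "0 < \<beta>" and b: "\<And>j. b j = 0 \<or> b j = 1"
    and j0: "j0 \<in> J" "b j0 = 0"
begin

abbreviation z :: "real \<Rightarrow> real ^ 'k \<Rightarrow> nat \<Rightarrow> real ^ 'k" where
  "z t x j \<equiv> (x - y j) /\<^sub>R t"

text \<open>For \<open>b j = 1\<close> this is the Hopf-Lax kernel started at \<open>y j\<close>
  with height \<open>g j\<close>; a maximum over \<open>j\<close> would be the sup-convolution
  itself.\<close>

definition U :: "real \<Rightarrow> real ^ 'k \<Rightarrow> nat \<Rightarrow> real" where
  "U t x j = g j - b j * (t * c (z t x j))"

definition f :: "real \<Rightarrow> real ^ 'k \<Rightarrow> real" where
  "f t x = softmax \<beta> J (U t x)"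

definition P :: "real \<Rightarrow> real ^ 'k \<Rightarrow> nat \<Rightarrow> real" where
  "P t x = softmax_weight \<beta> J (U t x)"

text \<open>The bracket \<open>z \<bullet> dc z - c z\<close> is the Legendre transform of the cost
  at \<open>dc z\<close>, and also the derivative in t of -t c(w / t) at w = t z. \<open>D\<close>
  turns out to be the time derivative of \<open>f\<close>, and \<open>G\<close> its
  gradient.\<close>

definition D :: "real \<Rightarrow> real ^ 'k \<Rightarrow> real" where
  "D t x = (\<Sum>j\<in>J. P t x j * (b j * (z t x j \<bullet> dc (z t x j) - c (z t x j))))"

definition G :: "real \<Rightarrow> real ^ 'k \<Rightarrow> real ^ 'k" where
  "G t x = - (\<Sum>j\<in>J. (P t x j * b j) *\<^sub>R dc (z t x j))"

lemma J_ne: "J \<noteq> {}" using j0 by auto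

lemma b_nonneg: "0 \<le> b j"
  using b[of j] by auto

lemma P_nonneg: "0 \<le> P t x j"
  unfolding P_def by (rule softmax_weight_nonneg[OF J J_ne \<beta>])

lemma sum_P: "(\<Sum>j\<in>J. P t x j) = 1"
  unfolding P_def by (rule sum_softmax_weight[OF J J_ne \<beta>])

lemma has_derivative_f_time:
  assumes t: "0 < t"
  shows "((\<lambda>t. f t x) has_real_derivative D t x) (at t)"
proof -
  have *: "((\<lambda>t. U t x j) has_derivative
      (\<lambda>h. b j * (z t x j \<bullet> dc (z t x j) - c (z t x j)) * h)) (at t)" for j
  proof -
    have "((\<lambda>t. z t x j) has_derivative (\<lambda>h. (- (inverse t * h * inverse t)) *\<^sub>R (x - y j))) (at t)"
      using t by (auto intro!: derivative_eq_intros)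
    from c_has_derivative[OF this]
    have "((\<lambda>t. U t x j) has_derivative (\<lambda>h. - (b j * (h * c (z t x j)
        + t * (dc (z t x j) \<bullet> ((- (inverse t * h * inverse t)) *\<^sub>R (x - y j))))))) (at t)"
      unfolding U_def by (auto intro!: derivative_eq_intros simp: algebra_simps)
    moreover have "- (b j * (h * c (z t x j)
        + t * (dc (z t x j) \<bullet> ((- (inverse t * h * inverse t)) *\<^sub>R (x - y j)))))
        = b j * (z t x j \<bullet> dc (z t x j) - c (z t x j)) * h" for h
    proof -
      have "(- (inverse t * h * inverse t)) *\<^sub>R (x - y j) = (- (h * inverse t)) *\<^sub>R z t x j"
        by (simp add: mult.commute)
      then have "t * (dc (z t x j) \<bullet> ((- (inverse t * h * inverse t)) *\<^sub>R (x - y j)))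
        = - (h * (z t x j \<bullet> dc (z t x j)))"
        using t by (simp only: inner_scaleR_right inner_commute[of "dc _"]) (simp add: mult.commute)
      then show ?thesis by (simp only:) (simp add: right_diff_distrib mult.commute
        mult.left_commute)
    qed
    ultimately show ?thesis by simp
  qed
  have "((\<lambda>t. softmax \<beta> J (U t x)) has_derivative (\<lambda>h. \<Sum>j\<in>J. softmax_weight \<beta> J (U t x) j *
      (b j * (z t x j \<bullet> dc (z t x j) - c (z t x j)) * h))) (at t)"
    by (rule has_derivative_softmax[OF J J_ne \<beta>]) (rule *)
  then show ?thesis
    unfolding f_def D_def P_def
    by (rule has_derivative_imp_has_field_derivative) (simp only: sum_distrib_left ac_simps)
qed

lemma GDERIV_f:
  assumes t: "0 < t"
  shows "GDERIV (f t) x :> G t x"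
proof -
  have *: "((\<lambda>x. U t x j) has_derivative (\<lambda>h. - (b j * (dc (z t x j) \<bullet> h)))) (at x)" for j
  proof -
    have "((\<lambda>x. z t x j) has_derivative (\<lambda>h. h /\<^sub>R t)) (at x)"
      by (auto intro!: derivative_eq_intros)
    from c_has_derivative[OF this]
    show ?thesis
      unfolding U_def using t by (auto intro!: derivative_eq_intros)
  qed
  have "((\<lambda>x. f t x) has_derivative (\<lambda>h. \<Sum>j\<in>J. P t x j * - (b j * (dc (z t x j) \<bullet> h)))) (at x)"
    unfolding f_def P_def by (rule has_derivative_softmax[OF J J_ne \<beta>]) (rule *)
  moreover have "(\<Sum>j\<in>J. P t x j * - (b j * (dc (z t x j) \<bullet> h))) = h \<bullet> G t x" for h
    by (simp add: G_def inner_sum_right inner_commute[of h] sum_negf mult.assoc)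
  ultimately show ?thesis by (simp add: gderiv_def)
qed

lemma f_measurable [measurable]:
  assumes "0 < t" shows "f t \<in> borel_measurable borel"
proof -
  have "isCont (f t) x" for x
    using GDERIV_f[OF assms] unfolding gderiv_def by (rule has_derivative_continuous)
  then show ?thesis
    by (intro borel_measurable_continuous_onI continuous_at_imp_continuous_on) auto
qed

lemma D_measurable [measurable]: "D t \<in> borel_measurable borel"
proof -
  have [measurable]: "deriv \<alpha> \<in> borel_measurable borel"
    by (rule borel_measurable_mono) (simp add: mono_def deriv_mono)
  have [measurable]: "(\<lambda>x :: real ^ 'k. x $ i) \<in> borel_measurable borel" for i
    by (intro borel_measurable_continuous_onI continuous_intros)
  have [measurable]: "(\<lambda>x. z t x j \<bullet> dc (z t x j)) \<in> borel_measurable borel" for j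
    unfolding inner_commute[of "z t _ j"] inner_dc by measurable
  have [measurable]: "(\<lambda>x. P t x j) \<in> borel_measurable borel" for j
    unfolding P_def softmax_weight_def U_def by measurable
  show ?thesis
    unfolding D_def[abs_def] by measurable
qed

text \<open>The Hamilton-Jacobi inequality \<open>c\<^sup>*(\<nabla>f) \<le> \<partial>\<^sub>t f\<close>, with the supremum in \<open>c\<^sup>*\<close> spelled out.\<close>

lemma Legendre_le: "G t x \<bullet> v - c v \<le> D t x"
proof -
  have "G t x \<bullet> v - c v = (\<Sum>j\<in>J. P t x j * (- (b j * (dc (z t x j) \<bullet> v)) - c v))"
  proof -
    have "c v = (\<Sum>j\<in>J. P t x j * c v)" by (simp only: sum_distrib_right[symmetric] sum_P mult_1)
    then show ?thesis
      by (simp add: G_def inner_sum_left right_diff_distrib sum_subtractf sum_negf mult.assoc)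
  qed
  also have "\<dots> \<le> D t x"
    unfolding D_def
  proof (intro sum_mono mult_left_mono P_nonneg)
    fix j
    \<comment> \<open>The tangent inequality is taken at \<open>- v\<close> because \<open>G\<close>
      carries the opposite sign of \<open>dc\<close>. It is the Fenchel-Young inequality for a
      single kernel.\<close>
    have "c (z t x j) + dc (z t x j) \<bullet> (- v - z t x j) \<le> c v"
      using c_tangent[of "z t x j" "- v"] by (simp add: c_minus)
    then have *: "- (dc (z t x j) \<bullet> v) - c v \<le> z t x j \<bullet> dc (z t x j) - c (z t x j)"
      by (simp add: inner_diff_right inner_commute)
    show "- (b j * (dc (z t x j) \<bullet> v)) - c v \<le> b j * (z t x j \<bullet> dc (z t x j) - c (z t x j))"
      using b[of j]
    proof
      assume "b j = 1" then show ?thesis using * by simp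
    qed (simp add: c_nonneg)
  qed
  finally show ?thesis .
qed

text \<open>Subquadratic growth dualises: \<theta>^2 c(v / \<theta>) <= c(v) shows that shrinking
  the argument of the conjugate by \<theta> shrinks its value by \<theta>^2. This is the source of
  the factor (a / \<eta>)^2 in the entropy bound.\<close>

lemma conj_cost_G_le:
  assumes "0 < \<theta>" "\<theta> \<le> 1"
  shows "conj_cost c (\<theta> *\<^sub>R G t x) \<le> ereal (\<theta>\<^sup>2 * D t x)"
  unfolding conj_cost_def
proof (rule SUP_least)
  fix v
  have "\<theta>\<^sup>2 * (G t x \<bullet> (v /\<^sub>R \<theta>) - c (v /\<^sub>R \<theta>)) \<le> \<theta>\<^sup>2 * D t x"
    by (intro mult_left_mono Legendre_le) simp
  moreover have "\<theta>\<^sup>2 * c (v /\<^sub>R \<theta>) \<le> c v"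
    using c_subquadratic[OF assms, of v] assms by (simp add: field_simps)
  moreover have "\<theta>\<^sup>2 * (G t x \<bullet> (v /\<^sub>R \<theta>)) = (\<theta> *\<^sub>R G t x) \<bullet> v"
    using assms by (simp add: power2_eq_square)
  ultimately have "(\<theta> *\<^sub>R G t x) \<bullet> v - c v \<le> \<theta>\<^sup>2 * D t x"
    unfolding right_diff_distrib by linarith
  then show "ereal ((\<theta> *\<^sub>R G t x) \<bullet> v - c v) \<le> ereal (\<theta>\<^sup>2 * D t x)" by simp
qed

text \<open>By \<open>c_second_order\<close> each kernel lies above its tangent at the intermediate
  point up to \<kappa> c(h). Convexity of softmax, with the weights at that point, transfers the
  averaged lower bound to \<open>f\<close>.\<close>

lemma semi_convex_f:
  assumes t: "0 < t" and a: "0 \<le> a" and \<kappa>: "0 \<le> \<kappa>"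
    and bd: "\<And>h :: real ^ 'k. 4 * t * c (h /\<^sub>R (2 * t)) \<le> \<kappa> * c h"
  shows "semi_convex c (a * \<kappa>) (\<lambda>x. a * f t x)"
  unfolding semi_convex_def
proof (intro ballI allI)
  fix s :: real and x x' :: "real ^ 'k" assume s: "s \<in> {0..1}"
  define w where "w = s *\<^sub>R x + (1 - s) *\<^sub>R x'"
  have lower: "U t w j - b j * (dc (z t w j) \<bullet> h) - \<kappa> * c h \<le> U t (w + h) j" for j h
  proof -
    have "c (z t w j + h /\<^sub>R t) \<le> c (z t w j) + dc (z t w j) \<bullet> (h /\<^sub>R t) + 4 * c ((h /\<^sub>R t) /\<^sub>R 2)"
      by (rule c_second_order)
    moreover have "z t w j + h /\<^sub>R t = z t (w + h) j" by (simp add: algebra_simps)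
    ultimately have "t * c (z t (w + h) j)
        \<le> t * (c (z t w j) + dc (z t w j) \<bullet> (h /\<^sub>R t) + 4 * c ((h /\<^sub>R t) /\<^sub>R 2))"
      using t by (intro mult_left_mono) auto
    also have "\<dots> = t * c (z t w j) + dc (z t w j) \<bullet> h + 4 * t * c (h /\<^sub>R (2 * t))"
      using t by (simp add: algebra_simps)
    finally have *: "t * c (z t (w + h) j) \<le> t * c (z t w j) + dc (z t w j) \<bullet> h + \<kappa> * c h"
      using bd[of h] by simp
    show ?thesis
      using b[of j]
    proof
      assume "b j = 1" then show ?thesis using * by (simp add: U_def)
    qed (use \<kappa> c_nonneg[of h] in \<open>simp add: U_def\<close>)
  qed
  \<comment> \<open>The displacements from \<open>w\<close> to the two ends. Their average with
    weights \<open>s\<close> and \<open>1 - s\<close> is zero, so the tangent terms cancel and only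
    \<open>R\<close> remains.\<close>
  let ?h = "(- (1 - s)) *\<^sub>R (x' - x)" and ?h' = "s *\<^sub>R (x' - x)"
  have x: "w + ?h = x" "w + ?h' = x'" by (simp_all add: w_def algebra_simps)
  define R where "R = s * \<kappa> * c ((1 - s) *\<^sub>R (x' - x)) + (1 - s) * \<kappa> * c (s *\<^sub>R (x' - x))"
  have diff: "- R \<le> s * (U t x j - U t w j) + (1 - s) * (U t x' j - U t w j)" for j
  proof -
    have "s * (- b j * (dc (z t w j) \<bullet> ?h) - \<kappa> * c ?h)
        + (1 - s) * (- b j * (dc (z t w j) \<bullet> ?h') - \<kappa> * c ?h')
      \<le> s * (U t x j - U t w j) + (1 - s) * (U t x' j - U t w j)"
      using lower[of j ?h] lower[of j ?h'] s unfolding x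
      by (intro add_mono mult_left_mono) auto
    moreover have "c ?h = c ((1 - s) *\<^sub>R (x' - x))"
      using c_minus[of "(1 - s) *\<^sub>R (x' - x)"] by (simp only: scaleR_minus_left)
    ultimately show ?thesis by (simp add: R_def algebra_simps)
  qed
  have "f t w - R \<le> f t w + (\<Sum>j\<in>J. P t w j * (s * (U t x j - U t w j) + (1 - s) * (U t x' j - U t w
    j)))"
  proof -
    have "- R = (\<Sum>j\<in>J. P t w j * (- R))" by (simp only: sum_distrib_right[symmetric] sum_P mult_1)
    also have "\<dots> \<le> (\<Sum>j\<in>J. P t w j * (s * (U t x j - U t w j) + (1 - s) * (U t x' j - U t w j)))"
      by (intro sum_mono mult_left_mono diff P_nonneg)
    finally show ?thesis by simp
  qed
  also have "\<dots> = s * (f t w + (\<Sum>j\<in>J. P t w j * (U t x j - U t w j)))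
      + (1 - s) * (f t w + (\<Sum>j\<in>J. P t w j * (U t x' j - U t w j)))"
  proof -
    have "(\<Sum>j\<in>J. P t w j * (s * A j + (1 - s) * B j))
      = s * (\<Sum>j\<in>J. P t w j * A j) + (1 - s) * (\<Sum>j\<in>J. P t w j * B j)"
      for A B :: "nat \<Rightarrow> real"
      by (simp only: distrib_left sum.distrib sum_distrib_left mult.left_commute)
    then show ?thesis by (simp only:) (simp only: distrib_left, simp add: left_diff_distrib)
  qed
  also have "\<dots> \<le> s * f t x + (1 - s) * f t x'"
    unfolding f_def P_def using s
    by (intro add_mono mult_left_mono softmax_tangent[OF J J_ne \<beta>]) auto
  finally have "a * f t w \<le> a * (s * f t x + (1 - s) * f t x' + R)"
    using a by (intro mult_left_mono) auto
  then show "a * f t (s *\<^sub>R x + (1 - s) *\<^sub>R x') \<le> s * (a * f t x) + (1 - s) * (a * f t x')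
      + s * (a * \<kappa>) * c ((1 - s) *\<^sub>R (x' - x)) + (1 - s) * (a * \<kappa>) * c (s *\<^sub>R (x' - x))"
    by (simp add: w_def R_def algebra_simps)
qed

lemma D_nonneg: "0 \<le> D t x"
  unfolding D_def
  by (intro sum_nonneg mult_nonneg_nonneg P_nonneg b_nonneg) (simp only: diff_ge_0_iff_ge
    c_le_dc_inner)

lemma f_bounded:
  obtains M where "\<And>t x. 0 < t \<Longrightarrow> \<bar>f t x\<bar> \<le> M"
proof -
  define m where "m = Max (g ` J)"
  have "f t x \<le> m + ln (real (card J)) / \<beta>" if "0 < t" for t x
    unfolding f_def
  proof (rule softmax_le[OF J J_ne \<beta>])
    fix j assume "j \<in> J"
    then have "g j \<le> m" using J by (simp add: m_def)
    moreover have "0 \<le> b j * (t * c (z t x j))" using that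
      by (intro mult_nonneg_nonneg b_nonneg c_nonneg) auto
    ultimately show "U t x j \<le> m" by (simp add: U_def)
  qed
  moreover have "g j0 \<le> f t x" for t x
    using softmax_ge[OF J J_ne \<beta> j0(1), of "U t x"] j0 by (simp add: f_def U_def)
  ultimately have "\<bar>f t x\<bar> \<le> \<bar>m + ln (real (card J)) / \<beta>\<bar> + \<bar>g j0\<bar>" if "0 < t" for t x
    using that by (smt (verit, best))
  then show ?thesis by (rule that)
qed

text \<open>The bracket in \<open>D\<close> is at most the cost, while the weight decays like
  exp(-\<beta> t c) relative to the constant index \<open>j0\<close>; r exp(-r) <= 1 finishes. The
  bound depends on \<beta>, which is harmless: it serves only integrability and differentiation
  under the integral.\<close>

lemma D_bounded:
  assumes "0 < \<tau>"
  obtains B where "\<And>t x. \<tau> \<le> t \<Longrightarrow> D t x \<le> B"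
proof -
  define B where "B = (\<Sum>j\<in>J. exp (\<beta> * (g j - g j0)) / (\<beta> * \<tau>))"
  have "D t x \<le> B" if t: "\<tau> \<le> t" for t x
    unfolding D_def B_def
  proof (rule sum_mono)
    fix j
    let ?c = "c (z t x j)"
    show "P t x j * (b j * (z t x j \<bullet> dc (z t x j) - ?c)) \<le> exp (\<beta> * (g j - g j0)) / (\<beta> * \<tau>)"
      using b[of j]
    proof
      assume b: "b j = 1"
      have "P t x j * (b j * (z t x j \<bullet> dc (z t x j) - ?c)) \<le> P t x j * ?c"
        using dc_inner_le[of "z t x j"] b by (intro mult_left_mono P_nonneg) simp
      also have "\<dots> \<le> exp (\<beta> * (g j - t * ?c - g j0)) * ?c"
        using softmax_weight_le[OF J J_ne \<beta> j0(1), of "U t x" j] b j0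
        by (intro mult_right_mono c_nonneg) (simp add: P_def U_def)
      also have "\<dots> = exp (\<beta> * (g j - g j0)) * (exp (- (\<beta> * t * ?c)) * (\<beta> * t * ?c)) / (\<beta> * t)"
      proof -
        have "exp (\<beta> * (g j - t * ?c - g j0)) = exp (\<beta> * (g j - g j0)) * exp (- (\<beta> * t * ?c))"
          unfolding exp_add[symmetric] by (simp add: algebra_simps)
        then show ?thesis using \<beta> t assms by simp
      qed
      also have "\<dots> \<le> exp (\<beta> * (g j - g j0)) * 1 / (\<beta> * \<tau>)"
      proof (rule frac_le)
        have "\<beta> * t * ?c \<le> exp (\<beta> * t * ?c)"
          using exp_ge_add_one_self[of "\<beta> * t * ?c"] by linarith
        then have "exp (- (\<beta> * t * ?c)) * (\<beta> * t * ?c) \<le> exp (- (\<beta> * t * ?c)) * exp (\<beta> * t * ?c)"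
          by (rule mult_left_mono) simp
        then show "exp (\<beta> * (g j - g j0)) * (exp (- (\<beta> * t * ?c)) * (\<beta> * t * ?c))
          \<le> exp (\<beta> * (g j - g j0)) * 1"
          by (intro mult_left_mono) (simp_all flip: exp_add)
      qed (use \<beta> t assms in auto)
      finally show ?thesis by simp
    qed (use \<beta> assms in simp)
  qed
  then show ?thesis by (rule that)
qed

end

subsection \<open>Monotonicity of the log-Laplace functional along the flow\<close>

text \<open>The value at \<open>t = 7 / 25\<close> of the schedule in \<open>early_flow_mono\<close> below. The factor \<open>8\<close> of
  the theorem only requires that it is at least \<open>1 / (8 C)\<close>.\<close>

definition dual_rate :: "real \<Rightarrow> real" where "dual_rate C = 1569 / 12500 / C"

context softmax_flow
begin

text \<open>The regime changes where the scaling factor 1 / (2 t) crosses 1: shrinking the argument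
  is governed by convexity, stretching it by quadratic growth.\<close>

lemma curvature_bound:
  fixes h :: "real ^ 'k"
  shows "1 / 2 \<le> t \<Longrightarrow> 4 * t * c (h /\<^sub>R (2 * t)) \<le> 2 * c h"
    and "0 < t \<Longrightarrow> t \<le> 1 / 2 \<Longrightarrow> 4 * t * c (h /\<^sub>R (2 * t)) \<le> 1 / t * c h"
proof -
  assume "1 / 2 \<le> t"
  then have "c (h /\<^sub>R (2 * t)) \<le> inverse (2 * t) * c h"
    by (intro c_scale_le) (auto simp: field_simps)
  then have "4 * t * c (h /\<^sub>R (2 * t)) \<le> 4 * t * (inverse (2 * t) * c h)"
    using \<open>1 / 2 \<le> t\<close> by (intro mult_left_mono) auto
  then show "4 * t * c (h /\<^sub>R (2 * t)) \<le> 2 * c h" using \<open>1 / 2 \<le> t\<close> by (simp add: field_simps)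
next
  assume t: "0 < t" "t \<le> 1 / 2"
  then have "4 * t * c (h /\<^sub>R (2 * t)) \<le> 4 * t * (c h / (2 * t)\<^sup>2)"
    by (intro mult_left_mono c_subquadratic) auto
  also have "\<dots> = 1 / t * c h" using t by (simp add: power2_eq_square field_simps)
  finally show "4 * t * c (h /\<^sub>R (2 * t)) \<le> 1 / t * c h" .
qed

context
  fixes \<mu> :: "(real ^ 'k) measure" and C :: real
  assumes \<mu>: "\<mu> \<in> space (prob_algebra borel)" and rM: "rMLSI \<mu> c C" and C: "0 < C"
begin

lemma \<mu>p: "prob_space \<mu>" and sets\<mu>: "sets \<mu> = sets borel"
  using \<mu> by (auto simp: space_prob_algebra)

interpretation \<mu>: prob_space \<mu> by (rule \<mu>p)

lemma D_exp_integrable: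
  assumes [measurable]: "f t \<in> borel_measurable borel" and D: "\<And>x. D t x \<le> B"
    and N: "\<And>x. \<bar>a * f t x\<bar> \<le> N"
  shows "integrable \<mu> (\<lambda>x. D t x * exp (a * f t x))"
proof (rule \<mu>.integrable_const_bound[where B = "B * exp N"], rule AE_I2)
  note [measurable_cong] = sets\<mu>
  show "(\<lambda>x. D t x * exp (a * f t x)) \<in> borel_measurable \<mu>" by measurable
next
  fix x
  have "D t x * exp (a * f t x) \<le> B * exp N"
    using N[of x] D order_trans[OF D_nonneg D] by (intro mult_mono) (auto simp: abs_le_iff)
  then show "norm (D t x * exp (a * f t x)) \<le> B * exp N"
    using D_nonneg by (simp add: abs_mult)
qed

text \<open>The choice \<open>\<eta> = (1 - C K) / (2 C)\<close> maximises \<open>\<eta> (1 - C (\<eta> + K))\<close>, the admissible decay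
  rate of \<open>a\<close>.\<close>

lemma entropy_production:
  assumes t: "0 < t" and a: "0 < a" and \<kappa>: "0 \<le> \<kappa>" "C * a * \<kappa> < 1" "a \<le> (1 - C * a * \<kappa>) / (2 * C)"
    and bd: "\<And>h :: real ^ 'k. 4 * t * c (h /\<^sub>R (2 * t)) \<le> \<kappa> * c h"
  defines "Z \<equiv> \<integral>x. exp (a * f t x) \<partial>\<mu>"
  shows "(1 - C * a * \<kappa>)\<^sup>2 / (4 * C) * ((\<integral>x. exp (a * f t x) * (a * f t x) \<partial>\<mu>) - Z * ln Z)
    \<le> a\<^sup>2 * (\<integral>x. D t x * exp (a * f t x) \<partial>\<mu>)"
proof -
  note [measurable_cong] = sets\<mu>
  have [measurable]: "f t \<in> borel_measurable borel" using t by measurable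
  obtain M where M: "\<And>x. \<bar>f t x\<bar> \<le> M" using f_bounded t by metis
  obtain B where B: "\<And>x. D t x \<le> B" using D_bounded[OF t] by (metis order_refl)
  have aM: "\<bar>a * f t x\<bar> \<le> a * M" for x using M a by (simp add: abs_mult)
  note I = exp_bounded_integrable[OF \<mu>p _ aM]
  have i: "integrable \<mu> (\<lambda>x. D t x * exp (a * f t x))"
    by (rule D_exp_integrable[OF _ B aM]) measurable
  define E where "E = (\<integral>x. D t x * exp (a * f t x) \<partial>\<mu>)"
  have E0: "0 \<le> E" unfolding E_def by (intro integral_nonneg_AE AE_I2 mult_nonneg_nonneg D_nonneg)
    simp
  define K where "K = a * \<kappa>"
  define \<eta> where "\<eta> = (1 - C * K) / (2 * C)"
  have K: "0 \<le> K" "C * K < 1" using a \<kappa> by (auto simp: K_def mult.assoc)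
  \<comment> \<open>The bound \<open>a <= \<eta>\<close> makes the ratio \<open>a / \<eta>\<close>
    admissible as \<theta> in \<open>conj_cost_G_le\<close>.\<close>
  have \<eta>: "0 < \<eta>" "a \<le> \<eta>" using K C \<kappa> by (auto simp: \<eta>_def K_def mult.assoc)
  \<comment> \<open>With this \<eta> the prefactor of the restricted inequality is exactly
    \<open>1 / C\<close>. Multiplying the result by C \<eta>^2 then gives the decay rate in the
    conclusion.\<close>
  have \<eta>K: "\<eta> + K < 1 / C" "1 - C * (\<eta> + K) = C * \<eta>" using K C by (auto simp: \<eta>_def field_simps)
  have GD: "GDERIV (\<lambda>x. a * f t x) x :> a *\<^sub>R G t x" for x
    using GDERIV_f[OF t, of x] unfolding gderiv_def by (auto intro!: derivative_eq_intros)
  have diff: "\<forall>x. (\<lambda>x. a * f t x) differentiable (at x)"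
    using GD unfolding gderiv_def differentiable_def by blast
  have sc: "semi_convex c K (\<lambda>x. a * f t x)"
    unfolding K_def by (rule semi_convex_f[OF t less_imp_le[OF a] \<kappa>(1) bd])
  let ?R = "\<integral>\<^sup>+ x. e2ennreal (conj_cost c (gradient (\<lambda>x. a * f t x) x /\<^sub>R \<eta>)) * ennreal (exp (a * f
    t x)) \<partial>\<mu>"
  have "Ent \<mu> (\<lambda>x. exp (a * f t x)) \<le> ereal (\<eta> / (1 - C * (\<eta> + K))) * enn2ereal ?R"
    using rM K(1) \<eta>(1) \<eta>K(1) diff sc I(2) unfolding rMLSI_def by auto
  also have "\<dots> \<le> ereal (1 / C) * ereal ((a / \<eta>)\<^sup>2 * E)"
  proof (rule ereal_mult_mono)
    have "?R \<le> (\<integral>\<^sup>+ x. ennreal ((a / \<eta>)\<^sup>2 * (D t x * exp (a * f t x))) \<partial>\<mu>)"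
    proof (rule nn_integral_mono)
      fix x
      have "gradient (\<lambda>x. a * f t x) x /\<^sub>R \<eta> = (a / \<eta>) *\<^sub>R G t x"
        by (simp add: GDERIV_imp_gradient[OF GD] divide_inverse_commute)
      then have "conj_cost c (gradient (\<lambda>x. a * f t x) x /\<^sub>R \<eta>) \<le> ereal ((a / \<eta>)\<^sup>2 * D t x)"
        using conj_cost_G_le[of "a / \<eta>" t x] a \<eta> by simp
      from e2ennreal_mono[OF this]
      have "e2ennreal (conj_cost c (gradient (\<lambda>x. a * f t x) x /\<^sub>R \<eta>)) * ennreal (exp (a * f t x))
          \<le> ennreal ((a / \<eta>)\<^sup>2 * D t x) * ennreal (exp (a * f t x))"
        by (intro mult_right_mono) auto
      also have "\<dots> = ennreal ((a / \<eta>)\<^sup>2 * (D t x * exp (a * f t x)))"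
        using D_nonneg[of t x] by (simp add: mult.assoc flip: ennreal_mult)
      finally show "e2ennreal (conj_cost c (gradient (\<lambda>x. a * f t x) x /\<^sub>R \<eta>)) * ennreal (exp (a * f
        t x))
          \<le> ennreal ((a / \<eta>)\<^sup>2 * (D t x * exp (a * f t x)))" .
    qed
    also have "\<dots> = ennreal ((a / \<eta>)\<^sup>2 * E)"
      unfolding E_def using i D_nonneg by (subst nn_integral_eq_integral) auto
    finally show "enn2ereal ?R \<le> ereal ((a / \<eta>)\<^sup>2 * E)"
      using E0 by (simp add: less_eq_ennreal.rep_eq enn2ereal_ennreal)
    show "ereal (\<eta> / (1 - C * (\<eta> + K))) \<le> ereal (1 / C)"
      unfolding \<eta>K(2) using \<eta> by simp
  qed (use C in auto)
  finally have "(\<integral>x. exp (a * f t x) * (a * f t x) \<partial>\<mu>) - Z * ln Z \<le> 1 / C * ((a / \<eta>)\<^sup>2 * E)"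
    using Ent_exp_bounded[OF \<mu>p _ aM] unfolding Z_def by simp
  then have "C * \<eta>\<^sup>2 * ((\<integral>x. exp (a * f t x) * (a * f t x) \<partial>\<mu>) - Z * ln Z)
      \<le> C * \<eta>\<^sup>2 * (1 / C * ((a / \<eta>)\<^sup>2 * E))"
    using C by (intro mult_left_mono) auto
  also have "\<dots> = a\<^sup>2 * E" using C \<eta> by (simp add: power_divide)
  also have "C * \<eta>\<^sup>2 = (1 - C * a * \<kappa>)\<^sup>2 / (4 * C)"
    using C by (simp add: \<eta>_def K_def power_divide power_mult_distrib power2_eq_square mult.assoc)
  finally show ?thesis by (simp add: E_def)
qed

text \<open>A Herbst-type argument. The derivative of ln Z / a is (a' Ent + a^2 V) / (a^2 Z), where
  Ent is the entropy of exp(a f) and V the integral of D exp(a f). \<open>entropy_production\<close>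
  bounds Ent by V, and \<open>ode\<close> says that \<open>a\<close> decreases no faster than this
  bound allows. The larger interval from \<open>lo\<close> to \<open>hi\<close> leaves room for
  two-sided derivatives with uniform bounds.\<close>

lemma log_Laplace_flow_mono:
  assumes t12: "t1 \<le> t2" "lo < t1" "t2 < hi" and lo: "0 < lo"
    and a_deriv: "\<And>t. t \<in> {lo<..<hi} \<Longrightarrow> (a has_real_derivative a' t) (at t)"
    and a_bd: "\<And>t. t \<in> {lo<..<hi} \<Longrightarrow> \<bar>a t\<bar> \<le> A" "\<And>t. t \<in> {lo<..<hi} \<Longrightarrow> \<bar>a' t\<bar> \<le> A"
    and a: "\<And>t. t \<in> {t1..t2} \<Longrightarrow> 0 < a t" "\<And>t. t \<in> {t1..t2} \<Longrightarrow> a' t \<le> 0"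
    and \<kappa>: "\<And>t. t \<in> {t1..t2} \<Longrightarrow> 0 \<le> \<kappa> t" "\<And>t. t \<in> {t1..t2} \<Longrightarrow> C * a t * \<kappa> t < 1"
      "\<And>t. t \<in> {t1..t2} \<Longrightarrow> a t \<le> (1 - C * a t * \<kappa> t) / (2 * C)"
    and bd: "\<And>t h. t \<in> {t1..t2} \<Longrightarrow> 4 * t * c ((h :: real ^ 'k) /\<^sub>R (2 * t)) \<le> \<kappa> t * c h"
    and ode: "\<And>t. t \<in> {t1..t2} \<Longrightarrow> - a' t \<le> (1 - C * a t * \<kappa> t)\<^sup>2 / (4 * C)"
  shows "ln (\<integral>x. exp (a t1 * f t1 x) \<partial>\<mu>) / a t1 \<le> ln (\<integral>x. exp (a t2 * f t2 x) \<partial>\<mu>) / a t2"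
proof -
  note [measurable_cong] = sets\<mu>
  define Z where "Z t = (\<integral>x. exp (a t * f t x) \<partial>\<mu>)" for t
  obtain M where M: "\<And>t x. 0 < t \<Longrightarrow> \<bar>f t x\<bar> \<le> M" using f_bounded by metis
  obtain B where B: "\<And>t x. lo \<le> t \<Longrightarrow> D t x \<le> B" using D_bounded[OF lo] by metis
  have M0: "0 \<le> M" using M[of 1 0] by linarith
  have B0: "0 \<le> B" using B[of lo 0] D_nonneg[of lo 0] by linarith
  have A0: "0 \<le> A" using a_bd(1)[of t1] t12 by auto
  have afM: "\<bar>a t * f t x\<bar> \<le> A * M" if "t \<in> {lo<..<hi}" for t x
    unfolding abs_mult using a_bd(1)[OF that] M[of t x] lo that A0 by (intro mult_mono) auto
  have meas: "(\<lambda>x. a t * f t x) \<in> borel_measurable \<mu>" if "t \<in> {lo<..<hi}" for t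
  proof -
    have [measurable]: "f t \<in> borel_measurable borel" by (rule f_measurable) (use that lo in auto)
    show ?thesis by measurable
  qed
  have Z_deriv: "(Z has_real_derivative (\<integral>x. exp (a t * f t x) * (a' t * f t x + a t * D t x) \<partial>\<mu>))
    (at t)"
    if t: "t \<in> {lo<..<hi}" for t
    unfolding Z_def
  proof (rule has_real_derivative_integral[OF \<mu>p t, where B = "exp (A * M) * (1 + (A * M + A * B))"
        and \<phi> = "\<lambda>t x. exp (a t * f t x)" and \<phi>'
          = "\<lambda>t x. exp (a t * f t x) * (a' t * f t x + a t * D t x)"])
    fix s assume s: "s \<in> {lo<..<hi}"
    show "(\<lambda>x. exp (a s * f s x)) \<in> borel_measurable \<mu>" using meas[OF s] by measurable
    fix x
    have e: "exp (a s * f s x) \<le> exp (A * M)" using afM[OF s, of x] by (simp add: abs_le_iff)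
    have "exp (A * M) * 1 \<le> exp (A * M) * (1 + (A * M + A * B))"
      using A0 M0 B0 by (intro mult_left_mono) auto
    with e have "exp (a s * f s x) \<le> exp (A * M) * (1 + (A * M + A * B))" by linarith
    then show "\<bar>exp (a s * f s x)\<bar> \<le> exp (A * M) * (1 + (A * M + A * B))"
      by (simp only: abs_exp_cancel)
    have "\<bar>a' s * f s x + a s * D s x\<bar> \<le> \<bar>a' s\<bar> * \<bar>f s x\<bar> + \<bar>a s\<bar> * \<bar>D s x\<bar>"
      unfolding abs_mult[symmetric] by (rule abs_triangle_ineq)
    also have "\<dots> \<le> A * M + A * B"
      using a_bd[OF s] M[of s x] B[of s x] D_nonneg[of s x] s lo A0
        by (intro add_mono mult_mono) auto
    finally show "\<bar>exp (a s * f s x) * (a' s * f s x + a s * D s x)\<bar>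
      \<le> exp (A * M) * (1 + (A * M + A * B))"
      unfolding abs_mult using e by (intro mult_mono) auto
    show "((\<lambda>t. exp (a t * f t x)) has_real_derivative exp (a s * f s x) * (a' s * f s x + a s * D s
      x)) (at s)"
      using s lo by (auto intro!: derivative_eq_intros a_deriv has_derivative_f_time)
  next
    have [measurable]: "f t \<in> borel_measurable borel" by (rule f_measurable) (use t lo in auto)
    show "(\<lambda>x. exp (a t * f t x) * (a' t * f t x + a t * D t x)) \<in> borel_measurable \<mu>"
      by measurable
  qed
  have "ln (Z t1) / a t1 \<le> ln (Z t2) / a t2"
  proof (rule DERIV_nonneg_imp_nondecreasing[OF t12(1), where f = "\<lambda>t. ln (Z t) / a t"])
    fix t assume "t1 \<le> t" "t \<le> t2"
    then have t: "t \<in> {t1..t2}" and t': "t \<in> {lo<..<hi}" and t0: "0 < t" using t12 lo by auto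
    note I = exp_bounded_integrable[OF \<mu>p meas[OF t'] afM[OF t'], folded Z_def]
    have [measurable]: "f t \<in> borel_measurable borel" by (rule f_measurable[OF t0])
    have iD: "integrable \<mu> (\<lambda>x. D t x * exp (a t * f t x))"
      by (rule D_exp_integrable[OF _ B afM[OF t']]) (use t' in auto)
    define E where "E = (\<integral>x. exp (a t * f t x) * (a t * f t x) \<partial>\<mu>)"
    define V where "V = (\<integral>x. D t x * exp (a t * f t x) \<partial>\<mu>)"
    have V0: "0 \<le> V" unfolding V_def by (intro integral_nonneg_AE AE_I2 mult_nonneg_nonneg D_nonneg)
      simp
    have at: "0 < a t" using a t by simp
    have Z0: "0 < Z t" using I by (simp add: Z_def)
    define Z' where "Z' = (\<integral>x. exp (a t * f t x) * (a' t * f t x + a t * D t x) \<partial>\<mu>)"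
    have "Z' = (\<integral>x. a' t / a t * (exp (a t * f t x) * (a t * f t x)) + a t * (D t x * exp (a t * f t
      x)) \<partial>\<mu>)"
      unfolding Z'_def using at by (intro Bochner_Integration.integral_cong) (auto simp:
        field_simps)
    also have "\<dots> = a' t / a t * E + a t * V"
      unfolding E_def V_def using I(3) iD
      by (simp only: Bochner_Integration.integral_add integrable_mult_right
        integral_mult_right_zero)
    finally have Z': "Z' = a' t / a t * E + a t * V" .
    \<comment> \<open>For a nonnegative entropy the differential inequality is used; otherwise the
      sign of \<open>a'\<close> decides.\<close>
    have "- a' t * (E - Z t * ln (Z t)) \<le> (a t)\<^sup>2 * V"
    proof (cases "0 \<le> E - Z t * ln (Z t)")
      case True
      then have "- a' t * (E - Z t * ln (Z t))
        \<le> (1 - C * a t * \<kappa> t)\<^sup>2 / (4 * C) * (E - Z t * ln (Z t))"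
        using ode[OF t] by (intro mult_right_mono) auto
      also have "\<dots> \<le> (a t)\<^sup>2 * V"
        unfolding E_def V_def Z_def by (rule entropy_production[OF t0 at \<kappa>[OF t] bd[OF t]])
      finally show ?thesis .
    next
      case False
      then have "- a' t * (E - Z t * ln (Z t)) \<le> 0"
        using a(2)[OF t] by (intro mult_nonneg_nonpos) auto
      also have "0 \<le> (a t)\<^sup>2 * V" using V0 by simp
      finally show ?thesis .
    qed
    then have "0 \<le> (a' t * (E - Z t * ln (Z t)) + (a t)\<^sup>2 * V) / ((a t)\<^sup>2 * Z t)"
      using Z0 at by (intro divide_nonneg_pos) auto
    also have "\<dots> = (Z' / Z t * a t - ln (Z t) * a' t) / (a t * a t)"
      unfolding Z' using Z0 at by (simp add: field_simps power2_eq_square)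
    finally have "0 \<le> (Z' / Z t * a t - ln (Z t) * a' t) / (a t * a t)" .
    moreover have "((\<lambda>t. ln (Z t) / a t) has_real_derivative
        (Z' / Z t * a t - ln (Z t) * a' t) / (a t * a t)) (at t)"
      using Z_deriv[OF t'] a_deriv[OF t'] Z0 at unfolding Z'_def[symmetric]
      by (auto intro!: derivative_eq_intros)
    ultimately show "\<exists>d. ((\<lambda>t. ln (Z t) / a t) has_real_derivative d) (at t) \<and> 0 \<le> d" by blast
  qed
  then show ?thesis by (simp add: Z_def)
qed

text \<open>For \<open>t \<ge> 1 / 2\<close> the semi-convexity constant is \<open>2\<close>, and this schedule attains the
  admissible decay rate with equality.\<close>

lemma late_flow_mono:
  assumes s: "1 / 2 \<le> s" "s < 1"
  defines "a \<equiv> \<lambda>t. (1 - t) / (2 * (3 - t)) / C"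
  shows "ln (\<integral>x. exp (a (1 / 2) * f (1 / 2) x) \<partial>\<mu>) / a (1 / 2)
    \<le> ln (\<integral>x. exp (a s * f s x) \<partial>\<mu>) / a s"
proof (rule log_Laplace_flow_mono[OF s(1), where lo = "1 / 4" and hi = 2 and A = "1 / C"
      and a' = "\<lambda>t. - (1 / (3 - t)\<^sup>2) / C" and \<kappa> = "\<lambda>_. 2"])
  fix t :: real assume t: "t \<in> {1 / 4<..<2}"
  have "((\<lambda>t. (1 - t) / (2 * (3 - t)) / C) has_real_derivative
      ((- 1) * (2 * (3 - t)) - (1 - t) * (- 2)) / (2 * (3 - t) * (2 * (3 - t))) / C) (at t)"
    by (rule DERIV_cdivide) (use t in \<open>auto intro!: derivative_eq_intros\<close>)
  also have "((- 1) * (2 * (3 - t)) - (1 - t) * (- 2)) / (2 * (3 - t) * (2 * (3 - t))) / C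
    = - (1 / (3 - t)\<^sup>2) / C"
  proof -
    have "((- 1) * (2 * (3 - t)) - (1 - t) * (- 2)) = - 4" "2 * (3 - t) * (2 * (3 - t))
      = 4 * (3 - t)\<^sup>2"
      by (simp_all add: algebra_simps power2_eq_square)
    then show ?thesis by simp
  qed
  finally show "(a has_real_derivative - (1 / (3 - t)\<^sup>2) / C) (at t)" by (simp add: a_def)
  have "\<bar>(1 - t) / (2 * (3 - t))\<bar> \<le> 1"
    using t by (auto simp: abs_le_iff field_simps)
  then have "\<bar>(1 - t) / (2 * (3 - t))\<bar> / C \<le> 1 / C" using C by (intro divide_right_mono) auto
  then show "\<bar>a t\<bar> \<le> 1 / C"
    unfolding a_def using C by (subst abs_divide) simp
  have "1 \<le> (3 - t)\<^sup>2" using t by (intro one_le_power) auto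
  then have "1 / (3 - t)\<^sup>2 \<le> 1" by (simp add: divide_le_eq_1)
  then have "1 / (3 - t)\<^sup>2 / C \<le> 1 / C" using C by (intro divide_right_mono) auto
  then show "\<bar>- (1 / (3 - t)\<^sup>2) / C\<bar> \<le> 1 / C" using C by simp
next
  fix t assume t: "t \<in> {1 / 2..s}"
  then have t3: "0 < 3 - t" "t < 1" "1 / 2 \<le> t" using s by auto
  have Ca: "C * a t = (1 - t) / (2 * (3 - t))" using C by (simp add: a_def)
  show "0 < a t" using t3 C by (simp add: a_def)
  show "- (1 / (3 - t)\<^sup>2) / C \<le> 0" using C by simp
  \<comment> \<open>For u = C a the extremal equation is u' = -(1 - 2 u)^2 / 4. Here 1 - 2 u = 2 /
    (3 - t), so both sides equal -1 / (3 - t)^2; the solution is singled out by u = 0 at t =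
    1.\<close>
  have u: "1 - C * a t * 2 = 2 / (3 - t)" unfolding Ca using t3 by (simp add: field_simps)
  show "C * a t * 2 < 1" unfolding Ca using t3 by (simp add: field_simps)
  have "(1 - t) / (2 * (3 - t)) \<le> 2 / (2 * (3 - t))" using t3 by (intro divide_right_mono) auto
  then have "(1 - t) / (2 * (3 - t)) / C \<le> 2 / (2 * (3 - t)) / C"
    by (rule divide_right_mono) (use C in simp)
  then show "a t \<le> (1 - C * a t * 2) / (2 * C)"
    unfolding u unfolding a_def by (simp only: divide_divide_eq_left ac_simps)
  show "- (- (1 / (3 - t)\<^sup>2) / C) \<le> (1 - C * a t * 2)\<^sup>2 / (4 * C)"
    unfolding u using t3 C by (simp add: power_divide)
  show "4 * t * c (h /\<^sub>R (2 * t)) \<le> 2 * c h" for h :: "real ^ 'k"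
    by (rule curvature_bound(1)[OF t3(3)])
qed (use s in auto)

text \<open>For \<open>t \<le> 1 / 2\<close> the constant is \<open>1 / t\<close>. The quadratic \<open>q\<close> agrees at \<open>t = 1 / 2\<close> with the
  schedule above and is a subsolution which still exceeds \<open>1 / 8\<close> at \<open>t = 7 / 25\<close>.\<close>

lemma early_flow_mono:
  defines "q \<equiv> \<lambda>t. 1 / 10 + 4 / 25 * (1 / 2 - t) - 1 / 5 * (1 / 2 - t)\<^sup>2"
  shows "ln (\<integral>x. exp (q (7 / 25) / C * f (7 / 25) x) \<partial>\<mu>) / (q (7 / 25) / C)
    \<le> ln (\<integral>x. exp (q (1 / 2) / C * f (1 / 2) x) \<partial>\<mu>) / (q (1 / 2) / C)"
proof (rule log_Laplace_flow_mono[ where lo = "1 / 4" and hi = 2 and A = "1 / C"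
      and a' = "\<lambda>t. - (4 / 25 - 2 / 5 * (1 / 2 - t)) / C" and \<kappa> = "\<lambda>t. 1 / t"
        and a = "\<lambda>t. q t / C"])
  fix t :: real assume t: "t \<in> {1 / 4<..<2}"
  show "((\<lambda>t. q t / C) has_real_derivative - (4 / 25 - 2 / 5 * (1 / 2 - t)) / C) (at t)"
    unfolding q_def by (rule DERIV_cdivide) (auto intro!: derivative_eq_intros simp: field_simps)
  have "\<bar>1 / 2 - t\<bar> \<le> 3 / 2" using t unfolding abs_le_iff by auto
  then have "(1 / 2 - t)\<^sup>2 \<le> (3 / 2)\<^sup>2" by (intro power2_le_iff_abs_le[THEN iffD2]) simp_all
  then have Q: "(1 / 2 - t)\<^sup>2 \<le> 9 / 4" by (simp add: power_divide)
  have "\<bar>1 / 10 + 4 / 25 * (1 / 2 - t) - 1 / 5 * Q\<bar> \<le> 1" if "0 \<le> Q" "Q \<le> 9 / 4" for Q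
    using that t unfolding abs_le_iff by (auto simp: field_simps)
  from this[OF _ Q] have "\<bar>q t\<bar> \<le> 1" by (simp add: q_def)
  then show "\<bar>q t / C\<bar> \<le> 1 / C" using C by (simp add: divide_right_mono)
  have "\<bar>- (4 / 25 - 2 / 5 * (1 / 2 - t))\<bar> \<le> 1" using t by (auto simp: abs_le_iff field_simps)
  then have "\<bar>- (4 / 25 - 2 / 5 * (1 / 2 - t))\<bar> / C \<le> 1 / C" using C
    by (intro divide_right_mono) auto
  then show "\<bar>- (4 / 25 - 2 / 5 * (1 / 2 - t)) / C\<bar> \<le> 1 / C" using C by (subst abs_divide) simp
next
  fix t :: real assume "t \<in> {7 / 25..1 / 2}"
  then have t: "0 < t" "t \<le> 1 / 2" "7 / 25 \<le> t" by auto
  define s where "s = 1 / 2 - t"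
  have s: "0 \<le> s" "s \<le> 11 / 50" and ts: "t = 1 / 2 - s" using t by (auto simp: s_def)
  have ss: "s * s \<le> 11 / 50 * s" using s by (intro mult_right_mono) auto
  have q: "q t = 1 / 10 + 4 / 25 * s - 1 / 5 * (s * s)" by (simp add: q_def s_def power2_eq_square)
  have q0: "0 < q t" using s ss unfolding q by linarith
  have q1: "q t \<le> 63 / 500"
  proof -
    have "(11 / 50 - s) * (11 / 50 - s) \<ge> 0" by simp
    then have "s * s \<ge> 22 / 50 * s - 121 / 2500" by (simp add: algebra_simps)
    then show ?thesis unfolding q using s by linarith
  qed
  show "0 < q t / C" using q0 C by simp
  show "- (4 / 25 - 2 / 5 * (1 / 2 - t)) / C \<le> 0" using C t by (simp add: divide_le_0_iff)
  show "0 \<le> 1 / t" using t by simp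
  have u: "1 - C * (q t / C) * (1 / t) = (t - q t) / t" using C t by (simp add: field_simps)
  show "C * (q t / C) * (1 / t) < 1" using C t q1 by (simp add: field_simps)
  have "2 * q t \<le> (t - q t) / t"
  proof -
    have "2 * q t * t \<le> 2 * (63 / 500) * t" using q1 t by (intro mult_right_mono) auto
    then have "2 * q t * t \<le> t - q t" using q1 t by linarith
    then show ?thesis using t by (simp add: field_simps)
  qed
  then have "2 * q t / (2 * C) \<le> (t - q t) / t / (2 * C)" using C by (intro divide_right_mono) auto
  then show "q t / C \<le> (1 - C * (q t / C) * (1 / t)) / (2 * C)" unfolding u using C by simp
  show "- (- (4 / 25 - 2 / 5 * (1 / 2 - t)) / C) \<le> (1 - C * (q t / C) * (1 / t))\<^sup>2 / (4 * C)"
  proof -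
    have "4 * t\<^sup>2 * (4 / 25 - 2 / 5 * s) \<le> (t - q t)\<^sup>2"
    proof -
      \<comment> \<open>The factor \<open>s\<close> splits off because \<open>q\<close> matches the
        late schedule at time 1/2 in slope as well as in value: both slopes are -4/25.\<close>
      have "(t - q t)\<^sup>2 - 4 * t\<^sup>2 * (4 / 25 - 2 / 5 * s)
          = s * (14 / 125 - 459 / 625 * s + 142 / 125 * (s * s) + 1 / 25 * (s * s * s))"
        unfolding q unfolding ts by (simp add: power2_eq_square field_simps)
      moreover have "0 \<le> 14 / 125 - 459 / 625 * s + 142 / 125 * (s * s) + 1 / 25 * (s * s * s)"
      proof -
        \<comment> \<open>The bracket decreases on the range of \<open>s\<close>. Replacing the
          square by its tangent at the far end 11/50, where the bracket is smallest, leaves a linear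
          inequality.\<close>
        have "(11 / 50 - s) * (11 / 50 - s) \<ge> 0" by simp
        then have "s * s \<ge> 22 / 50 * s - 121 / 2500" by (simp add: algebra_simps)
        moreover have "0 \<le> s * s * s" using s by simp
        ultimately show ?thesis using s by linarith
      qed
      ultimately show ?thesis using s by (metis diff_ge_0_iff_ge mult_nonneg_nonneg)
    qed
    then have "4 / 25 - 2 / 5 * s \<le> ((t - q t) / t)\<^sup>2 / 4"
      using t by (simp add: power_divide field_simps)
    then have "(4 / 25 - 2 / 5 * s) / C \<le> ((t - q t) / t)\<^sup>2 / 4 / C"
      using C by (intro divide_right_mono) auto
    moreover have "- (- (4 / 25 - 2 / 5 * (1 / 2 - t)) / C) = (4 / 25 - 2 / 5 * s) / C"
      by (simp only: minus_divide_left[symmetric] minus_minus s_def)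
    ultimately show ?thesis unfolding u by simp
  qed
  show "4 * t * c (h /\<^sub>R (2 * t)) \<le> 1 / t * c h" for h :: "real ^ 'k"
    by (rule curvature_bound(2)[OF t(1,2)])
qed auto

lemma f_mono: "0 < s \<Longrightarrow> s \<le> t \<Longrightarrow> f s x \<le> f t x"
  by (rule DERIV_nonneg_imp_nondecreasing)
     (auto intro!: exI[of _ "D _ x"] has_derivative_f_time D_nonneg)

text \<open>The two schedules agree at time 1/2, so the monotone pieces can be chained. At time 1
  the rate is 0 and the quotient degenerates; hence the limit from the left, with
  \<open>log_Laplace_le\<close> controlling the error and \<open>f_mono\<close> replacing the late
  times by time 1.\<close>

lemma log_Laplace_flow:
  defines "a0 \<equiv> dual_rate C"
  shows "ln (\<integral>x. exp (a0 * f (7 / 25) x) \<partial>\<mu>) / a0 \<le> (\<integral>x. f 1 x \<partial>\<mu>)"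
proof -
  note [measurable_cong] = sets\<mu>
  have f\<mu>: "f t \<in> borel_measurable \<mu>" if "0 < t" for t
    using f_measurable[OF that] by measurable
  obtain M where M: "\<And>t x. 0 < t \<Longrightarrow> \<bar>f t x\<bar> \<le> M" using f_bounded by metis
  define a where "a t = (1 - t) / (2 * (3 - t)) / C" for t
  let ?L = "ln (\<integral>x. exp (a0 * f (7 / 25) x) \<partial>\<mu>) / a0"
  have a_lim: "(a \<longlongrightarrow> 0) (at_left 1)"
    unfolding a_def using C by (auto intro!: tendsto_eq_intros)
  have "?L \<le> (\<integral>x. f 1 x \<partial>\<mu>) + 0 * M\<^sup>2"
  proof (rule tendsto_lowerbound)
    show "((\<lambda>s. (\<integral>x. f 1 x \<partial>\<mu>) + a s * M\<^sup>2) \<longlongrightarrow> (\<integral>x. f 1 x \<partial>\<mu>) + 0 * M\<^sup>2) (at_left 1)"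
      by (intro tendsto_intros a_lim)
    have "((\<lambda>s. a s * M) \<longlongrightarrow> 0 * M) (at_left 1)" by (intro tendsto_intros a_lim)
    then have "\<forall>\<^sub>F s in at_left 1. a s * M < 1" by (rule order_tendstoD) simp
    moreover have "\<forall>\<^sub>F s in at_left 1. 1 / 2 < s \<and> s < (1 :: real)"
      unfolding eventually_at_left_field by (intro exI[of _ "1 / 2"]) auto
    ultimately show "\<forall>\<^sub>F s in at_left 1. ?L \<le> (\<integral>x. f 1 x \<partial>\<mu>) + a s * M\<^sup>2"
    proof eventually_elim
      case (elim s)
      have s: "1 / 2 \<le> s" "s < 1" "0 < s" using elim by auto
      have "?L \<le> ln (\<integral>x. exp (a (1 / 2) * f (1 / 2) x) \<partial>\<mu>) / a (1 / 2)"
        using early_flow_mono C by (simp add: a0_def dual_rate_def a_def power2_eq_square)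
      also have "\<dots> \<le> ln (\<integral>x. exp (a s * f s x) \<partial>\<mu>) / a s"
        unfolding a_def by (rule late_flow_mono[OF s(1,2)])
      also have "\<dots> \<le> (\<integral>x. f s x \<partial>\<mu>) + a s * M\<^sup>2"
        using elim s C by (intro log_Laplace_le[OF \<mu>p f\<mu>[OF s(3)] M[OF s(3)]]) (auto simp: a_def)
      also have "(\<integral>x. f s x \<partial>\<mu>) \<le> (\<integral>x. f 1 x \<partial>\<mu>)"
        by (intro integral_mono exp_bounded_integrable(1)[OF \<mu>p f\<mu> M] f_mono) (use s in auto)
      finally show ?case by simp
    qed
  qed simp
  then show ?thesis by simp
qed

end

end

context cost_profile
begin

text \<open>The Bobkov-Goetze dual form of a transport inequality with constant
  \<open>1 / a0\<close>. Softmax dominates every kernel, hence \<open>v\<close> at time 7/25, and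
  exceeds the maximum, hence \<open>w\<close> at time 1, by at most
  \<open>ln (card J) / \<beta>\<close>, which is then sent to 0.\<close>

theorem rMLSI_dual:
  fixes \<mu> :: "(real ^ 'k) measure" and J :: "nat set" and y :: "nat \<Rightarrow> real ^ 'k"
  assumes \<mu>: "\<mu> \<in> space (prob_algebra borel)" and rM: "rMLSI \<mu> c C" and C: "0 < C"
    and J: "finite J" and b: "\<And>j. b j = 0 \<or> b j = 1" and base: "base \<in> J" "b base = 0"
    and v: "v \<in> borel_measurable borel" "\<And>x. \<bar>v x\<bar> \<le> M"
    and w: "w \<in> borel_measurable borel" "\<And>x. \<bar>w x\<bar> \<le> M"
    and v_le: "\<And>x. \<exists>j\<in>J. v x \<le> g j - b j * (7 / 25 * c ((x - y j) /\<^sub>R (7 / 25)))"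
    and w_ge: "\<And>x j. j \<in> J \<Longrightarrow> g j - b j * c (x - y j) \<le> w x"
  defines "a0 \<equiv> dual_rate C"
  shows "ln (\<integral>x. exp (a0 * v x) \<partial>\<mu>) \<le> a0 * (\<integral>x. w x \<partial>\<mu>)"
proof -
  have \<mu>p: "prob_space \<mu>" and sets\<mu>[measurable_cong]: "sets \<mu> = sets borel"
    using \<mu> by (auto simp: space_prob_algebra)
  interpret \<mu>: prob_space \<mu> by fact
  have a0: "0 < a0" using C by (simp add: a0_def dual_rate_def)
  have [measurable]: "v \<in> borel_measurable borel" "w \<in> borel_measurable borel" by fact+
  have av: "\<bar>a0 * v x\<bar> \<le> a0 * M" for x using v(2)[of x] a0 by (simp add: abs_mult)
  have v\<mu>: "(\<lambda>x. a0 * v x) \<in> borel_measurable \<mu>" by measurable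
  note Iv = exp_bounded_integrable[OF \<mu>p v\<mu> av]
  have w\<mu>: "w \<in> borel_measurable \<mu>" by measurable
  note Iw = exp_bounded_integrable(1)[OF \<mu>p w\<mu> w(2)]
  have step: "ln (\<integral>x. exp (a0 * v x) \<partial>\<mu>) / a0 \<le> (\<integral>x. w x \<partial>\<mu>) + ln (real (card J)) / \<beta>" if \<beta>: "0 < \<beta>"
    for \<beta>
  proof -
    interpret flow: softmax_flow \<alpha> J g b y \<beta> base
      by unfold_locales (use J b base \<beta> in auto)
    obtain N where N: "\<And>t x. 0 < t \<Longrightarrow> \<bar>flow.f t x\<bar> \<le> N" using flow.f_bounded by metis
    have f\<mu>: "flow.f t \<in> borel_measurable \<mu>" if "0 < t" for t
      using flow.f_measurable[OF that] by measurable
    have fN: "\<bar>a0 * flow.f (7 / 25) x\<bar> \<le> a0 * N" for x using N[of "7 / 25" x] a0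
      by (simp add: abs_mult)
    have "v x \<le> flow.f (7 / 25) x" for x
    proof -
      obtain j where j: "j \<in> J" "v x \<le> g j - b j * (7 / 25 * c ((x - y j) /\<^sub>R (7 / 25)))" using v_le
        by blast
      note j(2)
      also have "\<dots> \<le> flow.f (7 / 25) x"
        using softmax_ge[OF J flow.J_ne \<beta> j(1), of "flow.U (7 / 25) x"]
          by (simp add: flow.f_def flow.U_def)
      finally show ?thesis .
    qed
    then have "(\<integral>x. exp (a0 * v x) \<partial>\<mu>) \<le> (\<integral>x. exp (a0 * flow.f (7 / 25) x) \<partial>\<mu>)"
      using a0 Iv(2) f\<mu>[of "7 / 25"] by (intro integral_mono exp_bounded_integrable(2)[OF \<mu>p _ fN])
        auto
    then have "ln (\<integral>x. exp (a0 * v x) \<partial>\<mu>) / a0 \<le> ln (\<integral>x. exp (a0 * flow.f (7 / 25) x) \<partial>\<mu>) / a0"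
      using a0 Iv(4) by (intro divide_right_mono ln_mono) auto
    also have "\<dots> \<le> (\<integral>x. flow.f 1 x \<partial>\<mu>)"
      unfolding a0_def by (rule flow.log_Laplace_flow[OF \<mu> rM C])
    also have "\<dots> \<le> (\<integral>x. w x + ln (real (card J)) / \<beta> \<partial>\<mu>)"
    proof (rule integral_mono)
      show "integrable \<mu> (flow.f 1)"
        by (rule exp_bounded_integrable(1)[OF \<mu>p f\<mu> N]) auto
      fix x
      show "flow.f 1 x \<le> w x + ln (real (card J)) / \<beta>"
        unfolding flow.f_def
        by (rule softmax_le[OF J flow.J_ne \<beta>]) (use w_ge in \<open>simp add: flow.U_def\<close>)
    qed (use Iw in auto)
    also have "\<dots> = (\<integral>x. w x \<partial>\<mu>) + ln (real (card J)) / \<beta>"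
      using Iw by (simp add: \<mu>.prob_space)
    finally show ?thesis .
  qed
  have "ln (\<integral>x. exp (a0 * v x) \<partial>\<mu>) / a0 \<le> (\<integral>x. w x \<partial>\<mu>) + 0"
  proof (rule tendsto_lowerbound)
    show "((\<lambda>\<beta>. (\<integral>x. w x \<partial>\<mu>) + ln (real (card J)) / \<beta>) \<longlongrightarrow> (\<integral>x. w x \<partial>\<mu>) + 0) at_top"
      by (intro tendsto_intros tendsto_divide_0[OF tendsto_const] filterlim_at_top_imp_at_infinity
        filterlim_ident)
    show "\<forall>\<^sub>F \<beta> in at_top. ln (\<integral>x. exp (a0 * v x) \<partial>\<mu>) / a0 \<le> (\<integral>x. w x \<partial>\<mu>) + ln (real (card J)) / \<beta>"
      using eventually_gt_at_top[of 0] by eventually_elim (rule step)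
  qed simp
  then show ?thesis using a0 by (simp add: field_simps)
qed

end

subsection \<open>Finite Kantorovich duality\<close>

definition sublinear :: "(('a \<Rightarrow> real) \<Rightarrow> real) \<Rightarrow> bool" where
  "sublinear S \<longleftrightarrow> (\<forall>u v. S (\<lambda>i. u i + v i) \<le> S u + S v) \<and> (\<forall>r u. 0 \<le> r \<longrightarrow> S (\<lambda>i. r * u i) = r * S u)"

text \<open>The largest sublinear minorant of \<open>S\<close> that is odd along \<open>v\<close> and agrees with \<open>S\<close> at \<open>v\<close>.\<close>

definition linearize :: "('a \<Rightarrow> real) \<Rightarrow> (('a \<Rightarrow> real) \<Rightarrow> real) \<Rightarrow> ('a \<Rightarrow> real) \<Rightarrow> real" where
  "linearize v S u = (INF t\<in>{0..}. S (\<lambda>i. u i + t * v i) - t * S v)"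

lemma sublinear_add: "sublinear S \<Longrightarrow> S (\<lambda>i. u i + v i) \<le> S u + S v"
  by (simp add: sublinear_def)

lemma sublinear_scale: "sublinear S \<Longrightarrow> 0 \<le> r \<Longrightarrow> S (\<lambda>i. r * u i) = r * S u"
  by (simp add: sublinear_def)

lemma sublinear_zero: "sublinear S \<Longrightarrow> S (\<lambda>_. 0) = 0"
  using sublinear_scale[of S 0] by simp

lemma sublinear_minus: "sublinear S \<Longrightarrow> - S (\<lambda>i. - u i) \<le> S u"
  using sublinear_add[of S u "\<lambda>i. - u i"] sublinear_zero[of S] by simp

context
  fixes S :: "('a \<Rightarrow> real) \<Rightarrow> real" and v :: "'a \<Rightarrow> real"
  assumes S: "sublinear S"
begin

text \<open>Subadditivity bounds the family from below uniformly in \<open>t\<close>, so the real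
  infimum in \<open>linearize\<close> is a genuine one.\<close>

lemma linearize_bounded: "0 \<le> t \<Longrightarrow> - S (\<lambda>i. - u i) \<le> S (\<lambda>i. u i + t * v i) - t * S v"
proof -
  assume t: "0 \<le> t"
  have "S (\<lambda>i. t * v i) \<le> S (\<lambda>i. u i + t * v i) + S (\<lambda>i. - u i)"
    using sublinear_add[OF S, of "\<lambda>i. u i + t * v i" "\<lambda>i. - u i"] by simp
  then show ?thesis using sublinear_scale[OF S t, of v] by simp
qed

lemma bdd_linearize: "bdd_below ((\<lambda>t. S (\<lambda>i. u i + t * v i) - t * S v) ` {0..})"
  using linearize_bounded by (intro bdd_belowI2[of _ "- S (\<lambda>i. - u i)"]) auto

lemma linearize_le': "0 \<le> t \<Longrightarrow> linearize v S u \<le> S (\<lambda>i. u i + t * v i) - t * S v"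
  unfolding linearize_def by (rule cINF_lower[OF bdd_linearize]) simp

lemma linearize_le: "linearize v S u \<le> S u"
  using linearize_le'[of 0 u] by simp

lemma linearize_minus: "linearize v S (\<lambda>i. - v i) \<le> - S v"
  using linearize_le'[of 1 "\<lambda>i. - v i"] sublinear_zero[OF S] by simp

lemma linearize_greatest:
  "(\<And>t. 0 \<le> t \<Longrightarrow> m \<le> S (\<lambda>i. u i + t * v i) - t * S v) \<Longrightarrow> m \<le> linearize v S u"
  unfolding linearize_def by (rule cINF_greatest) auto

text \<open>Shifts \<open>t\<close> for \<open>u\<close> and \<open>s\<close> for \<open>w\<close>
  add up to the shift \<open>t + s\<close> for the sum; scaling by \<open>r\<close> rescales the
  shift.\<close>

lemma sublinear_linearize: "sublinear (linearize v S)"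
  unfolding sublinear_def
proof (intro conjI allI impI)
  fix u w
  have *: "linearize v S (\<lambda>i. u i + w i)
      \<le> (S (\<lambda>i. u i + t * v i) - t * S v) + (S (\<lambda>i. w i + s * v i) - s * S v)" if "0 \<le> t" "0 \<le> s"
        for t s
  proof -
    have "linearize v S (\<lambda>i. u i + w i) \<le> S (\<lambda>i. (u i + w i) + (t + s) * v i) - (t + s) * S v"
      by (rule linearize_le') (use that in simp)
    also have "S (\<lambda>i. (u i + w i) + (t + s) * v i) \<le> S (\<lambda>i. u i + t * v i) + S (\<lambda>i. w i + s * v i)"
      using sublinear_add[OF S, of "\<lambda>i. u i + t * v i" "\<lambda>i. w i + s * v i"]
        by (simp add: algebra_simps)
    finally show ?thesis by (simp add: algebra_simps)
  qed
  have "linearize v S (\<lambda>i. u i + w i) - (S (\<lambda>i. w i + s * v i) - s * S v) \<le> linearize v S u"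
    if "0 \<le> s" for s
    by (rule linearize_greatest) (use *[OF _ that] in \<open>simp add: algebra_simps\<close>)
  then have "linearize v S (\<lambda>i. u i + w i) - linearize v S u \<le> linearize v S w"
    by (intro linearize_greatest) (simp add: algebra_simps)
  then show "linearize v S (\<lambda>i. u i + w i) \<le> linearize v S u + linearize v S w" by simp
next
  fix r :: real and u assume r: "0 \<le> r"
  have scale: "r * linearize v S u \<le> linearize v S (\<lambda>i. r * u i)" if "0 < r" for r u
  proof (rule linearize_greatest)
    fix t :: real assume t: "0 \<le> t"
    have "r * linearize v S u \<le> r * (S (\<lambda>i. u i + t / r * v i) - t / r * S v)"
      using that t by (intro mult_left_mono linearize_le') auto
    also have "\<dots> = S (\<lambda>i. r * (u i + t / r * v i)) - t * S v"
      using that sublinear_scale[OF S less_imp_le[OF that]] by (simp add: right_diff_distrib)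
    also have "(\<lambda>i. r * (u i + t / r * v i)) = (\<lambda>i. r * u i + t * v i)"
      using that by (simp add: distrib_left)
    finally show "r * linearize v S u \<le> S (\<lambda>i. r * u i + t * v i) - t * S v" .
  qed
  show "linearize v S (\<lambda>i. r * u i) = r * linearize v S u"
  proof (cases "r = 0")
    case True
    have "0 \<le> linearize v S (\<lambda>_. 0)"
      by (rule linearize_greatest) (simp add: sublinear_scale[OF S])
    then show ?thesis using True linearize_le[of "\<lambda>_. 0"] sublinear_zero[OF S] by simp
  next
    case False
    then have r: "0 < r" using r by simp
    have "1 / r * linearize v S (\<lambda>i. r * u i) \<le> linearize v S (\<lambda>i. 1 / r * (r * u i))"
      by (rule scale) (use r in simp)
    then have "linearize v S (\<lambda>i. r * u i) \<le> r * linearize v S u"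
      using r by (simp add: field_simps)
    then show ?thesis using scale[OF r, of u] by simp
  qed
qed

end

text \<open>Hahn-Banach in finitely many directions: iterating \<open>linearize\<close> avoids Zorn's lemma.\<close>

lemma sublinear_minorant:
  assumes "sublinear S" "finite V"
  shows "\<exists>L. sublinear L \<and> (\<forall>u. L u \<le> S u) \<and> (\<forall>v\<in>V. L (\<lambda>i. - v i) = - L v)"
  using assms(2)
proof induction
  case empty
  then show ?case using assms(1) by auto
next
  case (insert v V)
  then obtain L where L: "sublinear L" "\<And>u. L u \<le> S u" "\<And>v. v \<in> V \<Longrightarrow> L (\<lambda>i. - v i) = - L v" by blast
  let ?L = "linearize v L"
  have le: "?L u \<le> L u" for u by (rule linearize_le[OF L(1)])
  have sub: "sublinear ?L" by (rule sublinear_linearize[OF L(1)])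
  \<comment> \<open>Oddness gained earlier survives: the new functional is smaller on both
    \<open>w\<close> and \<open>- w\<close>, while sublinearity keeps the sum of its two values
    nonnegative.\<close>
  have keep: "?L (\<lambda>i. - w i) = - ?L w" if "L (\<lambda>i. - w i) \<le> - L w" for w
    using that le[of w] le[of "\<lambda>i. - w i"] sublinear_minus[OF sub, of w] sublinear_minus[OF L(1), of
      w]
    by (smt (verit))
  have v: "?L (\<lambda>i. - v i) = - ?L v"
    using linearize_minus[OF L(1), of v] le[of v] sublinear_minus[OF sub, of v] by linarith
  show ?case
    using sub le L v keep by (intro exI[of _ ?L]) (auto intro: order_trans)
qed

text \<open>A sublinear functional that is odd on generators is linear on their span. Oddness
  handles negative coefficients in the upper bound, which is then applied to \<open>- u\<close> for
  the lower one.\<close>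

lemma sublinear_odd_sum:
  assumes L: "sublinear L" and I: "finite I" and odd: "\<And>i. i \<in> I \<Longrightarrow> L (\<lambda>j. - e i j) = - L (e i)"
  shows "L (\<lambda>j. \<Sum>i\<in>I. u i * e i j) = (\<Sum>i\<in>I. u i * L (e i))"
proof -
  have le: "L (\<lambda>j. \<Sum>i\<in>I. u i * e i j) \<le> (\<Sum>i\<in>I. u i * L (e i))" for u
    using I odd
  proof induction
    case empty
    then show ?case using sublinear_zero[OF L] by simp
  next
    case (insert i I)
    have "L (\<lambda>j. u i * e i j) = u i * L (e i)"
    proof (cases "0 \<le> u i")
      case False
      then have "L (\<lambda>j. (- u i) * - e i j) = (- u i) * L (\<lambda>j. - e i j)"
        by (intro sublinear_scale[OF L]) simp
      then show ?thesis using insert.prems[of i] by simp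
    qed (rule sublinear_scale[OF L])
    moreover have "L (\<lambda>j. u i * e i j + (\<Sum>i\<in>I. u i * e i j))
      \<le> L (\<lambda>j. u i * e i j) + L (\<lambda>j. \<Sum>i\<in>I. u i * e i j)"
      by (rule sublinear_add[OF L])
    ultimately show ?case using insert by (auto intro: order_trans)
  qed
  have "- L (\<lambda>j. \<Sum>i\<in>I. u i * e i j) \<le> L (\<lambda>j. \<Sum>i\<in>I. - u i * e i j)"
    using sublinear_minus[OF L, of "\<lambda>j. \<Sum>i\<in>I. - u i * e i j"] by (simp add: sum_negf)
  also have "\<dots> \<le> (\<Sum>i\<in>I. - u i * L (e i))" by (rule le)
  finally show ?thesis using le[of u] by (simp add: sum_negf)
qed

text \<open>The optimal plan is a linear functional below the dual value, seen as a sublinear function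
  of the cost.\<close>

theorem finite_Kantorovich:
  fixes p q :: "'a \<Rightarrow> real" and d :: "'a \<Rightarrow> 'a \<Rightarrow> real"
  assumes I: "finite I" and p: "\<And>i. i \<in> I \<Longrightarrow> 0 \<le> p i" "sum p I = 1"
    and q: "\<And>i. i \<in> I \<Longrightarrow> 0 \<le> q i" "sum q I = 1"
    and dual: "\<And>\<phi> \<psi>. (\<And>i j. i \<in> I \<Longrightarrow> j \<in> I \<Longrightarrow> \<phi> i + \<psi> j \<le> d i j) \<Longrightarrow>
      (\<Sum>i\<in>I. \<phi> i * p i) + (\<Sum>j\<in>I. \<psi> j * q j) \<le> m"
  obtains \<pi> where "\<And>i j. i \<in> I \<Longrightarrow> j \<in> I \<Longrightarrow> 0 \<le> \<pi> i j"
    "\<And>i. i \<in> I \<Longrightarrow> (\<Sum>j\<in>I. \<pi> i j) = p i" "\<And>j. j \<in> I \<Longrightarrow> (\<Sum>i\<in>I. \<pi> i j) = q j"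
    "(\<Sum>i\<in>I. \<Sum>j\<in>I. \<pi> i j * d i j) \<le> m"
proof -
  define A where "A u = {(\<phi>, \<psi>). \<forall>i\<in>I. \<forall>j\<in>I. u (i, j) \<le> \<phi> i + \<psi> j}" for u :: "'a \<times> 'a \<Rightarrow> real"
  define val where "val = (\<lambda>(\<phi>, \<psi>). (\<Sum>i\<in>I. \<phi> i * p i) + (\<Sum>j\<in>I. \<psi> j * q j))"
  define S where "S u = Inf (val ` A u)" for u
  \<comment> \<open>Integration against the product plan. It bounds \<open>val\<close> from below on
    each \<open>A u\<close>, so that \<open>S\<close> is finite.\<close>
  have valI: "val (\<phi>, \<psi>) = (\<Sum>i\<in>I. \<Sum>j\<in>I. (\<phi> i + \<psi> j) * (p i * q j))" for \<phi> \<psi>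
  proof -
    have "(\<Sum>i\<in>I. \<Sum>j\<in>I. (\<phi> i + \<psi> j) * (p i * q j))
        = (\<Sum>i\<in>I. \<phi> i * p i * (\<Sum>j\<in>I. q j)) + (\<Sum>j\<in>I. \<psi> j * q j * (\<Sum>i\<in>I. p i))"
      unfolding sum_distrib_left by (subst (3) sum.swap) (simp add: sum.distrib[symmetric]
        algebra_simps)
    then show ?thesis by (simp add: val_def p q)
  qed
  have lb: "(\<Sum>i\<in>I. \<Sum>j\<in>I. u (i, j) * (p i * q j)) \<le> val x" if "x \<in> A u" for u x
    using that p q unfolding A_def by (auto simp: valI intro!: sum_mono mult_right_mono)
  have bdd: "bdd_below (val ` A u)" for u
    using lb by (auto intro!: bdd_belowI2)
  have S_le: "S u \<le> val x" if "x \<in> A u" for u x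
    unfolding S_def using that bdd by (intro cINF_lower) auto
  have ne: "A u \<noteq> {}" for u
  proof -
    have "u (i, j) \<le> (\<Sum>i\<in>I. \<Sum>j\<in>I. \<bar>u (i, j)\<bar>)" if "i \<in> I" "j \<in> I" for i j
    proof -
      have "\<bar>u (i, j)\<bar> \<le> (\<Sum>j\<in>I. \<bar>u (i, j)\<bar>)" using I that by (intro member_le_sum) auto
      also have "\<dots> \<le> (\<Sum>i\<in>I. \<Sum>j\<in>I. \<bar>u (i, j)\<bar>)"
        using I that by (intro member_le_sum[of i I "\<lambda>i. \<Sum>j\<in>I. \<bar>u (i, j)\<bar>"]) (auto intro:
          sum_nonneg)
      finally show ?thesis by simp
    qed
    then have "((\<lambda>_. \<Sum>i\<in>I. \<Sum>j\<in>I. \<bar>u (i, j)\<bar>), (\<lambda>_. 0)) \<in> A u" by (auto simp: A_def)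
    then show ?thesis by blast
  qed
  have S_ge: "a \<le> S u" if "\<And>x. x \<in> A u \<Longrightarrow> a \<le> val x" for a u
    unfolding S_def using ne that by (intro cINF_greatest) auto
  have sub: "sublinear S"
    unfolding sublinear_def
  proof (intro conjI allI impI)
    fix u v
    have "S (\<lambda>i. u i + v i) \<le> val x + val x'" if "x \<in> A u" "x' \<in> A v" for x x'
    proof -
      have "(\<lambda>i. fst x i + fst x' i, \<lambda>j. snd x j + snd x' j) \<in> A (\<lambda>i. u i + v i)"
        unfolding A_def mem_Collect_eq case_prod_conv
      proof (intro ballI)
        fix i j assume "i \<in> I" "j \<in> I"
        then have "u (i, j) \<le> fst x i + snd x j" "v (i, j) \<le> fst x' i + snd x' j"
          using that by (auto simp: A_def)
        then show "u (i, j) + v (i, j) \<le> fst x i + fst x' i + (snd x j + snd x' j)" by simp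
      qed
      from S_le[OF this] show ?thesis
        by (simp add: val_def case_prod_beta distrib_right sum.distrib)
    qed
    then have "S (\<lambda>i. u i + v i) - val x' \<le> S u" if "x' \<in> A v" for x'
      using that by (intro S_ge) (simp add: diff_le_eq)
    then have "S (\<lambda>i. u i + v i) - S u \<le> S v" by (intro S_ge) (smt (verit))
    then show "S (\<lambda>i. u i + v i) \<le> S u + S v" by simp
  next
    fix r :: real and u assume r: "0 \<le> r"
    have le: "S (\<lambda>i. r * u i) \<le> r * val x" if "x \<in> A u" "0 \<le> r" for x u r
    proof -
      have "(\<lambda>i. r * fst x i, \<lambda>j. r * snd x j) \<in> A (\<lambda>i. r * u i)"
        using that unfolding A_def by (auto simp: distrib_left[symmetric] intro!: mult_left_mono)
      from S_le[OF this] show ?thesis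
        by (simp add: val_def case_prod_beta distrib_left sum_distrib_left mult.assoc)
    qed
    have le': "S (\<lambda>i. r * u i) \<le> r * S u" if "0 < r" for r u
    proof -
      have "S (\<lambda>i. r * u i) / r \<le> S u"
        using le[of _ u r] that by (intro S_ge) (simp add: field_simps)
      then show ?thesis using that by (simp add: field_simps)
    qed
    show "S (\<lambda>i. r * u i) = r * S u"
    proof (cases "r = 0")
      case True
      obtain x where "x \<in> A u" using ne by blast
      have "0 \<le> S (\<lambda>_. 0)" using lb[of _ "\<lambda>_. 0"] by (intro S_ge) simp
      moreover have "S (\<lambda>_. 0) \<le> 0" using le[OF \<open>x \<in> A u\<close>, of 0] by simp
      ultimately show ?thesis using True by simp
    next
      case False
      then have r: "0 < r" using r by simp
      have "S (\<lambda>i. 1 / r * (r * u i)) \<le> 1 / r * S (\<lambda>i. r * u i)" by (rule le') (use r in simp)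
      then have "r * S u \<le> S (\<lambda>i. r * u i)" using r by (simp add: field_simps)
      then show ?thesis using le'[OF r, of u] by simp
    qed
  qed
  define d' where "d' = (\<lambda>(i, j). d i j)"
  define e where "e k = (\<lambda>l. if l = k then 1 else 0 :: real)" for k :: "'a \<times> 'a"
  \<comment> \<open>The bound by \<open>S\<close> alone would control \<open>L d'\<close> only by
    the largest transport cost. Linearising along \<open>- d'\<close> forces
    \<open>L d' <= - S (- d')\<close>, and the right-hand side is the supremum of the dual values
    for \<open>d\<close>.\<close>
  let ?L0 = "linearize (\<lambda>k. - d' k) S"
  obtain L where L: "sublinear L" "\<And>u. L u \<le> ?L0 u" "\<And>v. v \<in> e ` (I \<times> I) \<Longrightarrow> L (\<lambda>i. - v i) = - L v"
    using sublinear_minorant[OF sublinear_linearize[OF sub], of "e ` (I \<times> I)" "\<lambda>k. - d' k"] I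
      by auto
  have LS: "L u \<le> S u" for u
    using L(2)[of u] linearize_le[OF sub, of "\<lambda>k. - d' k" u] by simp
  have S0: "S u \<le> val (\<phi>, \<psi>)" if "\<And>i j. i \<in> I \<Longrightarrow> j \<in> I \<Longrightarrow> u (i, j) \<le> \<phi> i + \<psi> j" for u \<phi> \<psi>
    by (rule S_le) (use that in \<open>auto simp: A_def\<close>)
  have Ld: "L d' \<le> m"
  proof -
    have "- m \<le> S (\<lambda>k. - d' k)"
    proof (rule S_ge)
      fix x assume "x \<in> A (\<lambda>k. - d' k)"
      then have "- fst x i + - snd x j \<le> d i j" if "i \<in> I" "j \<in> I" for i j
        using that by (fastforce simp: A_def d'_def)
      from dual[OF this] show "- m \<le> val x" by (simp add: val_def case_prod_beta sum_negf)
    qed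
    moreover have "?L0 d' \<le> - S (\<lambda>k. - d' k)"
      using linearize_minus[OF sub, of "\<lambda>k. - d' k"] by simp
    ultimately show ?thesis using L(2)[of d'] by simp
  qed
  define \<pi> where "\<pi> i j = L (e (i, j))" for i j
  have lin: "L (\<lambda>l. \<Sum>k\<in>I \<times> I. u k * e k l) = (\<Sum>k\<in>I \<times> I. u k * L (e k))" for u
    by (rule sublinear_odd_sum[OF L(1)]) (use I L(3) in auto)
  have e_sum: "(\<Sum>k\<in>I \<times> I. u k * e k l) = (if l \<in> I \<times> I then u l else 0)" for u l
    using I by (simp add: e_def if_distrib sum.delta cong: if_cong)
  \<comment> \<open>\<open>L\<close> is linear only on the span of the point indicators of
    \<open>I \<times> I\<close>. Outside this set \<open>u\<close> may be arbitrary, but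
    \<open>S0\<close> looks at \<open>I \<times> I\<close> alone.\<close>
  have lin': "(\<Sum>i\<in>I. \<Sum>j\<in>I. u (i, j) * \<pi> i j) \<le> L u" for u
  proof -
    have "(\<Sum>i\<in>I. \<Sum>j\<in>I. u (i, j) * \<pi> i j) = L (\<lambda>l. \<Sum>k\<in>I \<times> I. u k * e k l)"
      unfolding lin by (simp add: sum.cartesian_product \<pi>_def case_prod_beta)
    also have "\<dots> \<le> L u + L (\<lambda>l. (\<Sum>k\<in>I \<times> I. u k * e k l) - u l)"
      using sublinear_add[OF L(1), of u "\<lambda>l. (\<Sum>k\<in>I \<times> I. u k * e k l) - u l"] by simp
    also have "L (\<lambda>l. (\<Sum>k\<in>I \<times> I. u k * e k l) - u l) \<le> val (\<lambda>_. 0, \<lambda>_. 0)"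
      by (rule order_trans[OF LS S0]) (simp add: e_sum)
    finally show ?thesis by (simp add: val_def)
  qed
  have pair: "(\<Sum>i\<in>I. \<Sum>j\<in>I. (\<phi> i + \<psi> j) * \<pi> i j) = val (\<phi>, \<psi>)" for \<phi> \<psi>
  proof (rule antisym)
    have le: "(\<Sum>i\<in>I. \<Sum>j\<in>I. (\<phi> i + \<psi> j) * \<pi> i j) \<le> val (\<phi>, \<psi>)" for \<phi> \<psi>
    proof -
      have "(\<Sum>i\<in>I. \<Sum>j\<in>I. (\<phi> i + \<psi> j) * \<pi> i j) \<le> L (\<lambda>(i, j). \<phi> i + \<psi> j)"
        using lin'[of "\<lambda>(i, j). \<phi> i + \<psi> j"] by simp
      also have "\<dots> \<le> val (\<phi>, \<psi>)" by (rule order_trans[OF LS S0]) simp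
      finally show ?thesis .
    qed
    show "(\<Sum>i\<in>I. \<Sum>j\<in>I. (\<phi> i + \<psi> j) * \<pi> i j) \<le> val (\<phi>, \<psi>)" by (rule le)
    have "(\<Sum>i\<in>I. \<Sum>j\<in>I. (- \<phi> i + - \<psi> j) * \<pi> i j) = - (\<Sum>i\<in>I. \<Sum>j\<in>I. (\<phi> i + \<psi> j) * \<pi> i j)"
      by (simp add: sum_negf[symmetric] algebra_simps)
    then show "val (\<phi>, \<psi>) \<le> (\<Sum>i\<in>I. \<Sum>j\<in>I. (\<phi> i + \<psi> j) * \<pi> i j)"
      using le[of "\<lambda>i. - \<phi> i" "\<lambda>j. - \<psi> j"] by (simp add: val_def sum_negf)
  qed
  show ?thesis
  proof (rule that[of \<pi>])
    fix i j assume ij: "i \<in> I" "j \<in> I"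
    have "L (\<lambda>l. - e (i, j) l) \<le> val (\<lambda>_. 0, \<lambda>_. 0)"
      by (rule order_trans[OF LS S0]) (simp add: e_def)
    then show "0 \<le> \<pi> i j" using L(3)[of "e (i, j)"] ij by (simp add: \<pi>_def val_def)
  next
    fix i assume i: "i \<in> I"
    \<comment> \<open>Pairing the plan with the indicator of \<open>i\<close> as the first
      potential, and 0 as the second, reads off a marginal.\<close>
    have "(\<Sum>j\<in>I. \<Sum>k\<in>I. ((if k = i then 1 else 0) + 0) * \<pi> k j) = val (\<lambda>k.
      if k = i then 1 else 0, \<lambda>_. 0)"
      unfolding pair[symmetric] by (rule sum.swap)
    then show "(\<Sum>j\<in>I. \<pi> i j) = p i"
      using I i by (simp add: val_def if_distrib[of "\<lambda>x. x * _"] sum.delta cong: if_cong)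
  next
    fix j assume j: "j \<in> I"
    show "(\<Sum>i\<in>I. \<pi> i j) = q j"
      using pair[of "\<lambda>_. 0" "\<lambda>k. if k = j then 1 else 0"] I j
      by (simp add: val_def if_distrib[of "\<lambda>x. x * _"] sum.delta cong: if_cong)
  next
    show "(\<Sum>i\<in>I. \<Sum>j\<in>I. \<pi> i j * d i j) \<le> m"
      using order_trans[OF lin'[of d'] Ld] by (simp add: d'_def mult.commute)
  qed
qed

subsection \<open>Couplings from discrete plans\<close>

text \<open>Index 0 is reserved for the complement of \<open>K\<close>. Taking the least admissible
  index makes the cells disjoint and keeps the index map measurable.\<close>

lemma finite_net:
  fixes K :: "'a :: euclidean_space set"
  assumes K: "compact K" and \<eta>: "0 < \<eta>"
  obtains n :: nat and y :: "nat \<Rightarrow> 'a" and I :: "'a \<Rightarrow> nat"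
  where "I \<in> borel \<rightarrow>\<^sub>M count_space UNIV" "\<And>x. I x \<le> n" "\<And>x. I x = 0 \<longleftrightarrow> x \<notin> K"
    "\<And>j. j \<in> {1..n} \<Longrightarrow> y j \<in> K" "\<And>x. x \<in> K \<Longrightarrow> dist x (y (I x)) < \<eta>"
proof -
  obtain T where T: "finite T" "T \<subseteq> K" "K \<subseteq> (\<Union>t\<in>T. ball t \<eta>)"
    using compactE_image[OF K, of K "\<lambda>t. ball t \<eta>"] \<eta>
      by (metis UN_I centre_in_ball open_ball subsetI)
  obtain y where y: "bij_betw y {1..card T} T"
    using ex_bij_betw_nat_finite_1[OF T(1)] by blast
  define P where "P j x = (if j = 0 then x \<notin> K else j \<le> card T \<and> dist x (y j) < \<eta>)" for j x
  define I where "I x = (LEAST j. P j x)" for x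
  have P: "\<exists>j\<le>card T. P j x" for x
  proof (cases "x \<in> K")
    case True
    then obtain t where "t \<in> T" "dist t x < \<eta>" using T by auto
    moreover then have "t \<in> y ` {1..card T}" using y by (simp only: bij_betw_def)
    then obtain j where "j \<in> {1..card T}" "y j = t" by blast
    ultimately show ?thesis by (intro exI[of _ j]) (auto simp: P_def dist_commute)
  qed (auto simp: P_def)
  then have PI: "P (I x) x" for x unfolding I_def by (meson LeastI)
  have [measurable]: "K \<in> sets borel" using K by (simp add: borel_compact)
  have "I \<in> borel \<rightarrow>\<^sub>M count_space UNIV"
    unfolding I_def[abs_def] P_def by measurable
  moreover have "I x \<le> card T" for x
    using P[of x] unfolding I_def by (meson Least_le order_trans)
  moreover have "I x = 0 \<longleftrightarrow> x \<notin> K" for x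
  proof
    assume "x \<notin> K"
    then have "P 0 x" by (simp add: P_def)
    then show "I x = 0" unfolding I_def by (simp add: Least_eq_0)
  qed (use PI[of x] in \<open>simp add: P_def\<close>)
  moreover have "y j \<in> K" if "j \<in> {1..card T}" for j
    using that y T(2) by (auto simp: bij_betw_def)
  moreover have "dist x (y (I x)) < \<eta>" if "x \<in> K" for x
    using PI[of x] that by (auto simp: P_def split: if_splits)
  ultimately show ?thesis by (rule that)
qed

lemma sum_indicator_index:
  fixes h :: "nat \<Rightarrow> 'b :: comm_semiring_1"
  assumes "x \<in> A" "I x \<le> n"
  shows "h (I x) = (\<Sum>i\<le>n. h i * indicator {x \<in> A. I x = i} x)"
proof -
  have "(\<Sum>i\<le>n. h i * indicator {x \<in> A. I x = i} x) = (\<Sum>i\<le>n. if i = I x then h i else 0)"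
    by (intro sum.cong) (use assms in \<open>auto simp: indicator_def\<close>)
  then show ?thesis using assms by simp
qed

lemma nn_integral_finite_index:
  fixes I :: "'a \<Rightarrow> nat"
  assumes "I \<in> M \<rightarrow>\<^sub>M count_space UNIV" "\<And>x. x \<in> space M \<Longrightarrow> I x \<le> n"
  shows "(\<integral>\<^sup>+ x. h (I x) \<partial>M) = (\<Sum>i\<le>n. h i * emeasure M {x \<in> space M. I x = i})"
proof -
  have [measurable]: "I \<in> M \<rightarrow>\<^sub>M count_space UNIV" by fact
  have "(\<integral>\<^sup>+ x. h (I x) \<partial>M) = (\<integral>\<^sup>+ x. (\<Sum>i\<le>n. h i * indicator {x \<in> space M. I x = i} x) \<partial>M)"
  proof (rule nn_integral_cong)
    fix x assume x: "x \<in> space M"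
    show "h (I x) = (\<Sum>i\<le>n. h i * indicator {x \<in> space M. I x = i} x)"
      by (rule sum_indicator_index) (use x assms(2) in auto)
  qed
  also have "\<dots> = (\<Sum>i\<le>n. h i * emeasure M {x \<in> space M. I x = i})"
    by (subst nn_integral_sum) (auto intro!: sum.cong nn_integral_cmult_indicator)
  finally show ?thesis .
qed

lemma integral_finite_index:
  fixes I :: "'a \<Rightarrow> nat" and h :: "nat \<Rightarrow> real"
  assumes M: "finite_measure M" and I: "I \<in> M \<rightarrow>\<^sub>M count_space UNIV" "\<And>x. x \<in> space M \<Longrightarrow> I x \<le> n"
  shows "(\<integral>x. h (I x) \<partial>M) = (\<Sum>i\<le>n. h i * measure M {x \<in> space M. I x = i})"
proof -
  interpret finite_measure M by fact
  have [measurable]: "I \<in> M \<rightarrow>\<^sub>M count_space UNIV" by fact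
  have "(\<integral>x. h (I x) \<partial>M) = (\<integral>x. (\<Sum>i\<le>n. h i * indicator {x \<in> space M. I x = i} x) \<partial>M)"
  proof (rule Bochner_Integration.integral_cong)
    fix x assume x: "x \<in> space M"
    show "h (I x) = (\<Sum>i\<le>n. h i * indicator {x \<in> space M. I x = i} x)"
      by (rule sum_indicator_index) (use x I(2) in auto)
  qed simp
  also have "\<dots> = (\<Sum>i\<le>n. h i * measure M {x \<in> space M. I x = i})"
    by (subst Bochner_Integration.integral_sum) (auto simp: Int_absorb1 less_top[symmetric])
  finally show ?thesis .
qed

text \<open>On the block of cells \<open>i\<close> and \<open>j\<close> the product measure is
  reweighted by \<open>q i j / (p i * r j)\<close>: inside each block the two coordinates are
  independent. The row and column sums then restore the full marginals, not only their
  discretisations.\<close>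

lemma glued_coupling:
  fixes \<nu> \<mu> :: "(real ^ 'k) measure" and I :: "real ^ 'k \<Rightarrow> nat" and q :: "nat \<Rightarrow> nat \<Rightarrow> real"
  assumes \<nu>: "\<nu> \<in> space (prob_algebra borel)" and \<mu>: "\<mu> \<in> space (prob_algebra borel)"
    and I: "I \<in> borel \<rightarrow>\<^sub>M count_space UNIV" "\<And>x. I x \<le> n"
    and q: "\<And>i j. i \<le> n \<Longrightarrow> j \<le> n \<Longrightarrow> 0 \<le> q i j"
    and row: "\<And>i. i \<le> n \<Longrightarrow> (\<Sum>j\<le>n. q i j) = measure \<nu> {x. I x = i}"
    and col: "\<And>j. j \<le> n \<Longrightarrow> (\<Sum>i\<le>n. q i j) = measure \<mu> {x. I x = j}"
  obtains \<pi> where "\<pi> \<in> couplings \<nu> \<mu>"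
    "\<And>d. (\<integral>\<^sup>+ z. d (I (fst z)) (I (snd z)) \<partial>\<pi>) = (\<Sum>i\<le>n. \<Sum>j\<le>n. ennreal (q i j) * d i j)"
proof -
  have \<nu>p: "prob_space \<nu>" and sets\<nu>[measurable_cong]: "sets \<nu> = sets borel"
    and \<mu>p: "prob_space \<mu>" and sets\<mu>[measurable_cong]: "sets \<mu> = sets borel"
    using \<nu> \<mu> by (auto simp: space_prob_algebra)
  have sp: "space \<nu> = UNIV" "space \<mu> = UNIV"
    using sets_eq_imp_space_eq[OF sets\<nu>] sets_eq_imp_space_eq[OF sets\<mu>] by auto
  interpret \<nu>: prob_space \<nu> by fact
  interpret \<mu>: prob_space \<mu> by fact
  interpret pair_prob_space \<nu> \<mu> ..
  have [measurable]: "I \<in> borel \<rightarrow>\<^sub>M count_space UNIV" by fact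
  define p where "p i = measure \<nu> {x. I x = i}" for i
  define r where "r j = measure \<mu> {x. I x = j}" for j
  define w where "w i j = ennreal (q i j / (p i * r j))" for i j
  define \<pi> where "\<pi> = density (\<nu> \<Otimes>\<^sub>M \<mu>) (\<lambda>z. w (I (fst z)) (I (snd z)))"
  have p0: "0 \<le> p i" "0 \<le> r i" for i by (auto simp: p_def r_def)
  have q_le: "q i j \<le> p i" "q i j \<le> r j" if "i \<le> n" "j \<le> n" for i j
    using that q member_le_sum[of j "{..n}" "q i"] member_le_sum[of i "{..n}" "\<lambda>i. q i j"]
    by (auto simp: row[symmetric] col[symmetric] p_def r_def)
  \<comment> \<open>On a null cell the quotient has the default value 0. This is consistent, because
    \<open>q i j\<close> lies below both cell masses and vanishes as well.\<close>
  have w: "w i j * ennreal (p i) * ennreal (r j) = ennreal (q i j)" if "i \<le> n" "j \<le> n" for i j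
  proof -
    have "w i j * ennreal (p i) * ennreal (r j) = ennreal (q i j / (p i * r j) * p i * r j)"
      unfolding w_def using p0 q[OF that] by (simp only: ennreal_mult'' mult_nonneg_nonneg)
    also have "q i j / (p i * r j) * p i * r j = q i j"
      using q_le[OF that] q[OF that] p0 by (cases "p i = 0 \<or> r j = 0") auto
    finally show ?thesis .
  qed
  have sets\<pi>[measurable_cong]: "sets \<pi> = sets (borel \<Otimes>\<^sub>M borel)"
    unfolding \<pi>_def using sets_pair_measure_cong[OF sets\<nu> sets\<mu>] by simp
  have em\<nu>: "emeasure \<nu> {x. I x = i} = ennreal (p i)"
    and em\<mu>: "emeasure \<mu> {x. I x = i} = ennreal (r i)" for i
    by (simp_all add: p_def r_def \<nu>.emeasure_eq_measure \<mu>.emeasure_eq_measure)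
  have idx: "(\<integral>\<^sup>+ x. h (I x) \<partial>\<nu>) = (\<Sum>i\<le>n. h i * ennreal (p i))"
    "(\<integral>\<^sup>+ x. h (I x) \<partial>\<mu>) = (\<Sum>i\<le>n. h i * ennreal (r i))" for h
    using nn_integral_finite_index[of I \<nu> n h] nn_integral_finite_index[of I \<mu> n h] I(2)
    by (simp_all add: sp em\<nu> em\<mu>)
  have dens: "(\<integral>\<^sup>+ z. g z \<partial>\<pi>) = (\<integral>\<^sup>+ x. \<integral>\<^sup>+ y. w (I x) (I y) * g (x, y) \<partial>\<mu> \<partial>\<nu>)"
    if [measurable]: "g \<in> borel_measurable (borel \<Otimes>\<^sub>M borel)" for g
  proof -
    have "(\<integral>\<^sup>+ z. g z \<partial>\<pi>) = (\<integral>\<^sup>+ z. w (I (fst z)) (I (snd z)) * g z \<partial>(\<nu> \<Otimes>\<^sub>M \<mu>))"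
      unfolding \<pi>_def by (rule nn_integral_density) measurable
    also have "\<dots> = (\<integral>\<^sup>+ x. \<integral>\<^sup>+ y. w (I x) (I y) * g (x, y) \<partial>\<mu> \<partial>\<nu>)"
      by (subst \<mu>.nn_integral_fst[symmetric]) simp_all
    finally show ?thesis .
  qed
  have dens': "(\<integral>\<^sup>+ z. g z \<partial>\<pi>) = (\<integral>\<^sup>+ y. \<integral>\<^sup>+ x. w (I x) (I y) * g (x, y) \<partial>\<nu> \<partial>\<mu>)"
    if [measurable]: "g \<in> borel_measurable (borel \<Otimes>\<^sub>M borel)" for g
    unfolding dens[OF that] by (rule Fubini'[symmetric]) measurable
  have plan: "(\<integral>\<^sup>+ z. d (I (fst z)) (I (snd z)) \<partial>\<pi>) = (\<Sum>i\<le>n. \<Sum>j\<le>n. ennreal (q i j) * d i j)" for d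
  proof -
    have "(\<integral>\<^sup>+ z. d (I (fst z)) (I (snd z)) \<partial>\<pi>)
      = (\<integral>\<^sup>+ x. \<integral>\<^sup>+ y. w (I x) (I y) * d (I x) (I y) \<partial>\<mu> \<partial>\<nu>)"
      by (subst dens) simp_all
    also have "\<dots> = (\<Sum>i\<le>n. \<Sum>j\<le>n. w i j * ennreal (p i) * ennreal (r j) * d i j)"
      unfolding idx(2)[of "\<lambda>j. w (I _) j * d (I _) j"]
      by (subst idx(1)[of "\<lambda>i. \<Sum>j\<le>n. w i j * d i j * ennreal (r j)"])
         (simp add: sum_distrib_left sum_distrib_right ac_simps)
    also have "\<dots> = (\<Sum>i\<le>n. \<Sum>j\<le>n. ennreal (q i j) * d i j)"
      by (intro sum.cong refl) (simp add: w)
    finally show ?thesis .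
  qed
  have sum_q: "(\<Sum>j\<le>n. ennreal (q i j)) = ennreal (p i)" "(\<Sum>j\<le>n. ennreal (q j i)) = ennreal (r i)"
    if "i \<le> n" for i
    using that q by (subst sum_ennreal; auto simp: row col p_def r_def)+
  have AE_pos: "AE x in \<nu>. p (I x) \<noteq> 0" "AE x in \<mu>. r (I x) \<noteq> 0"
  proof -
    have "(\<integral>\<^sup>+ x. indicator {i. p i = 0} (I x) \<partial>\<nu>) = 0" "(\<integral>\<^sup>+ x. indicator {i. r i = 0} (I x) \<partial>\<mu>)
      = 0"
      unfolding idx by (simp_all add: indicator_def)
    then show "AE x in \<nu>. p (I x) \<noteq> 0" "AE x in \<mu>. r (I x) \<noteq> 0"
      by (subst (asm) nn_integral_0_iff_AE; auto simp: indicator_def split: if_splits)+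
  qed
  have cancel: "a = 1" if "ennreal b * a = ennreal b" "b \<noteq> 0" "0 \<le> b" for a b
  proof -
    have inv: "ennreal (1 / b) * ennreal b = 1" using that by (simp flip: ennreal_mult')
    have "a = ennreal (1 / b) * (ennreal b * a)"
      by (simp only: mult.assoc[symmetric] inv mult_1_left)
    also have "\<dots> = 1" by (simp only: that(1) inv)
    finally show ?thesis .
  qed
  have cancel_nn: "(\<integral>\<^sup>+ x. k (I x) * indicator A x \<partial>M) = emeasure M A"
    if "AE x in M. s (I x) \<noteq> 0" "\<And>i. i \<le> n \<Longrightarrow> ennreal (s i) * k i = ennreal (s i)" "\<And>i. 0
      \<le> s i" "A \<in> sets M"
    for M :: "(real ^ 'k) measure" and s k A
  proof -
    have "(\<integral>\<^sup>+ x. k (I x) * indicator A x \<partial>M) = (\<integral>\<^sup>+ x. indicator A x \<partial>M)"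
      by (rule nn_integral_cong_AE, use that(1) in eventually_elim)
         (use cancel[OF that(2)[OF I(2)] _ that(3)] in simp)
    then show ?thesis using that(4) by simp
  qed
  have scale: "ennreal (p i) * (\<Sum>j\<le>n. w i j * ennreal (r j)) = ennreal (p i)"
    "ennreal (r i) * (\<Sum>j\<le>n. w j i * ennreal (p j)) = ennreal (r i)" if "i \<le> n" for i
  proof -
    have "ennreal (p i) * (\<Sum>j\<le>n. w i j * ennreal (r j))
      = (\<Sum>j\<le>n. w i j * ennreal (p i) * ennreal (r j))"
      "ennreal (r i) * (\<Sum>j\<le>n. w j i * ennreal (p j))
        = (\<Sum>j\<le>n. w j i * ennreal (p j) * ennreal (r i))"
      by (simp_all add: sum_distrib_left ac_simps)
    then show "ennreal (p i) * (\<Sum>j\<le>n. w i j * ennreal (r j)) = ennreal (p i)"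
      "ennreal (r i) * (\<Sum>j\<le>n. w j i * ennreal (p j)) = ennreal (r i)"
      using that by (simp_all add: w sum_q)
  qed
  have marg: "distr \<pi> borel fst = \<nu>" "distr \<pi> borel snd = \<mu>"
  proof -
    show "distr \<pi> borel fst = \<nu>"
    proof (rule measure_eqI)
      fix A assume "A \<in> sets (distr \<pi> borel fst)"
      then have A[measurable]: "A \<in> sets borel" by simp
      have "emeasure (distr \<pi> borel fst) A = (\<integral>\<^sup>+ x. indicator A x \<partial>(distr \<pi> borel fst))" by simp
      also have "\<dots> = (\<integral>\<^sup>+ z. indicator A (fst z) \<partial>\<pi>)" by (rule nn_integral_distr) measurable
      also have "\<dots> = (\<integral>\<^sup>+ x. \<integral>\<^sup>+ y. w (I x) (I y) * indicator A x \<partial>\<mu> \<partial>\<nu>)" by (subst dens) simp_all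
      also have "\<dots> = (\<integral>\<^sup>+ x. (\<Sum>j\<le>n. w (I x) j * ennreal (r j)) * indicator A x \<partial>\<nu>)"
        by (subst nn_integral_multc) (auto simp: idx)
      also have "\<dots> = emeasure \<nu> A"
        by (rule cancel_nn[OF AE_pos(1) scale(1) p0(1)]) (auto simp: sets\<nu>)
      finally show "emeasure (distr \<pi> borel fst) A = emeasure \<nu> A" .
    qed (simp add: sets\<nu>)
    show "distr \<pi> borel snd = \<mu>"
    proof (rule measure_eqI)
      fix A assume "A \<in> sets (distr \<pi> borel snd)"
      then have A[measurable]: "A \<in> sets borel" by simp
      have "emeasure (distr \<pi> borel snd) A = (\<integral>\<^sup>+ x. indicator A x \<partial>(distr \<pi> borel snd))" by simp
      also have "\<dots> = (\<integral>\<^sup>+ z. indicator A (snd z) \<partial>\<pi>)" by (rule nn_integral_distr) measurable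
      also have "\<dots> = (\<integral>\<^sup>+ y. \<integral>\<^sup>+ x. w (I x) (I y) * indicator A y \<partial>\<nu> \<partial>\<mu>)" by (subst dens') simp_all
      also have "\<dots> = (\<integral>\<^sup>+ y. (\<Sum>i\<le>n. w i (I y) * ennreal (p i)) * indicator A y \<partial>\<mu>)"
        by (subst nn_integral_multc) (auto simp: idx(1)[of "\<lambda>i. w i _"])
      also have "\<dots> = emeasure \<mu> A"
        by (rule cancel_nn[OF AE_pos(2) scale(2) p0(2)]) (auto simp: sets\<mu>)
      finally show "emeasure (distr \<pi> borel snd) A = emeasure \<mu> A" .
    qed (simp add: sets\<mu>)
  qed
  have "prob_space \<pi>"
  proof
    have "emeasure \<pi> (space \<pi>) = emeasure (distr \<pi> borel fst) UNIV"
      by (subst emeasure_distr) (simp_all add: measurable_def)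
    then show "emeasure \<pi> (space \<pi>) = 1" using \<nu>.emeasure_space_1 by (simp add: marg sp)
  qed
  then have "\<pi> \<in> couplings \<nu> \<mu>" using marg sets\<pi> by (simp add: couplings_def space_prob_algebra)
  then show ?thesis using plan by (rule that)
qed

subsection \<open>Exponential tails\<close>

context cost_profile
begin

lemma compact_sublevel:
  assumes "\<alpha> t0 \<noteq> 0"
  shows "compact {x :: real ^ 'k. c x \<le> R}"
proof -
  obtain B where B: "\<And>t. \<alpha> t \<le> R \<Longrightarrow> \<bar>t\<bar> \<le> B" using coercive[OF assms] by metis
  have "\<bar>x $ i\<bar> \<le> B" if "c x \<le> R" for x :: "real ^ 'k" and i
  proof (rule B)
    have "\<alpha> (x $ i) \<le> c x" unfolding c_eq by (rule member_le_sum) (auto simp: nonneg)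
    then show "\<alpha> (x $ i) \<le> R" using that by simp
  qed
  then have "norm x \<le> (\<Sum>i\<in>(UNIV :: 'k set). B)" if "c x \<le> R" for x :: "real ^ 'k"
    using that by (intro order_trans[OF norm_le_l1_cart] sum_mono)
  then have "bounded {x :: real ^ 'k. c x \<le> R}" by (intro boundedI) auto
  moreover have "closed {x :: real ^ 'k. c x \<le> R}"
    by (intro closed_Collect_le c_continuous continuous_intros)
  ultimately show ?thesis by (simp add: compact_eq_bounded_closed)
qed

text \<open>The first estimate is uniform continuity of \<open>c\<close> on the compact set of
  differences of \<open>K\<close>; the second is continuity at 0 and bounds the price of starting
  the flow at time 7/25.\<close>

lemma c_mesh:
  fixes K :: "(real ^ 'k) set"
  assumes K: "compact K" and \<epsilon>: "0 < \<epsilon>"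
  obtains \<eta> where "0 < \<eta>"
    "\<And>x x' u u'. x \<in> K \<Longrightarrow> x' \<in> K \<Longrightarrow> u \<in> K \<Longrightarrow> u' \<in> K \<Longrightarrow> dist x u < \<eta> \<Longrightarrow> dist x' u' < \<eta> \<Longrightarrow>
      c (x - x') \<le> c (u - u') + \<epsilon>"
    "\<And>x y :: real ^ 'k. dist x y < \<eta> \<Longrightarrow> 7 / 25 * c ((x - y) /\<^sub>R (7 / 25)) \<le> \<epsilon>"
proof -
  let ?K = "{x - x' |x x'. x \<in> K \<and> x' \<in> K}"
  have "uniformly_continuous_on ?K c"
    using compact_uniformly_continuous[OF continuous_on_subset[OF c_continuous subset_UNIV]
      compact_differences[OF K K]] .
  then obtain d1 where d1: "0 < d1" "\<And>u v. u \<in> ?K \<Longrightarrow> v \<in> ?K \<Longrightarrow> dist v u < d1 \<Longrightarrow> dist (c v) (c u) < \<epsilon>"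
    by (rule uniformly_continuous_onE[OF _ \<epsilon>]) blast
  have "isCont c (0 :: real ^ 'k)" 
    by (rule bspec[OF iffD1[OF continuous_on_eq_continuous_at[OF open_UNIV] c_continuous]]) simp
  then have "\<exists>d>0. \<forall>v. dist v (0 :: real ^ 'k) < d \<longrightarrow> dist (c v) (c (0 :: real ^ 'k)) < \<epsilon>"
    using \<epsilon> by (simp only: continuous_at_eps_delta)
  then obtain d2 where d2: "0 < d2" "\<And>v :: real ^ 'k. dist v 0 < d2
    \<Longrightarrow> dist (c v) (c (0 :: real ^ 'k)) < \<epsilon>"
    by blast
  \<comment> \<open>Two displacements add up in the first estimate, hence \<open>d1 / 2\<close>; in
    the second, 25/7 < 4.\<close>
  define \<eta> where "\<eta> = min (d1 / 2) (d2 / 4)"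
  show ?thesis
  proof (rule that[of \<eta>])
    show "0 < \<eta>" using d1 d2 by (simp add: \<eta>_def)
  next
    fix x x' u u' assume K: "x \<in> K" "x' \<in> K" "u \<in> K" "u' \<in> K" and d: "dist x u < \<eta>" "dist x' u' < \<eta>"
    have "dist (x - x') (u - u') \<le> dist x u + dist x' u'"
      unfolding dist_norm using norm_triangle_ineq4[of "x - u" "x' - u'"]
        by (simp add: algebra_simps)
    also have "\<dots> < d1" using d by (simp add: \<eta>_def)
    finally have "dist (c (x - x')) (c (u - u')) < \<epsilon>" by (intro d1) (use K in auto)
    then show "c (x - x') \<le> c (u - u') + \<epsilon>" by (simp add: dist_real_def abs_less_iff)
  next
    fix x y :: "real ^ 'k" assume "dist x y < \<eta>"
    then have "norm (x - y) * 4 < d2" by (simp add: dist_norm \<eta>_def)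
    then have "norm (x - y) * (25 / 7) < d2" using norm_ge_zero[of "x - y"] by linarith
    then have "dist (c ((x - y) /\<^sub>R (7 / 25))) (c (0 :: real ^ 'k)) < \<epsilon>"
      by (intro d2(2)) (simp add: dist_norm)
    then have "c ((x - y) /\<^sub>R (7 / 25)) < \<epsilon>" by (simp add: dist_real_def c_zero abs_less_iff)
    then show "7 / 25 * c ((x - y) /\<^sub>R (7 / 25)) \<le> \<epsilon>"
      using c_nonneg[of "(x - y) /\<^sub>R (7 / 25)"] by linarith
  qed
qed

section \<open>Concentration of the reference measure and integrability of the cost\<close>

context
  fixes \<mu> :: "(real ^ 'k) measure" and C t0 :: real
  assumes \<mu>: "\<mu> \<in> space (prob_algebra borel)" and C: "0 < C" and rM: "rMLSI \<mu> c C"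
    and t0: "\<alpha> t0 \<noteq> 0"
begin

interpretation \<mu>: prob_space \<mu> using \<mu> by (simp add: space_prob_algebra)

lemma sets_\<mu> [measurable_cong]: "sets \<mu> = sets borel" using \<mu> by (simp add: space_prob_algebra)

lemma space_\<mu>: "space \<mu> = UNIV" using sets_eq_imp_space_eq[OF sets_\<mu>] by simp

abbreviation a0 :: real where "a0 \<equiv> dual_rate C"

lemma a0_pos: "0 < a0" using C by (simp add: dual_rate_def)

text \<open>The dual inequality is applied to kernels of height \<open>N\<close> at net points of
  the annulus. They reach \<open>N - 1\<close> on the annulus at the early time, and by the
  quasi-triangle inequality they are nonpositive at time 1 wherever \<open>c x <= r\<close>. The
  mean of \<open>w\<close> is thus at most \<open>N / 4\<close>, and Markov's inequality for exp(a0
  v) gives the decay.\<close>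

lemma tail_bound_annulus:
  assumes r: "measure \<mu> {x. r < c x} \<le> 1 / 4" and N: "1 \<le> N"
  shows "measure \<mu> {x. 2 * N + 2 * r \<le> c x \<and> c x \<le> R} \<le> exp (a0 - 3 / 4 * a0 * N)"
proof -
  define S where "S = {x :: real ^ 'k. 2 * N + 2 * r \<le> c x \<and> c x \<le> R}"
  have "S = {x. c x \<le> R} \<inter> {x. 2 * N + 2 * r \<le> c x}" by (auto simp: S_def)
  moreover have "closed {x :: real ^ 'k. 2 * N + 2 * r \<le> c x}"
    by (intro closed_Collect_le c_continuous continuous_intros)
  ultimately have S: "compact S"
    using compact_Int_closed[OF compact_sublevel[OF t0]] by (simp only:)
  then have [measurable]: "S \<in> sets borel" by (simp add: borel_compact)
  obtain \<eta> where \<eta>: "0 < \<eta>" "\<And>x y :: real ^ 'k. dist x y < \<eta>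
    \<Longrightarrow> 7 / 25 * c ((x - y) /\<^sub>R (7 / 25)) \<le> 1"
    using c_mesh[OF S, of 1] by (metis zero_less_one)
  obtain n :: nat and y :: "nat \<Rightarrow> real ^ 'k" and I where I: "\<And>x. I x \<le> n" "\<And>x. I x = 0 \<longleftrightarrow> x \<notin> S"
    and y: "\<And>j. j \<in> {1..n} \<Longrightarrow> y j \<in> S" "\<And>x. x \<in> S \<Longrightarrow> dist x (y (I x)) < \<eta>"
    using finite_net[OF S \<eta>(1)] by metis
  define v where "v x = indicator S x * (N - 1)" for x
  define w where "w x = indicator {x. r < c x} x * N" for x :: "real ^ 'k"
  have [measurable]: "v \<in> borel_measurable borel" "w \<in> borel_measurable borel"
    unfolding v_def[abs_def] w_def[abs_def] by measurable
  have "ln (\<integral>x. exp (a0 * v x) \<partial>\<mu>) \<le> a0 * (\<integral>x. w x \<partial>\<mu>)"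
  proof (rule rMLSI_dual[OF \<mu> rM C, where J = "{..n}" and base = 0 and M = N
        and b = "\<lambda>j. if j = 0 then 0 else 1" and g = "\<lambda>j. if j = 0 then 0 else N" and y = y])
    fix x
    show "\<bar>v x\<bar> \<le> N" "\<bar>w x\<bar> \<le> N" using N by (auto simp: v_def w_def indicator_def)
    show "\<exists>j\<in>{..n}. v x \<le> (if j = 0 then 0 else N) - (if j
      = 0 then 0 else 1) * (7 / 25 * c ((x - y j) /\<^sub>R (7 / 25)))"
      using \<eta>(2)[OF y(2), of x] I[of x]
      by (intro bexI[of _ "I x"]) (auto simp: v_def indicator_def)
    fix j assume j: "j \<in> {..n}"
    show "(if j = 0 then 0 else N) - (if j = 0 then 0 else 1) * c (x - y j) \<le> w x"
    proof (cases "j = 0")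
      case False
      then have "2 * N + 2 * r \<le> c (y j)" using y(1)[of j] j by (auto simp: S_def)
      also have "c (y j) \<le> 2 * c x + 2 * c (x - y j)"
        using c_diff_le[of x "x - y j"] by simp
      finally show ?thesis using False c_nonneg[of "x - y j"] by (auto simp: w_def indicator_def)
    qed (use N in \<open>simp add: w_def\<close>)
  qed auto
  also have "(\<integral>x. w x \<partial>\<mu>) = measure \<mu> {x. r < c x} * N"
    unfolding w_def by (simp add: space_\<mu>)
  also have "a0 * (measure \<mu> {x. r < c x} * N) \<le> a0 * (1 / 4 * N)"
    using r N a0_pos by (intro mult_left_mono mult_right_mono) auto
  finally have ln: "ln (\<integral>x. exp (a0 * v x) \<partial>\<mu>) \<le> a0 * N / 4" by simp
  have bd: "\<bar>a0 * v x\<bar> \<le> a0 * N" for x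
    using N a0_pos by (auto simp: v_def indicator_def)
  have v\<mu>: "(\<lambda>x. a0 * v x) \<in> borel_measurable \<mu>" by measurable
  note Iv = exp_bounded_integrable[OF \<mu>.prob_space_axioms v\<mu> bd]
  have "exp (a0 * (N - 1)) * measure \<mu> S = (\<integral>x. exp (a0 * (N - 1)) * indicator S x \<partial>\<mu>)"
    by (simp add: space_\<mu>)
  also have "\<dots> \<le> (\<integral>x. exp (a0 * v x) \<partial>\<mu>)"
  proof (rule integral_mono)
    show "integrable \<mu> (\<lambda>x. exp (a0 * (N - 1)) * indicator S x)"
      by (intro integrable_mult_right integrable_real_indicator) (auto simp: less_top[symmetric])
    show "integrable \<mu> (\<lambda>x. exp (a0 * v x))" by (rule Iv(2))
  qed (auto simp: v_def indicator_def)
  also have "\<dots> \<le> exp (a0 * N / 4)" using ln Iv(4) by (metis exp_le_cancel_iff exp_ln)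
  finally have "measure \<mu> S \<le> exp (a0 * N / 4) / exp (a0 * (N - 1))"
    by (simp add: pos_le_divide_eq mult.commute)
  also have "\<dots> = exp (a0 - 3 / 4 * a0 * N)" by (simp add: exp_diff[symmetric] algebra_simps)
  finally show ?thesis by (simp add: S_def)
qed

text \<open>The bound for the annulus does not depend on \<open>R\<close>, which served to make the
  set compact; continuity of the measure from below removes it.\<close>

lemma tail_bound:
  assumes r: "measure \<mu> {x. r < c x} \<le> 1 / 4" and N: "1 \<le> N"
  shows "measure \<mu> {x. 2 * N + 2 * r \<le> c x} \<le> exp (a0 - 3 / 4 * a0 * N)"
proof (rule LIMSEQ_le_const2)
  let ?A = "\<lambda>m :: nat. {x :: real ^ 'k. 2 * N + 2 * r \<le> c x \<and> c x \<le> real m}"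
  have "(\<lambda>m. measure \<mu> (?A m)) \<longlonglongrightarrow> measure \<mu> (\<Union>m. ?A m)"
  proof (rule \<mu>.finite_Lim_measure_incseq)
    show "range ?A \<subseteq> sets \<mu>" by auto
    show "incseq ?A" by (auto simp: incseq_def)
  qed
  moreover have "(\<Union>m. ?A m) = {x :: real ^ 'k. 2 * N + 2 * r \<le> c x}"
    using real_arch_simple by auto
  ultimately show "(\<lambda>m. measure \<mu> (?A m)) \<longlonglongrightarrow> measure \<mu> {x. 2 * N + 2 * r \<le> c x}" by simp
  show "\<exists>m. \<forall>k\<ge>m. measure \<mu> (?A k) \<le> exp (a0 - 3 / 4 * a0 * N)"
    using tail_bound_annulus[OF r N] by blast
qed

text \<open>The space is cut into layers of width 2 in the value of \<open>c\<close>, and the tail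
  bounds turn the integral into a geometric series.\<close>

lemma exp_c_integrable: "(\<integral>\<^sup>+ x. ennreal (exp (a0 / 4 * c x)) \<partial>\<mu>) < \<infinity>"
proof -
  obtain r where r: "measure \<mu> {x. r < c x} \<le> 1 / 4" "0 \<le> r"
  proof -
    have "(\<lambda>m. measure \<mu> {x. real m < c x}) \<longlonglongrightarrow> measure \<mu> (\<Inter>m. {x. real m < c x})"
      by (rule \<mu>.finite_Lim_measure_decseq) (auto simp: decseq_def)
    moreover have "(\<Inter>m. {x :: real ^ 'k. real m < c x}) = {}"
      using real_arch_simple[of "c _"] by (auto simp flip: not_le)
    ultimately have "(\<lambda>m. measure \<mu> {x. real m < c x}) \<longlonglongrightarrow> 0" by simp
    then have "\<forall>\<^sub>F m in sequentially. measure \<mu> {x. real m < c x} < 1 / 4"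
      by (rule order_tendstoD) simp
    from eventually_happens'[OF sequentially_bot this]
    obtain m :: nat where "measure \<mu> {x. real m < c x} < 1 / 4" by blast
    then show ?thesis by (intro that[of "real m"]) auto
  qed
  \<comment> \<open>In these units the tail bound decays like exp(-3 k N), while the integrand on
    layer \<open>N\<close> grows like exp(2 k N).\<close>
  define k where "k = a0 / 4"
  have k: "0 < k" using a0_pos by (simp add: k_def)
  define T where "T N = {x :: real ^ 'k. 2 * real (Suc N) + 2 * r \<le> c x}" for N
  have [measurable]: "T N \<in> sets borel" for N unfolding T_def by measurable
  have "(\<integral>\<^sup>+ x. ennreal (exp (k * c x)) \<partial>\<mu>)
      \<le> (\<integral>\<^sup>+ x. ennreal (exp (k * (2 + 2 * r))) + (\<Sum>N. ennreal (exp (k * (2 * real N + 4 + 2 * r)))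
        * indicator (T N) x) \<partial>\<mu>)"
  proof (rule nn_integral_mono)
    fix x
    show "ennreal (exp (k * c x)) \<le> ennreal (exp (k * (2 + 2 * r)))
        + (\<Sum>N. ennreal (exp (k * (2 * real N + 4 + 2 * r))) * indicator (T N) x)"
    proof (cases "c x \<le> 2 + 2 * r")
      case True
      then have "ennreal (exp (k * c x)) \<le> ennreal (exp (k * (2 + 2 * r)))" using k
        by (simp add: ennreal_leI)
      then show ?thesis by (rule order_trans) simp
    next
      case False
      \<comment> \<open>The layer of \<open>x\<close>: 2 N + 2 + 2 r <= c x < 2 N + 4 + 2 r.\<close>
      define N where "N = nat \<lfloor>(c x - 2 - 2 * r) / 2\<rfloor>"
      have N: "real N \<le> (c x - 2 - 2 * r) / 2" "(c x - 2 - 2 * r) / 2 < real N + 1"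
      proof -
        have "0 \<le> (c x - 2 - 2 * r) / 2" using False by simp
        then have "real N = real_of_int \<lfloor>(c x - 2 - 2 * r) / 2\<rfloor>" unfolding N_def
          by (intro of_nat_nat) simp
        then show "real N \<le> (c x - 2 - 2 * r) / 2" "(c x - 2 - 2 * r) / 2 < real N + 1"
          using floor_correct[of "(c x - 2 - 2 * r) / 2"] by simp_all
      qed
      have "ennreal (exp (k * c x)) \<le> ennreal (exp (k * (2 * real N + 4 + 2 * r))) * indicator (T N)
        x"
        using N k by (auto simp: T_def indicator_def intro!: ennreal_leI)
      also have "\<dots> \<le> (\<Sum>N. ennreal (exp (k * (2 * real N + 4 + 2 * r))) * indicator (T N) x)"
      proof -
        have "g N \<le> suminf g" for g :: "nat \<Rightarrow> ennreal"
          using sum_le_suminf[of g "{N}"] by simp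
        then show ?thesis .
      qed
      finally show ?thesis by (rule order_trans) simp
    qed
  qed
  also have "\<dots> = ennreal (exp (k * (2 + 2 * r))) + (\<Sum>N. ennreal (exp (k * (2 * real N + 4 + 2 * r)))
    * emeasure \<mu> (T N))"
    by (subst nn_integral_add, simp, simp, subst nn_integral_suminf)
       (simp_all add: nn_integral_cmult_indicator \<mu>.emeasure_space_1)
  also have "\<dots> \<le> ennreal (exp (k * (2 + 2 * r))) + (\<Sum>N. ennreal (exp (k * (5 + 2 * r)) * exp (- k) ^
    N))"
  proof (intro add_left_mono suminf_le)
    fix N
    have "exp (k * (2 * real N + 4 + 2 * r)) * measure \<mu> (T N)
        \<le> exp (k * (2 * real N + 4 + 2 * r)) * exp (a0 - 3 / 4 * a0 * real (Suc N))"
      unfolding T_def by (intro mult_left_mono tail_bound[OF r(1)]) auto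
    also have "\<dots> = exp (k * (5 + 2 * r)) * exp (- k) ^ N"
      by (simp add: k_def exp_of_nat_mult[symmetric] exp_add[symmetric] field_simps)
    finally show "ennreal (exp (k * (2 * real N + 4 + 2 * r))) * emeasure \<mu> (T N)
      \<le> ennreal (exp (k * (5 + 2 * r)) * exp (- k) ^ N)"
      by (simp add: \<mu>.emeasure_eq_measure ennreal_leI flip: ennreal_mult)
  qed auto
  also have "(\<Sum>N. ennreal (exp (k * (5 + 2 * r)) * exp (- k) ^ N)) < \<infinity>"
    using k by (subst suminf_ennreal2) (auto intro!: summable_mult summable_geometric)
  finally show ?thesis by (simp add: k_def)
qed

text \<open>\<open>Gibbs\<close> with truncations of k c as test functions bounds their \<nu>-means
  by the entropy plus the log of an exponential moment under \<mu>; Fatou's lemma removes the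
  truncation.\<close>

lemma c_integrable_of_entropy:
  assumes \<nu>: "\<nu> \<in> space (prob_algebra borel)" and h: "rel_entropy \<nu> \<mu> = ereal h"
  shows "integrable \<nu> c"
proof -
  have \<nu>p: "prob_space \<nu>" and sets\<nu>[measurable_cong]: "sets \<nu> = sets borel"
    using \<nu> by (auto simp: space_prob_algebra)
  interpret \<nu>: prob_space \<nu> by fact
  define k where "k = a0 / 4"
  have k: "0 < k" using a0_pos by (simp add: k_def)
  obtain B where B: "(\<integral>\<^sup>+ x. ennreal (exp (k * c x)) \<partial>\<mu>) = ennreal B" "0 \<le> B"
    using exp_c_integrable by (cases "\<integral>\<^sup>+ x. ennreal (exp (k * c x)) \<partial>\<mu>") (auto simp: k_def)
  define \<phi> where "\<phi> m x = min (k * c x) (real m)" for m and x :: "real ^ 'k"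
  have [measurable]: "\<phi> m \<in> borel_measurable borel" for m unfolding \<phi>_def[abs_def] by measurable
  have \<phi>b: "\<bar>\<phi> m x\<bar> \<le> real m" "0 \<le> \<phi> m x" for m and x :: "real ^ 'k"
    using k c_nonneg[of x] by (auto simp: \<phi>_def abs_le_iff)
  have \<phi>\<mu>: "\<phi> m \<in> borel_measurable \<mu>" for m by measurable
  have \<phi>\<nu>: "\<phi> m \<in> borel_measurable \<nu>" for m by measurable
  have le: "(\<integral>\<^sup>+ x. ennreal (\<phi> m x) \<partial>\<nu>) \<le> ennreal (h + ln B)" for m
  proof -
    note I = exp_bounded_integrable[OF \<mu>.prob_space_axioms \<phi>\<mu> \<phi>b(1)]
    have "ennreal (\<integral>x. exp (\<phi> m x) \<partial>\<mu>) = (\<integral>\<^sup>+ x. ennreal (exp (\<phi> m x)) \<partial>\<mu>)"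
      using I by (intro nn_integral_eq_integral[symmetric]) auto
    also have "\<dots> \<le> ennreal B"
      unfolding B(1)[symmetric] by (intro nn_integral_mono ennreal_leI) (simp add: \<phi>_def)
    finally have "(\<integral>x. exp (\<phi> m x) \<partial>\<mu>) \<le> B" using B by simp
    then have "ln (\<integral>x. exp (\<phi> m x) \<partial>\<mu>) \<le> ln B" using I(4) by (simp add: ln_mono)
    moreover have "(\<integral>x. \<phi> m x \<partial>\<nu>) - ln (\<integral>x. exp (\<phi> m x) \<partial>\<mu>) \<le> h"
      using Gibbs[OF \<mu>.prob_space_axioms \<nu>p _ \<phi>\<mu> \<phi>b(1)] sets\<nu> sets_\<mu> h by simp
    ultimately have "(\<integral>x. \<phi> m x \<partial>\<nu>) \<le> h + ln B" by simp
    then have "ennreal (\<integral>x. \<phi> m x \<partial>\<nu>) \<le> ennreal (h + ln B)" by (rule ennreal_leI)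
    also have "ennreal (\<integral>x. \<phi> m x \<partial>\<nu>) = (\<integral>\<^sup>+ x. ennreal (\<phi> m x) \<partial>\<nu>)"
      using exp_bounded_integrable(1)[OF \<nu>p \<phi>\<nu> \<phi>b(1)] \<phi>b(2)
        by (intro nn_integral_eq_integral[symmetric]) auto
    finally show ?thesis .
  qed
  have "(\<integral>\<^sup>+ x. ennreal (k * c x) \<partial>\<nu>) = (\<integral>\<^sup>+ x. liminf (\<lambda>m. ennreal (\<phi> m x)) \<partial>\<nu>)"
  proof (rule nn_integral_cong)
    fix x :: "real ^ 'k"
    obtain m0 where m0: "k * c x \<le> real m0" using real_arch_simple by blast
    have "(\<lambda>m. ennreal (\<phi> m x)) \<longlonglongrightarrow> ennreal (k * c x)"
      by (rule tendsto_eventually, unfold eventually_sequentially, rule exI[of _ m0]) (use m0 in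
        \<open>auto simp: \<phi>_def min_def\<close>)
    then show "ennreal (k * c x) = liminf (\<lambda>m. ennreal (\<phi> m x))" by (simp add: lim_imp_Liminf)
  qed
  also have "\<dots> \<le> liminf (\<lambda>m. \<integral>\<^sup>+ x. ennreal (\<phi> m x) \<partial>\<nu>)"
    by (rule nn_integral_liminf) measurable
  also have "\<dots> \<le> ennreal (h + ln B)"
    using le by (intro Liminf_le) (auto intro: always_eventually)
  finally have "(\<integral>\<^sup>+ x. ennreal (k * c x) \<partial>\<nu>) \<le> ennreal (h + ln B)" .
  moreover have "0 \<le> k * c x" for x :: "real ^ 'k"
    using k c_nonneg[of x] by (intro mult_nonneg_nonneg) auto
  ultimately have "integrable \<nu> (\<lambda>x. k * c x)"
    by (intro integrableI_nonneg) (auto intro: le_less_trans)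
  then show ?thesis using k by simp
qed

lemma c_integrable: "integrable \<mu> c"
proof -
  have "(\<integral>\<^sup>+ x. ennreal (a0 / 4 * c x) \<partial>\<mu>) \<le> (\<integral>\<^sup>+ x. ennreal (exp (a0 / 4 * c x)) \<partial>\<mu>)"
    by (intro nn_integral_mono ennreal_leI) (smt (verit) exp_ge_add_one_self)
  moreover have "0 \<le> a0 / 4 * c x" for x :: "real ^ 'k"
    using a0_pos c_nonneg[of x] by (intro mult_nonneg_nonneg) auto
  ultimately have "integrable \<mu> (\<lambda>x. a0 / 4 * c x)"
    using exp_c_integrable by (intro integrableI_nonneg) (auto intro: le_less_trans)
  from Bochner_Integration.integrable_mult_right[OF this, of "4 / a0"]
  show ?thesis using a0_pos by simp
qed

end
end

subsection \<open>From semi-convex functions to transport\<close>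

lemma integral_tail_tendsto_0:
  fixes g :: "'a \<Rightarrow> real"
  assumes "integrable M g"
  shows "(\<lambda>m. \<integral>x. g x * indicator {x. real m < g x} x \<partial>M) \<longlonglongrightarrow> 0"
proof -
  have [measurable]: "g \<in> borel_measurable M" using assms by simp
  have eq: "g x * indicator {x. real m < g x} x = (if real m < g x then g x else 0)" for m x
    by (simp add: indicator_def)
  have "(\<lambda>m. \<integral>x. (if real m < g x then g x else 0) \<partial>M) \<longlonglongrightarrow> (\<integral>x. 0 \<partial>M)"
  proof (rule integral_dominated_convergence[where w = "\<lambda>x. \<bar>g x\<bar>"])
    show "AE x in M. (\<lambda>m. if real m < g x then g x else 0) \<longlonglongrightarrow> 0"
    proof (rule AE_I2)
      fix x
      obtain m0 where "g x \<le> real m0" using real_arch_simple by blast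
      then show "(\<lambda>m. if real m < g x then g x else 0) \<longlonglongrightarrow> 0"
        by (intro tendsto_eventually) (auto simp: eventually_sequentially intro!: exI[of _ m0])
    qed
  qed (use assms in auto)
  then show ?thesis by (simp only: eq) simp
qed

context cost_profile
begin

context
  fixes \<mu> :: "(real ^ 'k) measure" and C t0 :: real
  assumes \<mu>: "\<mu> \<in> space (prob_algebra borel)" and C: "0 < C" and rM: "rMLSI \<mu> c C"
    and t0: "\<alpha> t0 \<noteq> 0"
begin

text \<open>On finitely many cells, \<open>rMLSI_dual\<close> and \<open>Gibbs\<close> bound every
  dual value. \<open>finite_Kantorovich\<close> turns this into a discrete plan,
  \<open>glued_coupling\<close> lifts the plan to \<nu> and \<mu>, and integrability of
  \<open>c\<close> under both measures absorbs what lies outside the compact set.\<close>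

lemma transport_cost_le_entropy:
  assumes \<nu>: "\<nu> \<in> space (prob_algebra borel)" and h: "rel_entropy \<nu> \<mu> = ereal h"
  shows "transport_cost c \<nu> \<mu> \<le> ennreal (h / dual_rate C)"
proof (rule ennreal_le_epsilon)
  fix \<epsilon>' :: real assume \<epsilon>': "0 < \<epsilon>'"
  \<comment> \<open>The budget: two parts for the dual bound, one for the mesh inside
    \<open>K\<close>, one for each tail.\<close>
  define \<epsilon> where "\<epsilon> = \<epsilon>' / 5"
  have \<epsilon>: "0 < \<epsilon>" using \<epsilon>' by (simp add: \<epsilon>_def)
  have \<nu>p: "prob_space \<nu>" and sets\<nu>[measurable_cong]: "sets \<nu> = sets borel"
    and \<mu>p: "prob_space \<mu>" and sets\<mu>[measurable_cong]: "sets \<mu> = sets borel"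
    using \<nu> \<mu> by (auto simp: space_prob_algebra)
  have sp: "space \<nu> = UNIV" "space \<mu> = UNIV"
    using sets_eq_imp_space_eq[OF sets\<nu>] sets_eq_imp_space_eq[OF sets\<mu>] by auto
  interpret \<nu>: prob_space \<nu> by fact
  interpret \<mu>: prob_space \<mu> by fact
  let ?a = "dual_rate C"
  have a0: "0 < ?a" by (rule a0_pos[OF \<mu> C rM t0])
  have h0: "0 \<le> h" using rel_entropy_nonneg[OF \<mu>p \<nu>p] sets\<nu> sets\<mu> h by simp
  have ci: "integrable \<nu> c" "integrable \<mu> c"
    by (rule c_integrable_of_entropy[OF \<mu> C rM t0 \<nu> h], rule c_integrable[OF \<mu> C rM t0])
  have "\<forall>\<^sub>F m in sequentially. (\<integral>x. c x * indicator {x. real m < c x} x \<partial>\<nu>) < \<epsilon> / 4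
      \<and> (\<integral>x. c x * indicator {x. real m < c x} x \<partial>\<mu>) < \<epsilon> / 4"
    using \<epsilon> by (intro eventually_conj order_tendstoD(2)[OF integral_tail_tendsto_0] ci) simp_all
  from eventually_happens'[OF sequentially_bot this]
  obtain m :: nat where m: "(\<integral>x. c x * indicator {x. real m < c x} x \<partial>\<nu>) < \<epsilon> / 4"
      "(\<integral>x. c x * indicator {x. real m < c x} x \<partial>\<mu>) < \<epsilon> / 4"
    by blast
  define R where "R = real m"
  \<comment> \<open>If a point lies outside \<open>K\<close>, the larger of \<open>c x\<close> and
    \<open>c x'\<close> exceeds \<open>R\<close>, and the quasi-triangle bound
    \<open>2 * c x + 2 * c x'\<close> is at most four times it.\<close>
  define B where "B x = 4 * (c x * indicator {x. R < c x} x)" for x :: "real ^ 'k"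
  have B0: "0 \<le> B x" for x using c_nonneg[of x] by (simp add: B_def)
  define A where "A x = ennreal (B x)" for x
  have [measurable]: "A \<in> borel_measurable borel" unfolding A_def[abs_def] B_def by measurable
  have A: "(\<integral>\<^sup>+ x. A x \<partial>M) \<le> ennreal \<epsilon>"
    if "integrable M c" "(\<integral>x. c x * indicator {x. real m < c x} x \<partial>M) < \<epsilon> / 4" "sets M = sets borel"
      for M
  proof -
    have [measurable_cong]: "sets M = sets borel" by fact
    have i: "integrable M (\<lambda>x. c x * indicator {x. R < c x} x)"
      using that(1) by (rule integrable_real_mult_indicator[rotated]) measurable
    then have "(\<integral>\<^sup>+ x. A x \<partial>M) = ennreal (\<integral>x. 4 * (c x * indicator {x. R < c x} x) \<partial>M)"
      unfolding A_def B_def by (intro nn_integral_eq_integral) (auto simp: c_nonneg intro!: AE_I2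
        mult_nonneg_nonneg)
    also have "\<dots> \<le> ennreal \<epsilon>" using that(2) by (intro ennreal_leI) (simp add: R_def)
    finally show ?thesis .
  qed
  define K where "K = {x :: real ^ 'k. c x \<le> R}"
  have K: "compact K" unfolding K_def by (rule compact_sublevel[OF t0])
  obtain \<eta> where \<eta>: "0 < \<eta>"
    "\<And>x x' u u'. x \<in> K \<Longrightarrow> x' \<in> K \<Longrightarrow> u \<in> K \<Longrightarrow> u' \<in> K \<Longrightarrow> dist x u < \<eta> \<Longrightarrow> dist x' u' < \<eta> \<Longrightarrow>
      c (x - x') \<le> c (u - u') + \<epsilon>"
    "\<And>x y :: real ^ 'k. dist x y < \<eta> \<Longrightarrow> 7 / 25 * c ((x - y) /\<^sub>R (7 / 25)) \<le> \<epsilon>"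
    by (rule c_mesh[OF K \<epsilon>]) (rule that; simp)
  obtain n :: nat and y :: "nat \<Rightarrow> real ^ 'k" and I where
    I[measurable]: "I \<in> borel \<rightarrow>\<^sub>M count_space UNIV" and In: "\<And>x. I x \<le> n"
      and I0: "\<And>x. I x = 0 \<longleftrightarrow> x \<notin> K"
    and yK: "\<And>j. j \<in> {1..n} \<Longrightarrow> y j \<in> K" and y: "\<And>x. x \<in> K \<Longrightarrow> dist x (y (I x)) < \<eta>"
    by (rule finite_net[OF K \<eta>(1)]) (rule that; simp)
  \<comment> \<open>Moving to or from the outer cell 0 is free in the discrete problem: its true
    cost is charged to \<open>B\<close>. This fits the flow, where the base index 0 has
    \<open>b = 0\<close> and contributes a constant.\<close>
  define d where "d i j = (if i = 0 \<or> j = 0 then 0 else c (y i - y j))" for i j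
  define p where "p i = measure \<nu> {x. I x = i}" for i
  define r where "r i = measure \<mu> {x. I x = i}" for i
  have I': "I \<in> \<nu> \<rightarrow>\<^sub>M count_space UNIV" "I \<in> \<mu> \<rightarrow>\<^sub>M count_space UNIV"
    using I by (simp_all only: measurable_cong_sets[OF sets\<nu> refl] measurable_cong_sets[OF sets\<mu>
      refl])
  have idx: "(\<integral>x. g (I x) \<partial>\<nu>) = (\<Sum>i\<le>n. g i * p i)" "(\<integral>x. g (I x) \<partial>\<mu>) = (\<Sum>i\<le>n. g i * r i)"
    for g :: "nat \<Rightarrow> real"
    using integral_finite_index[OF \<nu>.finite_measure_axioms I'(1), of n g]
      integral_finite_index[OF \<mu>.finite_measure_axioms I'(2), of n g] In
    by (simp_all add: sp p_def r_def)
  have p1: "sum p {..n} = 1" "sum r {..n} = 1"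
    using idx[of "\<lambda>_. 1"] by (simp_all add: \<nu>.prob_space \<mu>.prob_space)
  have dual: "(\<Sum>i\<le>n. \<phi> i * p i) + (\<Sum>j\<le>n. \<psi> j * r j) \<le> h / ?a + 2 * \<epsilon>"
    if le: "\<And>i j. i \<in> {..n} \<Longrightarrow> j \<in> {..n} \<Longrightarrow> \<phi> i + \<psi> j \<le> d i j" for \<phi> \<psi> :: "nat \<Rightarrow> real"
  proof -
    define M where "M = Max ((\<lambda>i. \<bar>\<phi> i\<bar> + \<bar>\<psi> i\<bar>) ` {..n}) + \<epsilon>"
    have M: "\<bar>\<phi> (I x)\<bar> + \<bar>\<psi> (I x)\<bar> + \<epsilon> \<le> M" for x
      unfolding M_def using In[of x] by (intro add_right_mono Max_ge) auto
    have bd: "\<bar>\<phi> (I x) - \<epsilon>\<bar> \<le> M" "\<bar>- \<psi> (I x) + \<epsilon>\<bar> \<le> M" for x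
      using M[of x] \<epsilon> by linarith+
    \<comment> \<open>Lowering the first function by \<epsilon> pays for the kernel at the net point
      of \<open>x\<close> at time 7/25; raising the second pays for replacing \<open>x\<close> by
      its net point in the cost.\<close>
    have "ln (\<integral>x. exp (?a * (\<phi> (I x) - \<epsilon>)) \<partial>\<mu>) \<le> ?a * (\<integral>x. - \<psi> (I x) + \<epsilon> \<partial>\<mu>)"
      proof (rule rMLSI_dual[OF \<mu> rM C, where J = "{..n}" and base = 0 and M = M
          and b = "\<lambda>j. if j = 0 then 0 else 1" and g = \<phi> and y = y])
      fix x
      show "\<exists>j\<in>{..n}. \<phi> (I x) - \<epsilon> \<le> \<phi> j - (if j
        = 0 then 0 else 1) * (7 / 25 * c ((x - y j) /\<^sub>R (7 / 25)))"
        using \<eta>(3)[OF y, of x] In[of x] I0[of x] \<epsilon> by (intro bexI[of _ "I x"]) auto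
      fix j assume j: "j \<in> {..n}"
      have lej: "\<phi> j + \<psi> (I x) \<le> d j (I x)" using le j In[of x] by simp
      show "\<phi> j - (if j = 0 then 0 else 1) * c (x - y j) \<le> - \<psi> (I x) + \<epsilon>"
      proof (cases "j = 0 \<or> I x = 0")
        case True
        then have "\<phi> j \<le> - \<psi> (I x)" using lej by (simp add: d_def)
        then show ?thesis using c_nonneg[of "x - y j"] \<epsilon> by auto
      next
        case False
        then have xK: "x \<in> K" and jn: "j \<in> {1..n}" "I x \<in> {1..n}" using I0[of x] In[of x] j by auto
        have "c (y (I x) - y j) \<le> c (x - y j) + \<epsilon>"
          by (rule \<eta>(2)) (use xK yK jn y[OF xK] \<eta>(1) in \<open>auto simp: dist_commute\<close>)
        then show ?thesis using False lej c_commute[of "y j" "y (I x)"] by (simp add: d_def)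
      qed
    qed (use bd in auto)
    moreover have "(\<integral>x. ?a * (\<phi> (I x) - \<epsilon>) \<partial>\<nu>) - ln (\<integral>x. exp (?a * (\<phi> (I x) - \<epsilon>)) \<partial>\<mu>) \<le> h"
    proof -
      have bd': "\<bar>?a * (\<phi> (I x) - \<epsilon>)\<bar> \<le> ?a * M" for x
        using bd(1)[of x] a0 by (simp add: abs_mult)
      have m: "(\<lambda>x. ?a * (\<phi> (I x) - \<epsilon>)) \<in> borel_measurable \<mu>"
        by (rule measurable_compose[OF I'(2)]) simp
      show ?thesis using Gibbs[OF \<mu>p \<nu>p _ m bd'] sets\<nu> sets\<mu> h by simp
    qed
    ultimately have gap: "(\<integral>x. ?a * (\<phi> (I x) - \<epsilon>) \<partial>\<nu>) - ?a * (\<integral>x. - \<psi> (I x) + \<epsilon> \<partial>\<mu>) \<le> h" by linarith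
    have e1: "(\<integral>x. ?a * (\<phi> (I x) - \<epsilon>) \<partial>\<nu>) = ?a * ((\<Sum>i\<le>n. \<phi> i * p i) - \<epsilon>)"
    proof -
      have "(\<integral>x. ?a * (\<phi> (I x) - \<epsilon>) \<partial>\<nu>) = (\<Sum>i\<le>n. ?a * (\<phi> i - \<epsilon>) * p i)"
        by (rule idx(1))
      also have "\<dots> = ?a * ((\<Sum>i\<le>n. \<phi> i * p i) - \<epsilon> * sum p {..n})"
        by (simp add: sum_distrib_left sum_subtractf algebra_simps)
      finally show ?thesis by (simp add: p1)
    qed
    have e2: "(\<integral>x. - \<psi> (I x) + \<epsilon> \<partial>\<mu>) = - (\<Sum>j\<le>n. \<psi> j * r j) + \<epsilon>"
    proof -
      have "(\<integral>x. - \<psi> (I x) + \<epsilon> \<partial>\<mu>) = (\<Sum>i\<le>n. (- \<psi> i + \<epsilon>) * r i)"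
        by (rule idx(2))
      also have "\<dots> = - (\<Sum>j\<le>n. \<psi> j * r j) + \<epsilon> * sum r {..n}"
        by (simp add: sum_distrib_left sum.distrib sum_subtractf sum_negf algebra_simps)
      finally show ?thesis by (simp add: p1)
    qed
    have "?a * ((\<Sum>i\<le>n. \<phi> i * p i) + (\<Sum>j\<le>n. \<psi> j * r j) - 2 * \<epsilon>) \<le> h"
      using gap unfolding e1 e2 by (simp add: algebra_simps)
    then show ?thesis using a0 by (simp add: field_simps)
  qed
  obtain q where q: "\<And>i j. i \<in> {..n} \<Longrightarrow> j \<in> {..n} \<Longrightarrow> 0 \<le> q i j"
    "\<And>i. i \<in> {..n} \<Longrightarrow> (\<Sum>j\<le>n. q i j) = p i" "\<And>j. j \<in> {..n} \<Longrightarrow> (\<Sum>i\<le>n. q i j) = r j"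
    and qd: "(\<Sum>i\<le>n. \<Sum>j\<le>n. q i j * d i j) \<le> h / ?a + 2 * \<epsilon>"
    by (rule finite_Kantorovich[of "{..n}" p r d "h / ?a + 2 * \<epsilon>"])
       (use p1 dual in \<open>auto simp: p_def r_def\<close>)
  obtain \<pi> where \<pi>: "\<pi> \<in> couplings \<nu> \<mu>"
    and plan: "\<And>d. (\<integral>\<^sup>+ z. d (I (fst z)) (I (snd z)) \<partial>\<pi>) = (\<Sum>i\<le>n. \<Sum>j\<le>n. ennreal (q i j) * d i j)"
    using glued_coupling[OF \<nu> \<mu> I In, of q] q by (auto simp: p_def r_def)
  have sets\<pi>[measurable_cong]: "sets \<pi> = sets (borel \<Otimes>\<^sub>M borel)" and \<pi>p: "prob_space \<pi>"
    and fst: "distr \<pi> borel fst = \<nu>" and snd: "distr \<pi> borel snd = \<mu>"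
    using \<pi> by (auto simp: couplings_def space_prob_algebra)
  interpret \<pi>: prob_space \<pi> by fact
  have fm: "fst \<in> \<pi> \<rightarrow>\<^sub>M borel" "snd \<in> \<pi> \<rightarrow>\<^sub>M borel"
    by (simp_all only: measurable_cong_sets[OF sets\<pi> refl] measurable_fst measurable_snd)
  have d0: "0 \<le> d i j" for i j by (simp add: d_def c_nonneg)
  have pointwise: "c (x - x') \<le> d (I x) (I x') + \<epsilon> + B x + B x'"
    for x x' :: "real ^ 'k"
  proof (cases "I x = 0 \<or> I x' = 0")
    case True
    then have "R < c x \<or> R < c x'" using I0 by (auto simp: K_def not_le)
    then show ?thesis
      using c_diff_le[of x x'] c_nonneg[of x] c_nonneg[of x'] d0[of "I x" "I x'"] \<epsilon>
        by (auto simp: B_def indicator_def)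
  next
    case False
    then have xK: "x \<in> K" "x' \<in> K" and jn: "I x \<in> {1..n}" "I x' \<in> {1..n}"
      using I0[of x] In[of x] I0[of x'] In[of x'] by auto
    have "c (x - x') \<le> c (y (I x) - y (I x')) + \<epsilon>"
      by (rule \<eta>(2)) (use xK yK jn y in auto)
    then show ?thesis using False xK by (simp add: B_def d_def K_def indicator_def)
  qed
  have "transport_cost c \<nu> \<mu> \<le> (\<integral>\<^sup>+ (x, y). ennreal (c (x - y)) \<partial>\<pi>)"
    unfolding transport_cost_def by (rule INF_lower[OF \<pi>])
  also have "\<dots> \<le> (\<integral>\<^sup>+ z. ennreal (d (I (fst z)) (I (snd z))) + ennreal \<epsilon> + A (fst z) + A (snd z)
    \<partial>\<pi>)"
  proof (rule nn_integral_mono, clarify)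
    fix x x' :: "real ^ 'k"
    show "ennreal (c (x - x')) \<le> ennreal (d (I (fst (x, x'))) (I (snd (x, x')))) + ennreal \<epsilon> + A
      (fst (x, x')) + A (snd (x, x'))"
      using ennreal_leI[OF pointwise[of x x']] d0[of "I x" "I x'"] \<epsilon> B0[of x] B0[of x']
      by (simp add: A_def ennreal_plus[symmetric] del: ennreal_plus)
  qed
  also have "\<dots> = (\<integral>\<^sup>+ z. ennreal (d (I (fst z)) (I (snd z))) \<partial>\<pi>) + ennreal \<epsilon>
      + (\<integral>\<^sup>+ z. A (fst z) \<partial>\<pi>) + (\<integral>\<^sup>+ z. A (snd z) \<partial>\<pi>)"
  proof -
    from fm have [measurable]: "(\<lambda>z. A (fst z)) \<in> borel_measurable \<pi>" "(\<lambda>z. A (snd z)) \<in>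
      borel_measurable \<pi>"
      "(\<lambda>z. I (fst z)) \<in> \<pi> \<rightarrow>\<^sub>M count_space UNIV" "(\<lambda>z. I (snd z)) \<in> \<pi> \<rightarrow>\<^sub>M count_space UNIV"
      by (auto intro: measurable_compose)
    have [measurable]: "(\<lambda>z. ennreal (d (I (fst z)) (I (snd z)))) \<in> borel_measurable \<pi>"
      by measurable
    show ?thesis
      by (simp add: nn_integral_add \<pi>.emeasure_space_1)
  qed
  also have "(\<integral>\<^sup>+ z. A (fst z) \<partial>\<pi>) = (\<integral>\<^sup>+ x. A x \<partial>\<nu>)"
    unfolding fst[symmetric] by (rule nn_integral_distr[OF fm(1), symmetric]) simp
  also have "(\<integral>\<^sup>+ z. A (snd z) \<partial>\<pi>) = (\<integral>\<^sup>+ x. A x \<partial>\<mu>)"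
    unfolding snd[symmetric] by (rule nn_integral_distr[OF fm(2), symmetric]) simp
  also have "(\<integral>\<^sup>+ z. ennreal (d (I (fst z)) (I (snd z))) \<partial>\<pi>) = ennreal (\<Sum>i\<le>n. \<Sum>j\<le>n. q i j * d i j)"
  proof -
    have qd0: "0 \<le> q i j * d i j" if "i \<in> {..n}" "j \<in> {..n}" for i j
      using q(1) d0 that by simp
    have "(\<Sum>i\<le>n. \<Sum>j\<le>n. ennreal (q i j) * ennreal (d i j)) = (\<Sum>i\<le>n. \<Sum>j\<le>n. ennreal (q i j * d i j))"
      by (intro sum.cong refl) (use q(1) d0 in \<open>simp add: ennreal_mult\<close>)
    also have "\<dots> = (\<Sum>i\<le>n. ennreal (\<Sum>j\<le>n. q i j * d i j))"
      using qd0 by (intro sum.cong refl sum_ennreal)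
    also have "\<dots> = ennreal (\<Sum>i\<le>n. \<Sum>j\<le>n. q i j * d i j)"
      using qd0 by (intro sum_ennreal sum_nonneg)
    finally show ?thesis unfolding plan[of "\<lambda>i j. ennreal (d i j)"] .
  qed
  also have "\<dots> \<le> ennreal (h / ?a + 2 * \<epsilon>)" using qd by (rule ennreal_leI)
  also have "ennreal (h / ?a + 2 * \<epsilon>) + ennreal \<epsilon> + (\<integral>\<^sup>+ x. A x \<partial>\<nu>) + (\<integral>\<^sup>+ x. A x \<partial>\<mu>)
      \<le> ennreal (h / ?a + 2 * \<epsilon>) + ennreal \<epsilon> + ennreal \<epsilon> + ennreal \<epsilon>"
    by (intro add_mono order_refl A ci m sets\<nu> sets\<mu>)
  also have "\<dots> = ennreal (h / ?a) + ennreal \<epsilon>'"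
    using h0 a0 \<epsilon> by (simp add: \<epsilon>_def ennreal_plus[symmetric] del: ennreal_plus)
  finally show "transport_cost c \<nu> \<mu> \<le> ennreal (h / ?a) + ennreal \<epsilon>'" by (simp add: add_mono)
qed

end

theorem rMLSI_imp_transport:
  fixes \<mu> :: "(real ^ 'k) measure"
  assumes \<mu>: "\<mu> \<in> space (prob_algebra borel)" and C: "0 < C" and rM: "rMLSI \<mu> c C"
  shows "transport_ineq \<mu> c (8 * C)"
  unfolding transport_ineq_def
proof
  fix \<nu> :: "(real ^ 'k) measure" assume \<nu>: "\<nu> \<in> space (prob_algebra borel)"
  have nonneg: "0 \<le> rel_entropy \<nu> \<mu>"
    using \<nu> \<mu> by (intro rel_entropy_nonneg) (auto simp: space_prob_algebra)
  show "enn2ereal (transport_cost c \<nu> \<mu>) \<le> ereal (8 * C) * rel_entropy \<nu> \<mu>"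
  proof (cases "rel_entropy \<nu> \<mu>")
    case (real h)
    then have h: "0 \<le> h" using nonneg by simp
    have "transport_cost c \<nu> \<mu> \<le> ennreal (8 * C * h)"
    proof (cases "\<exists>t0. \<alpha> t0 \<noteq> 0")
      case True
      then obtain t0 where t0: "\<alpha> t0 \<noteq> 0" by blast
      have "transport_cost c \<nu> \<mu> \<le> ennreal (h / dual_rate C)"
        by (rule transport_cost_le_entropy[OF \<mu> C rM t0 \<nu> real])
      \<comment> \<open>The constant 12500/1569 is about 7.967.\<close>
      also have "h / dual_rate C \<le> 8 * C * h"
      proof -
        have "h / dual_rate C = 12500 / 1569 * (C * h)" using C
          by (simp add: dual_rate_def field_simps)
        also have "\<dots> \<le> 8 * (C * h)" using C h by (intro mult_right_mono) auto
        finally show ?thesis by simp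
      qed
      finally show ?thesis by (simp add: ennreal_leI)
    next
      case False
      \<comment> \<open>For \<alpha> = 0 sublevel sets of the cost are not compact, but every
        coupling is free of cost. With a single cell, \<open>glued_coupling\<close> yields the
        product coupling.\<close>
      then have c0: "c x = 0" for x :: "real ^ 'k" by (simp add: c_eq)
      obtain \<pi> where "\<pi> \<in> couplings \<nu> \<mu>"
      proof (rule glued_coupling[OF \<nu> \<mu>, of "\<lambda>_. 0" 0 "\<lambda>_ _. 1"])
        show "(\<Sum>j\<le>0 :: nat. 1) = measure \<nu> {x. 0 = i}" if "i \<le> 0" for i :: nat
          using \<nu> that prob_space.prob_space[of \<nu>] sets_eq_imp_space_eq[of \<nu> borel]
            by (simp add: space_prob_algebra)
        show "(\<Sum>i\<le>0 :: nat. 1) = measure \<mu> {x. 0 = j}" if "j \<le> 0" for j :: nat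
          using \<mu> that prob_space.prob_space[of \<mu>] sets_eq_imp_space_eq[of \<mu> borel]
            by (simp add: space_prob_algebra)
      qed auto
      then have "transport_cost c \<nu> \<mu> \<le> (\<integral>\<^sup>+ (x, y). ennreal (c (x - y)) \<partial>\<pi>)"
        unfolding transport_cost_def by (rule INF_lower)
      then show ?thesis by (simp add: c0 case_prod_unfold)
    qed
    then show ?thesis using real h C by (simp add: less_eq_ennreal.rep_eq enn2ereal_ennreal)
  next
    case PInf
    then show ?thesis using C by simp
  next
    case MInf
    then show ?thesis using nonneg by simp
  qed
qed

end

theorem theorem1p5:
  fixes \<alpha> :: "real \<Rightarrow> real" and c :: "real ^ 'k \<Rightarrow> real" and \<mu> :: "(real ^ 'k) measure"
  assumes "\<And>t. \<alpha> t \<ge> 0"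
    and "convex_on UNIV \<alpha>"
    and "\<And>t. \<alpha> (- t) = \<alpha> t"
    and "\<alpha> C1_differentiable_on UNIV"
    and "\<alpha> 0 = 0" and "deriv \<alpha> 0 = 0"
    and "concave_on {0..} (deriv \<alpha>)"
    and "c = sep_cost \<alpha>"
    and "\<mu> \<in> space (prob_algebra borel)"
  shows "((\<exists>C1>0. transport_ineq \<mu> c C1) \<longleftrightarrow> (\<exists>C2>0. ICLSI \<mu> c C2)) \<and>
         ((\<exists>C2>0. ICLSI \<mu> c C2) \<longleftrightarrow> (\<exists>C3>0. rMLSI \<mu> c C3)) \<and>
         (\<forall>C1>0. transport_ineq \<mu> c C1 \<longrightarrow> ICLSI \<mu> c C1) \<and>
         (\<forall>C2>0. ICLSI \<mu> c C2 \<longrightarrow> rMLSI \<mu> c C2) \<and>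
         (\<forall>C3>0. rMLSI \<mu> c C3 \<longrightarrow> transport_ineq \<mu> c (8 * C3))"
proof -
  interpret cost_profile \<alpha>
    using assms(1-7) by unfold_locales
  have c_sep: "c = cost_profile.c \<alpha>"
    using assms(8) by (simp add: c_def)
  have 12: "ICLSI \<mu> c C" if "0 < C" "transport_ineq \<mu> c C" for C
    by (rule transport_imp_ICLSI[OF _ _ _ assms(9) that])
       (simp_all add: c_sep c_continuous c_nonneg c_zero)
  have 23: "rMLSI \<mu> c C" if "0 < C" "ICLSI \<mu> c C" for C
    using ICLSI_imp_rMLSI[of C \<mu>] that unfolding c_sep by blast
  have 31: "transport_ineq \<mu> c (8 * C)" if "0 < C" "rMLSI \<mu> c C" for C
    using rMLSI_imp_transport[OF assms(9), of C] that unfolding c_sep by blast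
  have 32: "\<exists>C2>0. ICLSI \<mu> c C2" if "0 < C" "rMLSI \<mu> c C" for C
    using that 31 12[of "8 * C"] by (intro exI[of _ "8 * C"]) auto
  have 21: "\<exists>C1>0. transport_ineq \<mu> c C1" if "0 < C" "ICLSI \<mu> c C" for C
    using that 23 31 by (intro exI[of _ "8 * C"]) auto
  show ?thesis
    using 12 23 31 32 21 by blast
qed

end
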